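(* Consider complete variable selection, i.e. $m(k)=\binom{p}{k}$ for $k=1,\ldots,r-1$, for a sequence of regression models $\mathbf{y}=X_p\boldsymbol{\beta}_p+\boldsymbol{\epsilon}$ with nearly-orthogonal design and $r=\mathrm{rank}(X_p)\to\infty$. As $r$ increases: 1. $$\inf_{\tilde{\mathbf{y}}}\sup_{\boldsymbol{\beta}_M:\,M\in\mathfrak{M}_{p_0}}E\|\tilde{\mathbf{y}}-X_p\boldsymbol{\beta}_M\|^2\asymp\sigma^2p_0\left(\ln(p/p_0)+1\right)$$ for all $p_0=1,\ldots,r$, where the infimum is over all estimators $\tilde{\mathbf{y}}$ of the mean vector. 2. Let $\gamma>0$ and $c(\gamma)=8(\gamma+3/4)^2$, and assume that for some constant $c>c(\gamma)$, $$\left(\frac{k}{pe}\right)^{ck}\le\pi(k)\le\left(\frac{p}{ke^{c(\gamma)}}\right)^k,\quad k=1,\ldots,r-1,\qquad\text{and}\qquad e^{-cr}\le\pi(r)\le e^{-c(\gamma)r}.$$ Then the resulting MAP estimator $X_p\hat{\boldsymbol{\beta}}_{\hat M}$ attains the minimax rates simultaneously over all $\mathfrak{M}_{p_0}$, $1\le p_0\le r$; that is, there is a constant $C>0$ such that for all sufficiently large $r$ and all $1\le p_0\le r$, $$\sup_{\boldsymbol{\beta}_M:\,M\in\mathfrak{M}_{p_0}}E\|X_p\hat{\boldsymbol{\beta}}_{\hat M}-X_p\boldsymbol{\beta}_M\|^2\le C\inf_{\tilde{\mathbf{y}}}\sup_{\boldsymbol{\beta}_M:\,M\in\mathfrak{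M}_{p_0}}E\|\tilde{\mathbf{y}}-X_p\boldsymbol{\beta}_M\|^2.$$
   Context: Asymptotic setup: a sequence indexed by the sample size $n$ of models $\mathbf{y}=X_p\boldsymbol{\beta}_p+\boldsymbol{\epsilon}$, where $p=p_n$ may grow with $n$ (possibly $p>n$), $X_p\in\mathbb{R}^{n\times p}$ with columns (predictors) $X_1,\ldots,X_p$, $\boldsymbol{\epsilon}\sim N(\mathbf{0},\sigma^2I_n)$, with $\sigma^2>0$ known and not depending on $n,p$; $r=r_n=\mathrm{rank}(X_p)\to\infty$, and any $r$ columns of $X_p$ are linearly independent. The index $n$ is suppressed; the priors $\pi$ also depend on $n$, while $\gamma$ and $c$ do not. The relation $a\asymp b$ means that $C_1b\le a\le C_2b$ for all sufficiently large $r$ with constants $0<C_1\le C_2<\infty$ not depending on $n$, $p$, $r$, $p_0$. A model $M$ is a subset of the predictors, encoded by $D_M=\mathrm{diag}(\mathbf{d}_M)$, $d_{Mj}=1$ if $X_j\in M$ and $0$ otherwise; its size is $|M|=\mathrm{tr}(D_M)$. The least squares estimator for $M$ is $\hat{\boldsymbol{\beta}}_M=(D_MX_p'X_pD_M)^+D_MX_p'\mathbf{y}$. In complete variable selection all subsets of predictors of size at most $r-1$ are admissible, including the null model ($m(0)=1$); all models of size $r$ are identified with a single saturated model, represented by a fixed set of $r$ columns, so $m(r)=1$. $\mathcal{M}_k$ is the set of admissible models of size $k$, $m(k)=\mathrm{card}(\mathcal{M}_k)$, and $\mathfrak{M}_{p_0}=\bigcup_{k=0}^{p_0}\mathcal{M}_k$.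 For a model $M$, $\boldsymbol{\beta}_M\in\mathbb{R}^p$ denotes a coefficient vector with $\beta_{Mj}\neq0$ iff $X_j\in M$; suprema are over all such vectors with $M\in\mathfrak{M}_{p_0}$, and expectations are under $\mathbf{y}=X_p\boldsymbol{\beta}_M+\boldsymbol{\epsilon}$. The prior $\pi(k)$, $k=0,\ldots,r$, is a probability distribution on model sizes with $\pi(k)>0$ for all $k$. The MAP model $\hat M$ is a minimizer over admissible $M$ of $$\|\mathbf{y}-X_p\hat{\boldsymbol{\beta}}_M\|^2+2\sigma^2(1+1/\gamma)\ln\left\{m(|M|)\pi(|M|)^{-1}(1+\gamma)^{|M|/2}\right\}.$$ Sparse eigenvalue ratios: $\tau_p[k]=\phi_{min}[k]/\phi_{max}[k]$, where $\phi_{min}[k]$ and $\phi_{max}[k]$ are the minimum and maximum of $\|X_p\boldsymbol{\beta}\|^2/\|\boldsymbol{\beta}\|^2$ over $\boldsymbol{\beta}$ with between $1$ and $k$ nonzero entries. The design is nearly-orthogonal if the sequence $\tau_p[r]$ is bounded away from zero. *)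

theory Defs
  imports "HOL-Probability.Probability" "Jordan_Normal_Form.DL_Rank"
begin

definition sqn :: "real vec \<Rightarrow> real" where
  "sqn v = scalar_prod v v"

definition nonzero_entries :: "real vec \<Rightarrow> nat set" where
  "nonzero_entries v = {j. j < dim_vec v \<and> vec_index v j \<noteq> 0}"


(* Columns are indexed, so a repeated column counts as a dependence: hence inj_on. *)
definition cols_lin_indpt :: "real mat \<Rightarrow> nat set \<Rightarrow> bool" where
  "cols_lin_indpt A J \<longleftrightarrow>
     inj_on (col A) J \<and>
     module.lin_indpt class_ring (module_vec TYPE(real) (dim_row A)) (col A ` J)"

(* On nonempty sets of admissible vectors, Inf and Sup are a minimum and a maximum:
   the quotient is scale invariant and the k-sparse unit vectors form a compact set. *)
definition phi_min :: "real mat \<Rightarrow> nat \<Rightarrow> real" where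
  "phi_min A k = Inf {sqn (A *\<^sub>v b) / sqn b | b. b \<in> carrier_vec (dim_col A) \<and>
     1 \<le> card (nonzero_entries b) \<and> card (nonzero_entries b) \<le> k}"

definition phi_max :: "real mat \<Rightarrow> nat \<Rightarrow> real" where
  "phi_max A k = Sup {sqn (A *\<^sub>v b) / sqn b | b. b \<in> carrier_vec (dim_col A) \<and>
     1 \<le> card (nonzero_entries b) \<and> card (nonzero_entries b) \<le> k}"

definition tau :: "real mat \<Rightarrow> nat \<Rightarrow> real" where
  "tau A k = phi_min A k / phi_max A k"

(* The ratio has no meaning for rank 0 (there are no vectors to range over),
   which always occurs at n = 0; such n are left out. *)
definition nearly_orthogonal :: "(nat \<Rightarrow> real mat) \<Rightarrow> (nat \<Rightarrow> nat) \<Rightarrow> bool" where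
  "nearly_orthogonal X r \<longleftrightarrow> (\<exists>\<delta>>0. \<forall>n. 1 \<le> r n \<longrightarrow> \<delta> \<le> tau (X n) (r n))"


(* Borel sigma-algebra of R^n, transported to the vectors of dimension n. *)
definition borel_vec :: "nat \<Rightarrow> real vec measure" where
  "borel_vec n = vimage_algebra (carrier_vec n)
     (\<lambda>v. \<lambda>i\<in>{..<n}. vec_index v i) (PiM {..<n} (\<lambda>_. borel))"

(* N(0, sigma^2 I_n); the second parameter of normal_density is the standard deviation. *)
definition gauss_noise :: "nat \<Rightarrow> real \<Rightarrow> real vec measure" where
  "gauss_noise n \<sigma> =
     distr (PiM {..<n} (\<lambda>_. density lborel (normal_density 0 \<sigma>))) (borel_vec n) (Matrix.vec n)"

definition estimators :: "nat \<Rightarrow> (real vec \<Rightarrow> real vec) set" where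
  "estimators n = measurable (borel_vec n) (borel_vec n)"

(* Expected squared error of f(y) for the mean vector mu when y = mu + eps.
   It is extended-real valued: the risk of an estimator may be infinite. *)
definition risk :: "nat \<Rightarrow> real \<Rightarrow> (real vec \<Rightarrow> real vec) \<Rightarrow> real vec \<Rightarrow> ennreal" where
  "risk n \<sigma> f \<mu> = (\<integral>\<^sup>+ e. ennreal (sqn (f (\<mu> + e) - \<mu>)) \<partial>gauss_noise n \<sigma>)"


(* Complete variable selection. A model is the set of indices of its predictors among
   {..<p}; S is the set of r columns that represents the saturated model. *)
definition models :: "nat \<Rightarrow> nat \<Rightarrow> nat set \<Rightarrow> nat \<Rightarrow> nat set set" where
  "models p r S k =
     (if k < r then {M. M \<subseteq> {..<p} \<and> card M = k} else if k = r then {S} else {})"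

definition num_models :: "nat \<Rightarrow> nat \<Rightarrow> nat set \<Rightarrow> nat \<Rightarrow> nat" where
  "num_models p r S k = card (models p r S k)"

definition models_upto :: "nat \<Rightarrow> nat \<Rightarrow> nat set \<Rightarrow> nat \<Rightarrow> nat set set" where
  "models_upto p r S k0 = (\<Union>k\<le>k0. models p r S k)"

definition coeffs_upto :: "nat \<Rightarrow> nat \<Rightarrow> nat set \<Rightarrow> nat \<Rightarrow> real vec set" where
  "coeffs_upto p r S k0 =
     {b \<in> carrier_vec p. \<exists>M\<in>models_upto p r S k0. \<forall>j<p. vec_index b j \<noteq> 0 \<longleftrightarrow> j \<in> M}"

definition sup_risk ::
    "real mat \<Rightarrow> nat \<Rightarrow> nat set \<Rightarrow> real \<Rightarrow> (real vec \<Rightarrow> real vec) \<Rightarrow> nat \<Rightarrow> ennreal" where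
  "sup_risk A r S \<sigma> f k0 =
     (SUP b\<in>coeffs_upto (dim_col A) r S k0. risk (dim_row A) \<sigma> f (A *\<^sub>v b))"

definition minimax_risk :: "real mat \<Rightarrow> nat \<Rightarrow> nat set \<Rightarrow> real \<Rightarrow> nat \<Rightarrow> ennreal" where
  "minimax_risk A r S \<sigma> k0 = (INF f\<in>estimators (dim_row A). sup_risk A r S \<sigma> f k0)"


(* Moore-Penrose inverse, by the four Penrose equations. *)
definition is_pinv :: "real mat \<Rightarrow> real mat \<Rightarrow> bool" where
  "is_pinv A B \<longleftrightarrow> B \<in> carrier_mat (dim_col A) (dim_row A) \<and>
     A * B * A = A \<and> B * A * B = B \<and>
     transpose_mat (A * B) = A * B \<and> transpose_mat (B * A) = B * A"

definition pinv :: "real mat \<Rightarrow> real mat" where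
  "pinv A = (THE B. is_pinv A B)"

definition model_diag :: "nat \<Rightarrow> nat set \<Rightarrow> real mat" where
  "model_diag p M = Matrix.mat p p (\<lambda>(i, j). if i = j \<and> j \<in> M then 1 else 0)"

definition lse :: "real mat \<Rightarrow> nat set \<Rightarrow> real vec \<Rightarrow> real vec" where
  "lse A M y = (let D = model_diag (dim_col A) M in
     (pinv (D * transpose_mat A * A * D) * D * transpose_mat A) *\<^sub>v y)"

definition map_criterion ::
    "real mat \<Rightarrow> nat \<Rightarrow> nat set \<Rightarrow> real \<Rightarrow> real \<Rightarrow> (nat \<Rightarrow> real) \<Rightarrow> real vec \<Rightarrow> nat set \<Rightarrow> real" where
  "map_criterion A r S \<sigma> \<gamma> \<pi> y M =
     sqn (y - A *\<^sub>v lse A M y) +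
     2 * \<sigma>\<^sup>2 * (1 + 1 / \<gamma>) *
       ln (real (num_models (dim_col A) r S (card M)) * inverse (\<pi> (card M)) *
           (1 + \<gamma>) powr (real (card M) / 2))"

(* A MAP model as a (measurable) function of the data; ties may be broken arbitrarily. *)
definition map_selector ::
    "real mat \<Rightarrow> nat \<Rightarrow> nat set \<Rightarrow> real \<Rightarrow> real \<Rightarrow> (nat \<Rightarrow> real) \<Rightarrow> (real vec \<Rightarrow> nat set) \<Rightarrow> bool" where
  "map_selector A r S \<sigma> \<gamma> \<pi> Mhat \<longleftrightarrow>
     Mhat \<in> measurable (borel_vec (dim_row A)) (count_space UNIV) \<and>
     (\<forall>y\<in>carrier_vec (dim_row A).
        Mhat y \<in> models_upto (dim_col A) r S r \<and>
        (\<forall>M\<in>models_upto (dim_col A) r S r.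
           map_criterion A r S \<sigma> \<gamma> \<pi> y (Mhat y) \<le> map_criterion A r S \<sigma> \<gamma> \<pi> y M))"

definition map_estimator :: "real mat \<Rightarrow> (real vec \<Rightarrow> nat set) \<Rightarrow> real vec \<Rightarrow> real vec" where
  "map_estimator A Mhat y = A *\<^sub>v lse A (Mhat y) y"

definition size_prior :: "nat \<Rightarrow> (nat \<Rightarrow> real) \<Rightarrow> bool" where
  "size_prior r \<pi> \<longleftrightarrow> (\<forall>k\<le>r. 0 < \<pi> k) \<and> (\<Sum>k\<le>r. \<pi> k) = 1"

definition c_gamma :: "real \<Rightarrow> real" where
  "c_gamma \<gamma> = 8 * (\<gamma> + 3 / 4)\<^sup>2"

end

theory Submission
  imports Defs
begin

text \<open>
  Both halves of the result compare a risk with the complexity $k(\ln(p/k)+1)$ of a model of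
  size $k$, which bounds the logarithm of the number of models of that size and is comparable with it for
  $1 \le k \le p/2$.

  \<^emph>\<open>Upper bound.\<close> Let $\mu$ be the true mean, $\hat y$ the fit of the selected model $N$, and
  $u = \hat y - \mu$. Comparing the criterion at $N$ with its value at a model $M$ that contains the
  true predictors gives $\|u\|^2 \le 2\langle\epsilon,u\rangle + \mathrm{pen}(M) - \mathrm{pen}(N)$. The vector $u$
  lies in the space spanned by $\mu$ and the columns of $N$, whose dimension is at most $|N|+1$, so
  $2\langle\epsilon,u\rangle$ is at most $a\|u\|^2$ plus $1/a$ times the squared norm $Q_N$ of the projection of
  the noise onto that space. The random index $N$ is removed by $x \le (\sigma^2/s)\exp(sx/\sigma^2)$ and a sum over
  all models. Since $Q_N/\sigma^2$ is chi-square, the expectation of $\exp(tQ_N/\sigma^2)$ is an explicit power of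
  $1/(1-2t)$. For $s = \gamma/(2(1+\gamma))$ and $a = 1$ the factor $(1+\gamma)^{|N|/2}$ in the criterion
  would cancel this power up to $\sqrt{1+\gamma}$, and what remains, the weight $\pi(k)/m(k)$ for each model of
  size $k$, sums to one. Absorbing $a\|u\|^2$ needs
  $a < 1$; the loss is paid for by the condition $\ln(m(k)/\pi(k)) \ge c(\gamma)k$, which is what the upper
  bounds on the prior provide. The lower bounds on the prior make $\mathrm{pen}(M)$ at most a constant times
  $\sigma^2$ times the complexity. This is \<open>sup_risk_map_le\<close>; applied to a geometric prior it also bounds the minimax
  risk from above.

  \<^emph>\<open>Lower bound.\<close> Scale the design so that $\phi_{max}[r] = 1$. Take $q \asymp p_0$ disjoint blocks of
  $m = \lfloor p/q\rfloor$ predictors and consider coefficient vectors with one entry $a$ in each block, in an arbitrary position. An estimator of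
  the mean yields a guess of all positions, by taking the nearest candidate mean, and near-orthogonality makes
  the loss at least a constant times $a^2$ for each wrong block. Within one block, with the
  other blocks fixed, there are $m$ means at distance at most $a$ from a common centre; if $a^2$ is a small multiple
  of $\sigma^2\ln m$, a change of measure to the centre shows that the guess fails with
  probability at least $1/8$ on average over the position. Averaging over all positions turns this into risk of order
  $qa^2 \asymp \sigma^2p_0(\ln(p/p_0)+1)$; see \<open>sup_risk_ge_blocks\<close>.

  Near-orthogonality enters only through \<open>sparse_eigenvalue_bounds\<close>: on $r$-sparse vectors the
  design is injective and distorts squared norms by a bounded factor.
\<close>

section \<open>Gaussian integrals\<close>

text \<open>The law of the coordinates of the noise, of which the law of the noise vector is an image. On a
  product measure, integrals of products factor and Fubini's theorem applies.\<close>

definition noise_coords :: "nat \<Rightarrow> real \<Rightarrow> (nat \<Rightarrow> real) measure" where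
  "noise_coords n \<sigma> = PiM {..<n} (\<lambda>_. density lborel (normal_density 0 \<sigma>))"

abbreviation gaussian :: "real \<Rightarrow> real \<Rightarrow> real measure" where
  "gaussian m \<sigma> \<equiv> density lborel (normal_density m \<sigma>)"

lemma prob_space_normal: "0 < \<sigma> \<Longrightarrow> prob_space (gaussian m \<sigma>)"
  by (rule prob_space_normal_density)

lemma product_sigma_finite_normal:
  "0 < \<sigma> \<Longrightarrow> product_sigma_finite (\<lambda>i::'i. gaussian (m i) \<sigma>)"
  using prob_space_normal prob_space_imp_sigma_finite unfolding product_sigma_finite_def by blast

lemma nn_integral_normal_density_one: "0 < \<sigma> \<Longrightarrow> (\<integral>\<^sup>+x. ennreal (normal_density m \<sigma> x) \<partial>lborel) = 1"
  using prob_space.emeasure_space_1[OF prob_space_normal[of \<sigma> m]] by (simp add: emeasure_density)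

text \<open>Completing the square: tilting a centred Gaussian density by $e^{lx}$ moves its mean and
  rescales it. Both the moment generating function and the change of measure come from this.\<close>

lemma normal_density_tilt:
  assumes "0 < \<sigma>"
  shows "normal_density 0 \<sigma> x * exp (l * x) = exp (l\<^sup>2 * \<sigma>\<^sup>2 / 2) * normal_density (l * \<sigma>\<^sup>2) \<sigma> x"
proof -
  have "- (x - 0)\<^sup>2 / (2 * \<sigma>\<^sup>2) + l * x = l\<^sup>2 * \<sigma>\<^sup>2 / 2 + (- (x - l * \<sigma>\<^sup>2)\<^sup>2 / (2 * \<sigma>\<^sup>2))"
    using assms by (simp add: field_simps power2_eq_square)
  then have "exp (- (x - 0)\<^sup>2 / (2 * \<sigma>\<^sup>2)) * exp (l * x)
      = exp (l\<^sup>2 * \<sigma>\<^sup>2 / 2) * exp (- (x - l * \<sigma>\<^sup>2)\<^sup>2 / (2 * \<sigma>\<^sup>2))"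
    by (simp only: exp_add[symmetric])
  then show ?thesis by (simp add: normal_density_def)
qed

lemma nn_integral_normal_exp_linear:
  assumes "0 < \<sigma>"
  shows "(\<integral>\<^sup>+x. ennreal (exp (l * x)) \<partial>gaussian 0 \<sigma>) = ennreal (exp (l\<^sup>2 * \<sigma>\<^sup>2 / 2))"
proof -
  have "(\<integral>\<^sup>+x. ennreal (exp (l * x)) \<partial>gaussian 0 \<sigma>)
      = (\<integral>\<^sup>+x. ennreal (exp (l\<^sup>2 * \<sigma>\<^sup>2 / 2)) * ennreal (normal_density (l * \<sigma>\<^sup>2) \<sigma> x) \<partial>lborel)"
    by (subst nn_integral_density)
       (auto simp: ennreal_mult[symmetric] normal_density_tilt[OF assms] intro!: nn_integral_cong)
  also have "\<dots> = ennreal (exp (l\<^sup>2 * \<sigma>\<^sup>2 / 2))"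
    by (subst nn_integral_cmult) (auto simp: nn_integral_normal_density_one[OF assms])
  finally show ?thesis .
qed

lemma nn_integral_normal_exp_square:
  assumes "t < 1 / 2"
  shows "(\<integral>\<^sup>+x. ennreal (exp (t * x\<^sup>2)) \<partial>gaussian 0 1) = ennreal (1 / sqrt (1 - 2 * t))"
proof -
  define s where "s = 1 / sqrt (1 - 2 * t)"
  have s: "0 < s" "1 / s\<^sup>2 = 1 - 2 * t" using assms by (auto simp: s_def power_divide)
  have "normal_density 0 1 x * exp (t * x\<^sup>2) = s * normal_density 0 s x" for x
  proof -
    have "- x\<^sup>2 / 2 + t * x\<^sup>2 = - x\<^sup>2 * (1 / s\<^sup>2) / 2"
      unfolding s(2) by (simp add: algebra_simps)
    then have "exp (- x\<^sup>2 / 2) * exp (t * x\<^sup>2) = exp (- x\<^sup>2 / (2 * s\<^sup>2))"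
      by (simp add: exp_add[symmetric])
    then show ?thesis using s by (simp add: normal_density_def real_sqrt_mult)
  qed
  then have "(\<integral>\<^sup>+x. ennreal (exp (t * x\<^sup>2)) \<partial>gaussian 0 1)
      = (\<integral>\<^sup>+x. ennreal s * ennreal (normal_density 0 s x) \<partial>lborel)"
    using s by (subst nn_integral_density)
       (auto simp: ennreal_mult[symmetric] intro!: nn_integral_cong)
  also have "\<dots> = ennreal s"
    by (subst nn_integral_cmult) (auto simp: nn_integral_normal_density_one[OF s(1)])
  finally show ?thesis by (simp add: s_def)
qed

lemma measurable_coord:
  "i < n \<Longrightarrow> (\<lambda>e. e i) \<in> borel_measurable (noise_coords n \<sigma>)"
proof -
  assume "i < n"
  then have "(\<lambda>e. e i) \<in> measurable (noise_coords n \<sigma>) (gaussian 0 \<sigma>)"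
    unfolding noise_coords_def by (intro measurable_component_singleton) simp
  then show ?thesis by (simp add: measurable_def)
qed

lemma prob_space_noise_coords: "0 < \<sigma> \<Longrightarrow> prob_space (noise_coords n \<sigma>)"
  unfolding noise_coords_def by (intro prob_space_PiM prob_space_normal)

lemma nn_integral_noise_exp_linear:
  assumes "0 < \<sigma>"
  shows "(\<integral>\<^sup>+e. ennreal (exp (\<Sum>i<n. l i * e i)) \<partial>noise_coords n \<sigma>)
    = ennreal (exp ((\<Sum>i<n. (l i)\<^sup>2) * \<sigma>\<^sup>2 / 2))"
proof -
  interpret product_sigma_finite "\<lambda>_::nat. gaussian 0 \<sigma>"
    by (rule product_sigma_finite_normal[OF assms, of "\<lambda>_. 0"])
  have "(\<integral>\<^sup>+e. ennreal (exp (\<Sum>i<n. l i * e i)) \<partial>noise_coords n \<sigma>)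
      = (\<integral>\<^sup>+e. (\<Prod>i<n. ennreal (exp (l i * e i))) \<partial>noise_coords n \<sigma>)"
    by (simp add: exp_sum prod_ennreal)
  also have "\<dots> = (\<Prod>i<n. \<integral>\<^sup>+x. ennreal (exp (l i * x)) \<partial>gaussian 0 \<sigma>)"
    unfolding noise_coords_def by (rule product_nn_integral_prod) auto
  also have "\<dots> = ennreal (exp (\<Sum>i<n. (l i)\<^sup>2 * \<sigma>\<^sup>2 / 2))"
    by (simp add: nn_integral_normal_exp_linear[OF assms] prod_ennreal exp_sum)
  finally show ?thesis by (simp add: sum_distrib_right sum_divide_distrib)
qed

text \<open>Only orthonormality matters, so the norm of $\sum_i g_iw_i$ does not depend on the system.\<close>

lemma sum_square_orthonormal_combination:
  fixes w :: "nat \<Rightarrow> nat \<Rightarrow> real"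
  assumes "\<And>i k. i < d \<Longrightarrow> k < d \<Longrightarrow> (\<Sum>j<n. w i j * w k j) = (if i = k then 1 else 0)"
  shows "(\<Sum>j<n. (\<Sum>i<d. g i * w i j)\<^sup>2) = (\<Sum>i<d. (g i)\<^sup>2)"
proof -
  have "(\<Sum>j<n. (\<Sum>i<d. g i * w i j)\<^sup>2) = (\<Sum>j<n. \<Sum>i<d. \<Sum>k<d. g i * g k * (w i j * w k j))"
    by (simp add: power2_eq_square sum_product algebra_simps)
  also have "\<dots> = (\<Sum>i<d. \<Sum>k<d. g i * g k * (\<Sum>j<n. w i j * w k j))"
    unfolding sum_distrib_left
    by (subst sum.swap, rule sum.cong[OF refl], rule sum.swap)
  also have "\<dots> = (\<Sum>i<d. \<Sum>k<d. if i = k then g i * g k else 0)"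
    by (intro sum.cong refl) (simp add: assms)
  also have "\<dots> = (\<Sum>i<d. (g i)\<^sup>2)" by (simp add: power2_eq_square)
  finally show ?thesis .
qed

text \<open>Rotation invariance of the Gaussian law is avoided by the identity
  $e^{tz^2} = E\,e^{\sqrt{2t}\,gz}$ with an auxiliary standard Gaussian $g$ for each direction: after exchanging the
  two integrals, the noise is integrated out of a linear exponent, and orthonormality
  leaves the product of the one-dimensional integrals of $e^{tg_i^2}$.\<close>

lemma nn_integral_noise_exp_projection:
  fixes w :: "nat \<Rightarrow> nat \<Rightarrow> real"
  assumes \<sigma>: "0 < \<sigma>" and t: "0 \<le> t" "t < 1 / 2"
    and on: "\<And>i k. i < d \<Longrightarrow> k < d \<Longrightarrow> (\<Sum>j<n. w i j * w k j) = (if i = k then 1 else 0)"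
  shows "(\<integral>\<^sup>+e. ennreal (exp (t / \<sigma>\<^sup>2 * (\<Sum>i<d. (\<Sum>j<n. e j * w i j)\<^sup>2))) \<partial>noise_coords n \<sigma>)
    = ennreal ((1 / sqrt (1 - 2 * t)) ^ d)"
proof -
  interpret G: product_sigma_finite "\<lambda>_::nat. gaussian 0 1"
    by (rule product_sigma_finite_normal[of 1 "\<lambda>_. 0"]) simp
  interpret E: prob_space "noise_coords n \<sigma>" by (rule prob_space_noise_coords[OF \<sigma>])
  interpret D: prob_space "noise_coords d 1" by (rule prob_space_noise_coords) simp
  interpret P: pair_sigma_finite "noise_coords d 1" "noise_coords n \<sigma>" ..
  define z where "z e i = (\<Sum>j<n. e j * w i j)" for e i
  define a where "a = sqrt (2 * t) / \<sigma>"
  have a2: "a\<^sup>2 = 2 * t / \<sigma>\<^sup>2" using t by (simp add: a_def power_divide)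
  \<comment> \<open>the auxiliary Gaussian variables $g$ linearize the exponent\<close>
  have hs: "ennreal (exp (t / \<sigma>\<^sup>2 * (\<Sum>i<d. (z e i)\<^sup>2)))
      = (\<integral>\<^sup>+g. ennreal (exp (\<Sum>i<d. (a * z e i) * g i)) \<partial>noise_coords d 1)" for e
    unfolding nn_integral_noise_exp_linear[of 1, simplified]
    by (simp add: power_mult_distrib a2 sum_distrib_left sum_divide_distrib sum_distrib_right mult_ac)
  have lin: "(\<Sum>i<d. (a * z e i) * g i) = (\<Sum>j<n. (a * (\<Sum>i<d. g i * w i j)) * e j)" for e g
    unfolding z_def by (simp add: sum_distrib_left sum_distrib_right mult_ac) (rule sum.swap)
  have sq: "(\<Sum>j<n. (\<Sum>i<d. g i * w i j)\<^sup>2) = (\<Sum>i<d. (g i)\<^sup>2)" for g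
    by (rule sum_square_orthonormal_combination) (rule on)
  have "(\<integral>\<^sup>+e. ennreal (exp (t / \<sigma>\<^sup>2 * (\<Sum>i<d. (z e i)\<^sup>2))) \<partial>noise_coords n \<sigma>)
      = (\<integral>\<^sup>+e. \<integral>\<^sup>+g. ennreal (exp (\<Sum>i<d. (a * z e i) * g i)) \<partial>noise_coords d 1 \<partial>noise_coords n \<sigma>)"
    by (simp only: hs)
  also have "\<dots> = (\<integral>\<^sup>+g. \<integral>\<^sup>+e. ennreal (exp (\<Sum>i<d. (a * z e i) * g i)) \<partial>noise_coords n \<sigma> \<partial>noise_coords d 1)"
  proof (rule P.Fubini')
    note [measurable] = measurable_coord
    show "(\<lambda>(g, e). ennreal (exp (\<Sum>i<d. (a * z e i) * g i)))
        \<in> borel_measurable (noise_coords d 1 \<Otimes>\<^sub>M noise_coords n \<sigma>)"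
      unfolding z_def by measurable
  qed
  also have "\<dots> = (\<integral>\<^sup>+g. ennreal (exp (t * (\<Sum>i<d. (g i)\<^sup>2))) \<partial>noise_coords d 1)"
    unfolding lin nn_integral_noise_exp_linear[OF \<sigma>] power_mult_distrib sum_distrib_left[symmetric]
      sq a2 using \<sigma> by simp
  also have "\<dots> = (\<integral>\<^sup>+g. (\<Prod>i<d. ennreal (exp (t * (g i)\<^sup>2))) \<partial>noise_coords d 1)"
    by (simp add: sum_distrib_left exp_sum prod_ennreal)
  also have "\<dots> = (\<Prod>i<d. \<integral>\<^sup>+x. ennreal (exp (t * x\<^sup>2)) \<partial>gaussian 0 1)"
    unfolding noise_coords_def by (rule G.product_nn_integral_prod) auto
  also have "\<dots> = ennreal ((1 / sqrt (1 - 2 * t)) ^ d)"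
    using t by (simp add: nn_integral_normal_exp_square prod_ennreal ennreal_power)
  finally show ?thesis by (simp add: z_def)
qed

text \<open>Both sides are product measures: translating every coordinate and multiplying by the
  likelihood ratio both turn the factor $N(0,\sigma^2)$ into $N(h_i,\sigma^2)$.\<close>

lemma noise_coords_shift:
  assumes \<sigma>: "0 < \<sigma>"
  shows "distr (noise_coords n \<sigma>) (PiM {..<n} (\<lambda>_. borel)) (\<lambda>e. \<lambda>i\<in>{..<n}. e i + h i)
    = density (noise_coords n \<sigma>) (\<lambda>e. ennreal (exp ((\<Sum>i<n. h i * e i) / \<sigma>\<^sup>2 - (\<Sum>i<n. (h i)\<^sup>2) / (2 * \<sigma>\<^sup>2))))"
    (is "?L = ?R")
proof -
  interpret N: product_sigma_finite "\<lambda>_::nat. gaussian 0 \<sigma>"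
    by (rule product_sigma_finite_normal[OF \<sigma>, of "\<lambda>_. 0"])
  interpret H: product_sigma_finite "\<lambda>i::nat. gaussian (h i) \<sigma>"
    by (rule product_sigma_finite_normal[OF \<sigma>, of "h"])
  have setsN: "sets (PiM {..<n} (\<lambda>i. gaussian (h i) \<sigma>)) = sets (PiM {..<n} (\<lambda>_. borel))"
    by (rule sets_PiM_cong) auto
  have setsL: "sets ?L = sets (PiM {..<n} (\<lambda>i. gaussian (h i) \<sigma>))" using setsN by simp
  have setsR: "sets ?R = sets (PiM {..<n} (\<lambda>i. gaussian (h i) \<sigma>))"
    unfolding setsN sets_density noise_coords_def by (rule sets_PiM_cong) auto
  have space: "space (noise_coords n \<sigma>) = Pi\<^sub>E {..<n} (\<lambda>_. UNIV)"
    by (simp add: noise_coords_def space_PiM)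
  have m: "(\<lambda>e. \<lambda>i\<in>{..<n}. e i + h i) \<in> measurable (noise_coords n \<sigma>) (PiM {..<n} (\<lambda>_. borel))"
    by (rule measurable_restrict) (auto intro!: borel_measurable_add measurable_coord)
  have tilt: "normal_density 0 \<sigma> x * exp (h i * x / \<sigma>\<^sup>2 - (h i)\<^sup>2 / (2 * \<sigma>\<^sup>2)) = normal_density (h i) \<sigma> x" for i x
    using normal_density_tilt[OF \<sigma>, of x "h i / \<sigma>\<^sup>2"] \<sigma>
    by (simp add: exp_diff power_divide) (simp add: field_simps power2_eq_square power4_eq_xxxx)
  have "?L = PiM {..<n} (\<lambda>i. gaussian (h i) \<sigma>)"
  proof (rule H.PiM_eqI[OF _ setsL])
    fix A :: "nat \<Rightarrow> real set" assume A: "\<And>i. i \<in> {..<n} \<Longrightarrow> A i \<in> sets (gaussian (h i) \<sigma>)"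
    have Ab: "i < n \<Longrightarrow> A i \<in> sets borel" for i using A[of i] by simp
    have shift: "emeasure (gaussian 0 \<sigma>) ((\<lambda>x. x + h i) -` A i) = emeasure (gaussian (h i) \<sigma>) (A i)" if "i < n" for i
    proof -
      have mm: "(\<lambda>x. x + h i) -` A i \<in> sets borel"
        using measurable_sets[of "\<lambda>x. x + h i" borel borel "A i"] Ab[OF that] by simp
      have "emeasure (gaussian (h i) \<sigma>) (A i) = (\<integral>\<^sup>+x. ennreal (normal_density (h i) \<sigma> x) * indicator (A i) x \<partial>lborel)"
        using Ab[OF that] by (simp add: emeasure_density)
      also have "\<dots> = (\<integral>\<^sup>+x. ennreal (normal_density (h i) \<sigma> (h i + x)) * indicator (A i) (h i + x) \<partial>lborel)"
        using Ab[OF that] by (subst nn_integral_real_affine[where c=1 and t="h i"]) auto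
      also have "\<dots> = emeasure (gaussian 0 \<sigma>) ((\<lambda>x. x + h i) -` A i)"
        using mm by (subst emeasure_density)
          (auto simp: normal_density_def indicator_def add.commute intro!: nn_integral_cong)
      finally show ?thesis by simp
    qed
    have "Pi\<^sub>E {..<n} A \<in> sets (PiM {..<n} (\<lambda>_. borel))"
      by (rule sets_PiM_I_finite) (auto simp: Ab)
    then have "emeasure ?L (Pi\<^sub>E {..<n} A)
        = emeasure (noise_coords n \<sigma>) ((\<lambda>e. \<lambda>i\<in>{..<n}. e i + h i) -` Pi\<^sub>E {..<n} A \<inter> space (noise_coords n \<sigma>))"
      by (rule emeasure_distr[OF m])
    also have "(\<lambda>e. \<lambda>i\<in>{..<n}. e i + h i) -` Pi\<^sub>E {..<n} A \<inter> space (noise_coords n \<sigma>)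
        = Pi\<^sub>E {..<n} (\<lambda>i. (\<lambda>x. x + h i) -` A i)"
      by (auto simp: space PiE_iff)
    also have "emeasure (noise_coords n \<sigma>) (Pi\<^sub>E {..<n} (\<lambda>i. (\<lambda>x. x + h i) -` A i))
        = (\<Prod>i<n. emeasure (gaussian 0 \<sigma>) ((\<lambda>x. x + h i) -` A i))"
      unfolding noise_coords_def
    proof (rule N.emeasure_PiM)
      fix i assume "i \<in> {..<n}"
      then show "(\<lambda>x. x + h i) -` A i \<in> sets (gaussian 0 \<sigma>)"
        using measurable_sets[of "\<lambda>x. x + h i" borel borel "A i"] Ab[of i] by simp
    qed simp
    also have "\<dots> = (\<Prod>i<n. emeasure (gaussian (h i) \<sigma>) (A i))" using shift by simp
    finally show "emeasure ?L (Pi\<^sub>E {..<n} A) = (\<Prod>i<n. emeasure (gaussian (h i) \<sigma>) (A i))" .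
  qed simp
  moreover have "?R = PiM {..<n} (\<lambda>i. gaussian (h i) \<sigma>)"
  proof (rule H.PiM_eqI[OF _ setsR])
    fix A :: "nat \<Rightarrow> real set" assume A: "\<And>i. i \<in> {..<n} \<Longrightarrow> A i \<in> sets (gaussian (h i) \<sigma>)"
    have Ab[measurable]: "i < n \<Longrightarrow> A i \<in> sets borel" for i using A[of i] by simp
    have s: "Pi\<^sub>E {..<n} A \<in> sets (noise_coords n \<sigma>)"
      unfolding noise_coords_def by (rule sets_PiM_I_finite) (auto simp: Ab)
    have "emeasure ?R (Pi\<^sub>E {..<n} A) = (\<integral>\<^sup>+e. ennreal (exp ((\<Sum>i<n. h i * e i) / \<sigma>\<^sup>2 - (\<Sum>i<n. (h i)\<^sup>2) / (2 * \<sigma>\<^sup>2)))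
        * indicator (Pi\<^sub>E {..<n} A) e \<partial>noise_coords n \<sigma>)"
    proof (rule emeasure_density[OF _ s])
      note [measurable] = measurable_coord
      show "(\<lambda>e. ennreal (exp ((\<Sum>i<n. h i * e i) / \<sigma>\<^sup>2 - (\<Sum>i<n. (h i)\<^sup>2) / (2 * \<sigma>\<^sup>2))))
        \<in> borel_measurable (noise_coords n \<sigma>)" by measurable
    qed
    also have "\<dots> = (\<integral>\<^sup>+e. (\<Prod>i<n. ennreal (exp (h i * e i / \<sigma>\<^sup>2 - (h i)\<^sup>2 / (2 * \<sigma>\<^sup>2))) * indicator (A i) (e i)) \<partial>noise_coords n \<sigma>)"
    proof (rule nn_integral_cong)
      fix e assume e: "e \<in> space (noise_coords n \<sigma>)"
      have "indicator (Pi\<^sub>E {..<n} A) e = (\<Prod>i<n. indicator (A i) (e i) :: ennreal)"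
      proof (cases "\<forall>i<n. e i \<in> A i")
        case True then show ?thesis using e by (auto simp: space PiE_iff indicator_def)
      next
        case False
        then have "e \<notin> Pi\<^sub>E {..<n} A" by (auto simp: PiE_iff)
        moreover have "(\<Prod>i<n. indicator (A i) (e i) :: ennreal) = 0" using False by (intro prod_zero) (auto simp: indicator_def)
        ultimately show ?thesis by simp
      qed
      then show "ennreal (exp ((\<Sum>i<n. h i * e i) / \<sigma>\<^sup>2 - (\<Sum>i<n. (h i)\<^sup>2) / (2 * \<sigma>\<^sup>2))) * indicator (Pi\<^sub>E {..<n} A) e
        = (\<Prod>i<n. ennreal (exp (h i * e i / \<sigma>\<^sup>2 - (h i)\<^sup>2 / (2 * \<sigma>\<^sup>2))) * indicator (A i) (e i))"
        by (simp add: prod.distrib prod_ennreal exp_sum[symmetric] sum_subtractf sum_divide_distrib)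
    qed
    also have "\<dots> = (\<Prod>i<n. \<integral>\<^sup>+x. ennreal (exp (h i * x / \<sigma>\<^sup>2 - (h i)\<^sup>2 / (2 * \<sigma>\<^sup>2))) * indicator (A i) x \<partial>gaussian 0 \<sigma>)"
      unfolding noise_coords_def by (rule N.product_nn_integral_prod) (auto intro!: borel_measurable_times_ennreal simp: Ab)
    also have "\<dots> = (\<Prod>i<n. emeasure (gaussian (h i) \<sigma>) (A i))"
    proof (rule prod.cong[OF refl])
      fix i assume "i \<in> {..<n}"
      then have [measurable]: "A i \<in> sets borel" by (simp add: Ab)
      have "(\<integral>\<^sup>+x. ennreal (exp (h i * x / \<sigma>\<^sup>2 - (h i)\<^sup>2 / (2 * \<sigma>\<^sup>2))) * indicator (A i) x \<partial>gaussian 0 \<sigma>)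
        = (\<integral>\<^sup>+x. ennreal (normal_density 0 \<sigma> x) * (ennreal (exp (h i * x / \<sigma>\<^sup>2 - (h i)\<^sup>2 / (2 * \<sigma>\<^sup>2))) * indicator (A i) x) \<partial>lborel)"
        by (rule nn_integral_density) auto
      also have "\<dots> = (\<integral>\<^sup>+x. ennreal (normal_density (h i) \<sigma> x) * indicator (A i) x \<partial>lborel)"
        by (simp add: mult.assoc[symmetric] ennreal_mult[symmetric] tilt)
      also have "\<dots> = emeasure (gaussian (h i) \<sigma>) (A i)" by (simp add: emeasure_density)
      finally show "(\<integral>\<^sup>+x. ennreal (exp (h i * x / \<sigma>\<^sup>2 - (h i)\<^sup>2 / (2 * \<sigma>\<^sup>2))) * indicator (A i) x \<partial>gaussian 0 \<sigma>)
        = emeasure (gaussian (h i) \<sigma>) (A i)" .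
    qed
    finally show "emeasure ?R (Pi\<^sub>E {..<n} A) = (\<Prod>i<n. emeasure (gaussian (h i) \<sigma>) (A i))" .
  qed simp
  ultimately show ?thesis by simp
qed

section \<open>Vectors and their squared norms\<close>

lemma scalar_prod_eq_sum:
  "u \<in> carrier_vec n \<Longrightarrow> v \<in> carrier_vec n \<Longrightarrow>
    scalar_prod u v = (\<Sum>i<n. vec_index u i * vec_index v i :: real)"
  by (auto simp: scalar_prod_def lessThan_atLeast0)

lemma sqn_eq_sum: "v \<in> carrier_vec n \<Longrightarrow> sqn v = (\<Sum>i<n. (vec_index v i)\<^sup>2)"
  by (simp add: sqn_def scalar_prod_eq_sum power2_eq_square)

lemma sqn_nonneg: "0 \<le> sqn v"
  by (subst sqn_eq_sum[of v "dim_vec v"]) (auto intro: sum_nonneg)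

lemma sqn_eq_0_iff: "v \<in> carrier_vec n \<Longrightarrow> sqn v = 0 \<longleftrightarrow> v = 0\<^sub>v n"
  by (auto simp: sqn_eq_sum sum_nonneg_eq_0_iff intro!: eq_vecI)

lemma sqn_minus:
  assumes "u \<in> carrier_vec n" "v \<in> carrier_vec n"
  shows "sqn (u - v) = sqn u - 2 * scalar_prod u v + sqn v"
  using assms
  by (simp add: sqn_eq_sum[of _ n] scalar_prod_eq_sum[of _ n] power2_diff sum.distrib sum_subtractf sum_distrib_left mult_ac)

lemma sqn_add:
  assumes "u \<in> carrier_vec n" "v \<in> carrier_vec n"
  shows "sqn (u + v) = sqn u + 2 * scalar_prod u v + sqn v"
  using assms
  by (simp add: sqn_eq_sum[of _ n] scalar_prod_eq_sum[of _ n] power2_sum sum.distrib sum_distrib_left mult_ac)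

lemma scalar_prod_mult_mat_vec:
  fixes A :: "real mat"
  assumes A: "A \<in> carrier_mat n p" and e: "e \<in> carrier_vec n" and b: "b \<in> carrier_vec p"
  shows "scalar_prod e (A *\<^sub>v b) = (\<Sum>j<p. vec_index b j * scalar_prod e (col A j))"
proof -
  have "scalar_prod e (A *\<^sub>v b) = scalar_prod (transpose_mat A *\<^sub>v e) b"
    using transpose_vec_mult_scalar[OF A b e] by simp
  also have "\<dots> = (\<Sum>j<p. vec_index (transpose_mat A *\<^sub>v e) j * vec_index b j)"
    using A b e by (intro scalar_prod_eq_sum) (auto intro!: mult_mat_vec_carrier[of _ p n])
  also have "\<dots> = (\<Sum>j<p. vec_index b j * scalar_prod e (col A j))"
    using A e by (intro sum.cong refl) (auto simp: comm_scalar_prod[of _ n] mult.commute)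
  finally show ?thesis .
qed

section \<open>Least squares through the Moore-Penrose inverse\<close>

text \<open>If $GB = BG = D$, every Moore-Penrose inverse $C$ also satisfies $GC = CG = D$, because $GC$ and
  $D$ are symmetric and absorb each other; then $C = CGC = BGB = B$.\<close>

lemma is_pinv_unique_of_projection:
  assumes G: "G \<in> carrier_mat p p" and D: "D \<in> carrier_mat p p"
    and B: "is_pinv G B" "G * B = D" "B * G = D"
    and C: "is_pinv G C"
  shows "C = B"
proof -
  have cB: "B \<in> carrier_mat p p" and cC: "C \<in> carrier_mat p p"
    using B C G by (auto simp: is_pinv_def)
  note as = assoc_mult_mat[of _ p p _ p _ p]
  have DG: "D * G = G" and GD: "G * D = G" and Dt: "transpose_mat D = D"
    using B G cB by (auto simp: is_pinv_def as)
  have tD: "D = transpose_mat X * transpose_mat D \<Longrightarrow> D = transpose_mat X * D" for X using Dt by simp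
  have "(G * C) * D = (G * C) * (G * B)" using B by simp
  also have "\<dots> = (G * C * G) * B" using G cB cC by (simp add: as)
  also have "\<dots> = D" using C B by (simp add: is_pinv_def)
  finally have "transpose_mat D * transpose_mat (G * C) = transpose_mat D"
    using G cC D by (subst transpose_mult[symmetric, of _ p p _ p]) auto
  then have "D * (G * C) = D" using C Dt by (simp add: is_pinv_def)
  then have GC: "G * C = D" using DG G cC D by (simp flip: as del: assoc_mult_mat)
  have "D * (C * G) = (B * G) * (C * G)" using B by simp
  also have "\<dots> = B * (G * C * G)" using G cB cC by (simp add: as)
  also have "\<dots> = D" using C B by (simp add: is_pinv_def)
  finally have "transpose_mat (C * G) * transpose_mat D = transpose_mat D"
    using G cC D by (subst transpose_mult[symmetric, of _ p p _ p]) auto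
  then have "(C * G) * D = D" using C Dt by (simp add: is_pinv_def)
  then have CG: "C * G = D" using GD G cC D by (simp add: as)
  have "C = C * G * C" using C by (simp add: is_pinv_def)
  also have "\<dots> = B * G * C" using CG B by simp
  also have "\<dots> = B * (G * C)" using G cB cC by (simp add: as)
  also have "\<dots> = B * (G * B)" using GC B by simp
  also have "\<dots> = B * G * B" using G cB by (simp add: as)
  also have "\<dots> = B" using B by (simp add: is_pinv_def)
  finally show ?thesis .
qed

lemma model_diag_carrier [simp]: "model_diag p M \<in> carrier_mat p p"
  by (simp add: model_diag_def)

lemma transpose_model_diag [simp]: "transpose_mat (model_diag p M) = model_diag p M"
  by (auto simp: model_diag_def intro!: eq_matI)

lemma model_diag_mult_vec:
  assumes "b \<in> carrier_vec p"
  shows "model_diag p M *\<^sub>v b = Matrix.vec p (\<lambda>j. if j \<in> M then vec_index b j else 0)"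
proof (rule eq_vecI)
  fix i assume "i < dim_vec (Matrix.vec p (\<lambda>j. if j \<in> M then vec_index b j else 0))"
  then have i: "i < p" by simp
  then have "vec_index (model_diag p M *\<^sub>v b) i = (\<Sum>j<p. (if i = j \<and> j \<in> M then 1 else 0) * vec_index b j)"
    using assms by (simp add: model_diag_def scalar_prod_eq_sum[of _ p])
  also have "\<dots> = (\<Sum>j<p. if i = j then (if j \<in> M then vec_index b j else 0) else 0)"
    by (intro sum.cong) auto
  also have "\<dots> = (if i \<in> M then vec_index b i else 0)" using i by simp
  finally show "vec_index (model_diag p M *\<^sub>v b) i
      = vec_index (Matrix.vec p (\<lambda>j. if j \<in> M then vec_index b j else 0)) i" using i by simp
qed (simp add: model_diag_def)

lemma model_diag_idem: "model_diag p M * model_diag p M = model_diag p M"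
proof (rule eq_matI)
  fix i j assume "i < dim_row (model_diag p M)" "j < dim_col (model_diag p M)"
  then have ij: "i < p" "j < p" by (simp_all add: model_diag_def)
  then have "col (model_diag p M * model_diag p M) j = model_diag p M *\<^sub>v col (model_diag p M) j"
    by (intro col_mult2[of _ p p _ p]) auto
  also have "\<dots> = col (model_diag p M) j"
    using ij by (subst model_diag_mult_vec) (auto simp: model_diag_def)
  finally have "vec_index (col (model_diag p M * model_diag p M) j) i = vec_index (col (model_diag p M) j) i" by simp
  then show "(model_diag p M * model_diag p M) $$ (i, j) = model_diag p M $$ (i, j)"
    using ij by (simp add: model_diag_def)
qed (simp_all add: model_diag_def)

text \<open>With $D$ the diagonal matrix of the model and $G = DA'AD$, the matrix $H = G + (I - D)$ is
  positive definite when the columns of the model are independent, and it commutes with $D$. Hence $H^{-1}D$ is the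
  Moore-Penrose inverse of $G$, which makes the estimator explicit.\<close>

lemma lse_normal_equations:
  fixes A :: "real mat"
  assumes A: "A \<in> carrier_mat n p" and y: "y \<in> carrier_vec n"
    and inj: "\<And>b. b \<in> carrier_vec p \<Longrightarrow> (\<And>j. j < p \<Longrightarrow> j \<notin> M \<Longrightarrow> vec_index b j = 0) \<Longrightarrow>
      A *\<^sub>v b = 0\<^sub>v n \<Longrightarrow> b = 0\<^sub>v p"
  shows "lse A M y \<in> carrier_vec p"
    and "\<And>j. j < p \<Longrightarrow> j \<notin> M \<Longrightarrow> vec_index (lse A M y) j = 0"
    and "\<And>b. b \<in> carrier_vec p \<Longrightarrow> (\<And>j. j < p \<Longrightarrow> j \<notin> M \<Longrightarrow> vec_index b j = 0) \<Longrightarrow>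
      scalar_prod (A *\<^sub>v b) (y - A *\<^sub>v lse A M y) = 0"
proof -
  note as = assoc_mult_mat[of _ p p _ p _ p]
  define D where "D = model_diag p M"
  define At where "At = transpose_mat A"
  define G where "G = D * At * A * D"
  \<comment> \<open>agrees with $G$ on the coordinates of the model and with the identity elsewhere\<close>
  define H where "H = G + (1\<^sub>m p - D)"
  have cAt: "At \<in> carrier_mat p n" and D: "D \<in> carrier_mat p p" using A by (auto simp: D_def At_def)
  have G: "G \<in> carrier_mat p p" using A D cAt by (auto simp: G_def)
  have H: "H \<in> carrier_mat p p" using G D by (auto simp: H_def)
  have DD: "D * D = D" by (simp add: D_def model_diag_idem)
  have AA: "At * A \<in> carrier_mat p p" using A cAt by simp
  have G': "G = D * (At * A) * D" unfolding G_def using A cAt D by (simp add: assoc_mult_mat[of _ p p _ n _ p])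
  have DG: "D * G = G" unfolding G' using AA D DD by (simp add: as[symmetric] del: assoc_mult_mat)
  have GD: "G * D = G" unfolding G' using AA D DD by (simp add: as)
  have c1: "(1\<^sub>m p :: real mat) \<in> carrier_mat p p" "1\<^sub>m p - D \<in> carrier_mat p p" using D by auto
  have "D * H = D * G + (D * 1\<^sub>m p - D * D)"
    unfolding H_def mult_add_distrib_mat[OF D G c1(2)] mult_minus_distrib_mat[OF D c1(1) D] ..
  then have DH: "D * H = G" using D G DG DD by simp
  have "H * D = G * D + (1\<^sub>m p * D - D * D)"
    unfolding H_def add_mult_distrib_mat[OF G c1(2) D] minus_mult_distrib_mat[OF c1(1) D D] ..
  then have HD: "H * D = G" using D G GD DD by simp
  have supp_D: "D *\<^sub>v b = b" if "b \<in> carrier_vec p" "\<And>j. j < p \<Longrightarrow> j \<notin> M \<Longrightarrow> vec_index b j = 0" for b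
    unfolding D_def using that by (subst model_diag_mult_vec) (auto intro!: eq_vecI)
  have D_supp: "vec_index (D *\<^sub>v b) j = 0" if "b \<in> carrier_vec p" "j < p" "j \<notin> M" for b j
    unfolding D_def using that by (subst model_diag_mult_vec) auto
  have Gv: "G *\<^sub>v v = D *\<^sub>v (At *\<^sub>v (A *\<^sub>v (D *\<^sub>v v)))" if "v \<in> carrier_vec p" for v
    unfolding G_def using that A cAt D by (simp add: assoc_mult_mat_vec[of _ p p _ p] assoc_mult_mat_vec[of _ p n _ p] assoc_mult_mat_vec[of _ p p _ n] mult_carrier_mat[of _ p n _ p] mult_carrier_mat[of _ p p _ n])
  have Dsym: "scalar_prod u (D *\<^sub>v v) = scalar_prod (D *\<^sub>v u) v" if "u \<in> carrier_vec p" "v \<in> carrier_vec p" for u v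
    using transpose_vec_mult_scalar[OF D that(2,1)] by (simp add: D_def)
  have Asym: "scalar_prod u (At *\<^sub>v v) = scalar_prod (A *\<^sub>v u) v" if "u \<in> carrier_vec p" "v \<in> carrier_vec n" for u v
    using transpose_vec_mult_scalar[of At p n v u] that A by (simp add: At_def)
  have "Determinant.det H \<noteq> 0"
  proof
    assume "Determinant.det H = 0"
    then obtain v where v: "v \<in> carrier_vec p" "v \<noteq> 0\<^sub>v p" "H *\<^sub>v v = 0\<^sub>v p"
      using det_0_iff_vec_prod_zero_field[OF H] by auto
    have "G *\<^sub>v v = D *\<^sub>v (H *\<^sub>v v)" unfolding DH[symmetric] by (rule assoc_mult_mat_vec[OF D H v(1)])
    moreover have "D *\<^sub>v 0\<^sub>v p = 0\<^sub>v p" using D by (intro eq_vecI) auto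
    ultimately have Gv0: "G *\<^sub>v v = 0\<^sub>v p" using v by simp
    have "H *\<^sub>v v = G *\<^sub>v v + (v - D *\<^sub>v v)"
      unfolding H_def add_mult_distrib_mat_vec[OF G c1(2) v(1)] minus_mult_distrib_mat_vec[OF c1(1) D v(1)]
      using v by simp
    then have "v - D *\<^sub>v v = 0\<^sub>v p" using v D Gv0 by simp
    then have vD: "D *\<^sub>v v = v" using v D
      by (intro eq_vecI) (auto simp: vec_eq_iff)
    have cDv: "A *\<^sub>v (D *\<^sub>v v) \<in> carrier_vec n" using A D v by auto
    have "sqn (A *\<^sub>v (D *\<^sub>v v)) = scalar_prod v (G *\<^sub>v v)"
      unfolding sqn_def Gv[OF v(1)] using A cAt D v cDv by (subst Dsym, simp, simp, subst Asym) auto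
    then have "A *\<^sub>v (D *\<^sub>v v) = 0\<^sub>v n" using Gv0 v cDv by (simp add: sqn_eq_0_iff)
    then have "v = 0\<^sub>v p" using inj[of v] vD v D_supp[of v] by auto
    then show False using v by simp
  qed
  then have "H \<in> Units (ring_mat TYPE(real) p ())" by (rule det_non_zero_imp_unit[OF H])
  then obtain Hi where Hi: "Hi \<in> carrier_mat p p" "Hi * H = 1\<^sub>m p" "H * Hi = 1\<^sub>m p"
    unfolding Units_def by (auto simp: ring_mat_simps)
  define B where "B = Hi * D"
  have cB: "B \<in> carrier_mat p p" using Hi D by (simp add: B_def)
  have comm: "D * Hi = Hi * D"
  proof -
    have "D * Hi = (Hi * H) * (D * Hi)" using Hi D by (metis left_mult_one_mat mult_carrier_mat)
    also have "\<dots> = Hi * (H * D) * Hi" using Hi(1) D H by (simp add: as)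
    also have "\<dots> = Hi * (D * H) * Hi" by (simp add: HD DH)
    also have "\<dots> = Hi * D * (H * Hi)" using Hi(1) D H by (simp add: as)
    finally show ?thesis using Hi D by simp
  qed
  have GB: "G * B = D"
  proof -
    have "G * B = D * (H * Hi) * D" unfolding B_def DH[symmetric] using D H Hi(1) by (simp add: as)
    then show ?thesis using Hi D DD by simp
  qed
  have BG: "B * G = D"
  proof -
    have "B * G = D * (Hi * H) * D" unfolding B_def HD[symmetric] comm[symmetric] using D H Hi(1) by (simp add: as)
    then show ?thesis using Hi D DD by simp
  qed
  have DB: "D * B = B"
  proof -
    have "D * B = (D * Hi) * D" unfolding B_def using D Hi by (simp add: as)
    also have "\<dots> = Hi * (D * D)" unfolding comm using D Hi by (simp add: as)
    finally show ?thesis by (simp add: DD B_def)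
  qed
  have pB: "is_pinv G B" using GB BG G cB DG DB by (auto simp: is_pinv_def D_def)
  have pinv: "pinv G = B" unfolding pinv_def
    by (rule the_equality[where P = "is_pinv G", OF pB]) (rule is_pinv_unique_of_projection[OF G D pB GB BG])
  define b0 where "b0 = B *\<^sub>v (D *\<^sub>v (At *\<^sub>v y))"
  have cy: "At *\<^sub>v y \<in> carrier_vec p" "D *\<^sub>v (At *\<^sub>v y) \<in> carrier_vec p" using cAt D y by auto
  have b0: "b0 \<in> carrier_vec p" using cB cy by (simp add: b0_def)
  have lse: "lse A M y = b0"
  proof -
    have "lse A M y = (B * D * At) *\<^sub>v y"
      using A by (simp add: lse_def Let_def G_def[symmetric] At_def[symmetric] D_def[symmetric] pinv)
    also have "\<dots> = b0" unfolding b0_def using A cB cAt D y cy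
      by (simp add: assoc_mult_mat_vec[of _ p p _ n] assoc_mult_mat_vec[of _ p p _ p] mult_carrier_mat[of _ p p _ p])
    finally show ?thesis .
  qed
  have Db0: "D *\<^sub>v b0 = b0"
    unfolding b0_def assoc_mult_mat_vec[OF D cB cy(2), symmetric] DB ..
  show "lse A M y \<in> carrier_vec p" using b0 lse by simp
  show "vec_index (lse A M y) j = 0" if "j < p" "j \<notin> M" for j
    using D_supp[OF b0 that] Db0 lse by simp
  show "scalar_prod (A *\<^sub>v b) (y - A *\<^sub>v lse A M y) = 0"
    if b: "b \<in> carrier_vec p" "\<And>j. j < p \<Longrightarrow> j \<notin> M \<Longrightarrow> vec_index b j = 0" for b
  proof -
    have "G *\<^sub>v b0 = (G * B) *\<^sub>v (D *\<^sub>v (At *\<^sub>v y))"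
      unfolding b0_def using G cB cy by (simp add: assoc_mult_mat_vec[of _ p p _ p])
    also have "\<dots> = D *\<^sub>v (At *\<^sub>v y)"
      unfolding GB assoc_mult_mat_vec[OF D D cy(1), symmetric] DD ..
    finally have ne: "D *\<^sub>v (At *\<^sub>v (A *\<^sub>v b0)) = D *\<^sub>v (At *\<^sub>v y)"
      using Gv[OF b0] Db0 by simp
    have proj: "scalar_prod (A *\<^sub>v b) z = scalar_prod b (D *\<^sub>v (At *\<^sub>v z))" if "z \<in> carrier_vec n" for z
      using Dsym[OF b(1), of "At *\<^sub>v z"] Asym[OF b(1) that] supp_D[OF b] that cAt by simp
    have cAb: "A *\<^sub>v b \<in> carrier_vec n" "A *\<^sub>v b0 \<in> carrier_vec n" using A b b0 by auto
    then show ?thesis using y unfolding lse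
      by (simp add: scalar_prod_minus_distrib[of _ n] proj ne)
  qed
qed

text \<open>Pythagoras: the residual of the least squares fit is orthogonal to all fits of the model.\<close>

lemma lse_minimizes_residual:
  fixes A :: "real mat"
  assumes A: "A \<in> carrier_mat n p" and y: "y \<in> carrier_vec n"
    and inj: "\<And>b. b \<in> carrier_vec p \<Longrightarrow> (\<And>j. j < p \<Longrightarrow> j \<notin> M \<Longrightarrow> vec_index b j = 0) \<Longrightarrow>
      A *\<^sub>v b = 0\<^sub>v n \<Longrightarrow> b = 0\<^sub>v p"
    and b: "b \<in> carrier_vec p" "\<And>j. j < p \<Longrightarrow> j \<notin> M \<Longrightarrow> vec_index b j = 0"
  shows "sqn (y - A *\<^sub>v lse A M y) \<le> sqn (y - A *\<^sub>v b)"
proof -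
  let ?l = "lse A M y"
  have l: "?l \<in> carrier_vec p" "\<And>j. j < p \<Longrightarrow> j \<notin> M \<Longrightarrow> vec_index ?l j = 0"
    "\<And>b. b \<in> carrier_vec p \<Longrightarrow> (\<And>j. j < p \<Longrightarrow> j \<notin> M \<Longrightarrow> vec_index b j = 0) \<Longrightarrow>
      scalar_prod (A *\<^sub>v b) (y - A *\<^sub>v ?l) = 0"
    using lse_normal_equations[where M = M, OF A y] inj by blast+
  have cl: "?l \<in> carrier_vec p" by (rule l(1)) 
  define d where "d = b - ?l"
  have d: "d \<in> carrier_vec p" using b cl by (simp add: d_def)
  have d0: "vec_index d j = 0" if "j < p" "j \<notin> M" for j
    using that b l(2)[of j] cl by (simp add: d_def)
  have Ad: "A *\<^sub>v d = A *\<^sub>v b - A *\<^sub>v ?l"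
    unfolding d_def using A b cl by (simp add: mult_minus_distrib_mat_vec)
  have orth: "scalar_prod (A *\<^sub>v d) (y - A *\<^sub>v ?l) = 0"
    by (rule l(3)[OF d d0])
  have c: "A *\<^sub>v b \<in> carrier_vec n" "A *\<^sub>v ?l \<in> carrier_vec n" "A *\<^sub>v d \<in> carrier_vec n"
    using A b cl d by auto
  have "y - A *\<^sub>v b = (y - A *\<^sub>v ?l) - A *\<^sub>v d"
    unfolding Ad using c y by (intro eq_vecI) auto
  then have "sqn (y - A *\<^sub>v b) = sqn (y - A *\<^sub>v ?l) + sqn (A *\<^sub>v d)"
    using sqn_minus[of "y - A *\<^sub>v ?l" n "A *\<^sub>v d"] orth c y
    by (simp add: comm_scalar_prod[of "A *\<^sub>v d" n])
  then show ?thesis using sqn_nonneg[of "A *\<^sub>v d"] by simp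
qed

section \<open>Orthonormal systems\<close>

text \<open>For an orthonormal system $w$ this says that $u$ lies in its span. The identity is linear in
  $u$ and yields both the expansion of an inner product and that of a norm, without vector-valued
  sums.\<close>

definition parseval :: "nat \<Rightarrow> nat \<Rightarrow> (nat \<Rightarrow> real vec) \<Rightarrow> real vec \<Rightarrow> bool" where
  "parseval n d w u \<longleftrightarrow> (\<forall>e\<in>carrier_vec n.
     scalar_prod e u = (\<Sum>i<d. scalar_prod e (w i) * scalar_prod u (w i)))"

definition orthonormal :: "nat \<Rightarrow> nat \<Rightarrow> (nat \<Rightarrow> real vec) \<Rightarrow> bool" where
  "orthonormal n d w \<longleftrightarrow> (\<forall>i<d. w i \<in> carrier_vec n) \<and>
     (\<forall>i<d. \<forall>k<d. scalar_prod (w i) (w k) = (if i = k then 1 else 0))"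

text \<open>One step of the Gram-Schmidt procedure; the system stays as it is if the residual vanishes.\<close>

lemma orthonormal_extend:
  assumes on: "orthonormal n d w" and v: "v \<in> carrier_vec n"
  shows "\<exists>d' w'. d' \<le> Suc d \<and> orthonormal n d' w' \<and> parseval n d' w' v \<and>
    (\<forall>u. parseval n d w u \<longrightarrow> u \<in> carrier_vec n \<longrightarrow> parseval n d' w' u)"
proof -
  define r where "r = Matrix.vec n (\<lambda>t. vec_index v t - (\<Sum>i<d. scalar_prod v (w i) * vec_index (w i) t))"
  have r: "r \<in> carrier_vec n" by (simp add: r_def)
  have w: "w i \<in> carrier_vec n" if "i < d" for i using on that by (simp add: orthonormal_def)
  have er: "scalar_prod e r = scalar_prod e v - (\<Sum>i<d. scalar_prod e (w i) * scalar_prod v (w i))"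
    if e: "e \<in> carrier_vec n" for e
  proof -
    have "scalar_prod e r = (\<Sum>t<n. vec_index e t * vec_index v t)
        - (\<Sum>t<n. \<Sum>i<d. vec_index e t * (scalar_prod v (w i) * vec_index (w i) t))"
      unfolding scalar_prod_eq_sum[OF e r] by (simp add: r_def right_diff_distrib sum_subtractf sum_distrib_left)
    also have "(\<Sum>t<n. \<Sum>i<d. vec_index e t * (scalar_prod v (w i) * vec_index (w i) t))
        = (\<Sum>i<d. scalar_prod e (w i) * scalar_prod v (w i))"
      by (subst sum.swap) (simp add: scalar_prod_eq_sum[OF e w] sum_distrib_left sum_distrib_right mult_ac)
    finally show ?thesis by (simp add: scalar_prod_eq_sum[OF e v])
  qed
  show ?thesis
  proof (cases "sqn r = 0")
    case True
    then have "r = 0\<^sub>v n" using r by (simp add: sqn_eq_0_iff)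
    then have "parseval n d w v" using er by (simp add: parseval_def)
    then show ?thesis using on by (intro exI[of _ d] exI[of _ w]) auto
  next
    case False
    then have pos: "0 < sqn r" using sqn_nonneg[of r] by simp
    define x where "x = (1 / sqrt (sqn r)) \<cdot>\<^sub>v r"
    have x: "x \<in> carrier_vec n" using r by (simp add: x_def)
    have ex: "scalar_prod e x = scalar_prod e r / sqrt (sqn r)" if "e \<in> carrier_vec n" for e
      using that r by (simp add: x_def)
    define w' where "w' = w(d := x)"
    have wr: "scalar_prod (w k) r = 0" if "k < d" for k
    proof -
      have "(\<Sum>i<d. scalar_prod (w k) (w i) * scalar_prod v (w i)) = (\<Sum>i<d. if k = i then scalar_prod v (w i) else 0)"
        using on that by (intro sum.cong) (auto simp: orthonormal_def)
      then show ?thesis using er[OF w[OF that]] that v w[OF that] by (simp add: comm_scalar_prod[of v n])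
    qed
    have wx: "scalar_prod (w k) x = 0" if "k < d" for k using ex[OF w[OF that]] wr[OF that] by simp
    have xw: "scalar_prod x (w k) = 0" if "k < d" for k
      using wx[OF that] comm_scalar_prod[OF x w[OF that]] by simp
    have xr: "scalar_prod r x = sqrt (sqn r)"
      using ex[OF r] pos by (simp add: sqn_def[symmetric] real_div_sqrt)
    have xx: "scalar_prod x x = 1"
      using ex[OF x] comm_scalar_prod[OF x r] xr pos by simp
    have on': "orthonormal n (Suc d) w'"
      using on x xx wx xw by (auto simp: orthonormal_def w'_def less_Suc_eq)
    have vx: "scalar_prod v x = sqrt (sqn r)"
    proof -
      have "scalar_prod x r = scalar_prod x v" using er[OF x] xw by simp
      then show ?thesis using xr comm_scalar_prod[OF x r] comm_scalar_prod[OF x v] by simp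
    qed
    have split: "(\<Sum>i<Suc d. scalar_prod e (w' i) * scalar_prod u (w' i))
      = (\<Sum>i<d. scalar_prod e (w i) * scalar_prod u (w i)) + scalar_prod e x * scalar_prod u x" for e u
      by (simp add: w'_def)
    have "parseval n (Suc d) w' v"
      unfolding parseval_def split vx using er ex pos by simp
    moreover have "parseval n (Suc d) w' u" if u: "parseval n d w u" "u \<in> carrier_vec n" for u
    proof -
      have "scalar_prod x u = 0" using u x xw by (simp add: parseval_def)
      then have "scalar_prod u x = 0" using comm_scalar_prod[OF x u(2)] by simp
      then show ?thesis using u unfolding parseval_def split by simp
    qed
    ultimately show ?thesis using on' by (intro exI[of _ "Suc d"] exI[of _ w']) auto
  qed
qed

lemma orthonormal_spanning:
  assumes "set vs \<subseteq> carrier_vec n"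
  shows "\<exists>d w. d \<le> length vs \<and> orthonormal n d w \<and> (\<forall>v\<in>set vs. parseval n d w v)"
  using assms
proof (induction vs)
  case Nil
  show ?case by (intro exI[of _ 0]) (simp add: orthonormal_def)
next
  case (Cons v vs)
  then obtain d w where dw: "d \<le> length vs" "orthonormal n d w" "\<forall>v\<in>set vs. parseval n d w v"
    by auto
  from orthonormal_extend[OF dw(2), of v] Cons.prems
  obtain d' w' where "d' \<le> Suc d" "orthonormal n d' w'" "parseval n d' w' v"
    "\<forall>u. parseval n d w u \<longrightarrow> u \<in> carrier_vec n \<longrightarrow> parseval n d' w' u" by auto
  then show ?case using dw Cons.prems by (intro exI[of _ d'] exI[of _ w']) auto
qed

lemma parseval_minus:
  assumes "parseval n d w u" "parseval n d w v" "orthonormal n d w" "u \<in> carrier_vec n" "v \<in> carrier_vec n"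
  shows "parseval n d w (u - v)"
  using assms unfolding parseval_def orthonormal_def
  by (simp add: scalar_prod_minus_distrib[of _ n] minus_scalar_prod_distrib[of _ n] right_diff_distrib sum_subtractf)

lemma parseval_mult_mat_vec:
  assumes A: "A \<in> carrier_mat n p" and b: "b \<in> carrier_vec p" and on: "orthonormal n d w"
    and cols: "\<And>j. j < p \<Longrightarrow> vec_index b j \<noteq> 0 \<Longrightarrow> parseval n d w (col A j)"
  shows "parseval n d w (A *\<^sub>v b)"
  unfolding parseval_def
proof
  fix e :: "real vec" assume e: "e \<in> carrier_vec n"
  have w: "w i \<in> carrier_vec n" if "i < d" for i using on that by (simp add: orthonormal_def)
  have c: "A *\<^sub>v b \<in> carrier_vec n" using A b by simp
  have cj: "col A j \<in> carrier_vec n" for j using A by auto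
  have "scalar_prod e (A *\<^sub>v b) = (\<Sum>j<p. vec_index b j * (\<Sum>i<d. scalar_prod e (w i) * scalar_prod (col A j) (w i)))"
    unfolding scalar_prod_mult_mat_vec[OF A e b]
  proof (rule sum.cong[OF refl])
    fix j assume "j \<in> {..<p}"
    then show "vec_index b j * scalar_prod e (col A j)
      = vec_index b j * (\<Sum>i<d. scalar_prod e (w i) * scalar_prod (col A j) (w i))"
      using cols[of j] e by (cases "vec_index b j = 0") (auto simp: parseval_def)
  qed
  also have "\<dots> = (\<Sum>i<d. scalar_prod e (w i) * (\<Sum>j<p. vec_index b j * scalar_prod (w i) (col A j)))"
    unfolding sum_distrib_left
    by (subst sum.swap) (auto intro!: sum.cong simp: comm_scalar_prod[OF cj w])
  also have "\<dots> = (\<Sum>i<d. scalar_prod e (w i) * scalar_prod (A *\<^sub>v b) (w i))"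
    by (intro sum.cong refl) (simp add: scalar_prod_mult_mat_vec[OF A w b, symmetric] comm_scalar_prod[OF c w])
  finally show "scalar_prod e (A *\<^sub>v b) = (\<Sum>i<d. scalar_prod e (w i) * scalar_prod (A *\<^sub>v b) (w i))" .
qed

text \<open>Coordinatewise, this is $2xy \le ay^2 + x^2/a$.\<close>

lemma twice_scalar_prod_le:
  assumes "parseval n d w u" "u \<in> carrier_vec n" "e \<in> carrier_vec n" "0 < a"
  shows "2 * scalar_prod e u \<le> a * sqn u + (1 / a) * (\<Sum>i<d. (scalar_prod e (w i))\<^sup>2)"
proof -
  have eu: "scalar_prod e u = (\<Sum>i<d. scalar_prod e (w i) * scalar_prod u (w i))"
    and uu: "sqn u = (\<Sum>i<d. (scalar_prod u (w i))\<^sup>2)"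
    using assms by (auto simp: parseval_def sqn_def power2_eq_square)
  have am: "2 * (x * y) \<le> a * y\<^sup>2 + (1 / a) * x\<^sup>2" for x y :: real
  proof -
    have "0 \<le> (a * y - x)\<^sup>2 / a" using assms by simp
    also have "(a * y - x)\<^sup>2 / a = a * y\<^sup>2 + (1 / a) * x\<^sup>2 - 2 * (x * y)"
      using assms by (simp add: field_simps power2_eq_square)
    finally show ?thesis by simp
  qed
  show ?thesis unfolding eu uu sum_distrib_left sum.distrib[symmetric]
    by (rule sum_mono) (rule am)
qed

section \<open>Measurability of vector-valued maps\<close>

lemma space_borel_vec [simp]: "space (borel_vec n) = carrier_vec n"
  by (simp add: borel_vec_def)

lemma measurable_vec_index [measurable]:
  assumes "i < n" shows "(\<lambda>v. vec_index v i) \<in> borel_measurable (borel_vec n)"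
proof -
  have "(\<lambda>v. \<lambda>i\<in>{..<n}. vec_index v i) \<in> borel_vec n \<rightarrow>\<^sub>M PiM {..<n} (\<lambda>_. borel :: real measure)"
    unfolding borel_vec_def by (rule measurable_vimage_algebra1) (auto simp: space_PiM)
  then have "(\<lambda>v. (\<lambda>i\<in>{..<n}. vec_index v i) i) \<in> borel_vec n \<rightarrow>\<^sub>M borel"
    by (rule measurable_compose[OF _ measurable_component_singleton]) (use assms in auto)
  then show ?thesis using assms by simp
qed

lemma measurable_into_borel_vec:
  assumes "\<And>x. x \<in> space N \<Longrightarrow> f x \<in> carrier_vec n"
    and "\<And>i. i < n \<Longrightarrow> (\<lambda>x. vec_index (f x) i) \<in> borel_measurable N"
  shows "f \<in> N \<rightarrow>\<^sub>M borel_vec n"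
  unfolding borel_vec_def
proof (rule measurable_vimage_algebra2)
  show "(\<lambda>x. \<lambda>i\<in>{..<n}. vec_index (f x) i) \<in> N \<rightarrow>\<^sub>M PiM {..<n} (\<lambda>_. borel)"
    by (rule measurable_restrict) (use assms in auto)
qed (use assms in auto)

lemma measurable_vec_of_coords: "Matrix.vec n \<in> noise_coords n \<sigma> \<rightarrow>\<^sub>M borel_vec n"
  by (rule measurable_into_borel_vec) (auto simp: measurable_coord)

lemma gauss_noise_eq: "gauss_noise n \<sigma> = distr (noise_coords n \<sigma>) (borel_vec n) (Matrix.vec n)"
  by (simp add: gauss_noise_def noise_coords_def)

lemma space_gauss_noise [simp]: "space (gauss_noise n \<sigma>) = carrier_vec n"
  and sets_gauss_noise [measurable_cong, simp]: "sets (gauss_noise n \<sigma>) = sets (borel_vec n)"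
  by (simp_all add: gauss_noise_eq)

lemma prob_space_gauss_noise: "0 < \<sigma> \<Longrightarrow> prob_space (gauss_noise n \<sigma>)"
  unfolding gauss_noise_eq
  by (rule prob_space.prob_space_distr[OF prob_space_noise_coords measurable_vec_of_coords])

lemma nn_integral_gauss_noise:
  "f \<in> borel_measurable (borel_vec n) \<Longrightarrow>
    (\<integral>\<^sup>+e. f e \<partial>gauss_noise n \<sigma>) = (\<integral>\<^sup>+e. f (Matrix.vec n e) \<partial>noise_coords n \<sigma>)"
  unfolding gauss_noise_eq by (subst nn_integral_distr[OF measurable_vec_of_coords]) simp_all

lemma measurable_scalar_prod [measurable (raw)]:
  assumes [measurable]: "f \<in> N \<rightarrow>\<^sub>M borel_vec n" "g \<in> N \<rightarrow>\<^sub>M borel_vec n"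
  shows "(\<lambda>x. scalar_prod (f x) (g x)) \<in> borel_measurable N"
proof -
  have c: "f x \<in> carrier_vec n" "g x \<in> carrier_vec n" if "x \<in> space N" for x
    using measurable_space[OF assms(1) that] measurable_space[OF assms(2) that] by auto
  have "(\<lambda>x. \<Sum>i<n. vec_index (f x) i * vec_index (g x) i) \<in> borel_measurable N"
    by (intro borel_measurable_sum borel_measurable_times
        measurable_compose[OF assms(1) measurable_vec_index] measurable_compose[OF assms(2) measurable_vec_index]) auto
  then show ?thesis
    by (rule measurable_cong[THEN iffD1, rotated]) (simp add: scalar_prod_eq_sum[OF c])
qed

lemma measurable_sqn [measurable (raw)]:
  "f \<in> N \<rightarrow>\<^sub>M borel_vec n \<Longrightarrow> (\<lambda>x. sqn (f x)) \<in> borel_measurable N"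
  unfolding sqn_def by (rule measurable_scalar_prod)

lemma measurable_vec_minus:
  assumes "f \<in> N \<rightarrow>\<^sub>M borel_vec n" "g \<in> N \<rightarrow>\<^sub>M borel_vec n"
  shows "(\<lambda>x. f x - g x) \<in> N \<rightarrow>\<^sub>M borel_vec n"
proof -
  have c: "f x \<in> carrier_vec n" "g x \<in> carrier_vec n" if "x \<in> space N" for x
    using measurable_space[OF assms(1) that] measurable_space[OF assms(2) that] by auto
  show ?thesis
  proof (rule measurable_into_borel_vec)
    fix i assume "i < n"
    then have "(\<lambda>x. vec_index (f x) i - vec_index (g x) i) \<in> borel_measurable N"
      by (intro borel_measurable_diff
        measurable_compose[OF assms(1) measurable_vec_index] measurable_compose[OF assms(2) measurable_vec_index])
    then show "(\<lambda>x. vec_index (f x - g x) i) \<in> borel_measurable N"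
      by (rule measurable_cong[THEN iffD1, rotated]) (use c[THEN carrier_vecD] \<open>i < n\<close> in simp)
  qed (use c in auto)
qed

lemma measurable_vec_add:
  assumes "f \<in> N \<rightarrow>\<^sub>M borel_vec n" "g \<in> N \<rightarrow>\<^sub>M borel_vec n"
  shows "(\<lambda>x. f x + g x) \<in> N \<rightarrow>\<^sub>M borel_vec n"
proof -
  have c: "f x \<in> carrier_vec n" "g x \<in> carrier_vec n" if "x \<in> space N" for x
    using measurable_space[OF assms(1) that] measurable_space[OF assms(2) that] by auto
  show ?thesis
  proof (rule measurable_into_borel_vec)
    fix i assume "i < n"
    then have "(\<lambda>x. vec_index (f x) i + vec_index (g x) i) \<in> borel_measurable N"
      by (intro borel_measurable_add
        measurable_compose[OF assms(1) measurable_vec_index] measurable_compose[OF assms(2) measurable_vec_index])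
    then show "(\<lambda>x. vec_index (f x + g x) i) \<in> borel_measurable N"
      by (rule measurable_cong[THEN iffD1, rotated]) (use c[THEN carrier_vecD] \<open>i < n\<close> in simp)
  qed (use c in auto)
qed

text \<open>The fit is a fixed matrix applied to the data, whether or not the inverse in its definition
  exists.\<close>

lemma measurable_fitted_values:
  assumes A: "A \<in> carrier_mat n p"
  shows "(\<lambda>y. A *\<^sub>v lse A M y) \<in> borel_vec n \<rightarrow>\<^sub>M borel_vec n"
proof (rule measurable_into_borel_vec)
  define H where "H = (let D = model_diag (dim_col A) M in
     pinv (D * transpose_mat A * A * D) * D * transpose_mat A)"
  have lse: "lse A M y = H *\<^sub>v y" for y by (simp add: lse_def H_def Let_def)
  fix i assume i: "i < n"
  have "vec_index (A *\<^sub>v lse A M y) i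
      = (\<Sum>k<dim_row H. vec_index (Matrix.row A i) k * (\<Sum>j<n. vec_index (Matrix.row H k) j * vec_index y j))"
    if "y \<in> carrier_vec n" for y
    using that A i unfolding lse by (auto simp: scalar_prod_def lessThan_atLeast0)
  moreover have "(\<lambda>y. \<Sum>k<dim_row H. vec_index (Matrix.row A i) k * (\<Sum>j<n. vec_index (Matrix.row H k) j * vec_index y j))
      \<in> borel_measurable (borel_vec n)"
    by (intro borel_measurable_sum borel_measurable_times borel_measurable_const measurable_vec_index) auto
  ultimately show "(\<lambda>y. vec_index (A *\<^sub>v lse A M y) i) \<in> borel_measurable (borel_vec n)"
    by (subst measurable_cong) auto
next
  show "A *\<^sub>v lse A M y \<in> carrier_vec n" if "y \<in> space (borel_vec n)" for y
    by (rule carrier_vecI) (use A in simp)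
qed

text \<open>Candidates are compared one after another. That the attained minimum is measurable is part
  of the claim because the induction step compares it with the next candidate.\<close>

lemma measurable_argmin:
  fixes g :: "'i \<Rightarrow> 'x \<Rightarrow> real"
  assumes "finite I" "I \<noteq> {}" "\<And>i. i \<in> I \<Longrightarrow> g i \<in> borel_measurable N"
  shows "\<exists>h. h \<in> N \<rightarrow>\<^sub>M count_space UNIV \<and> (\<lambda>x. g (h x) x) \<in> borel_measurable N \<and>
    (\<forall>x. h x \<in> I \<and> (\<forall>j\<in>I. g (h x) x \<le> g j x))"
  using assms
proof (induction I rule: finite_ne_induct)
  case (singleton a)
  then show ?case by (intro exI[of _ "\<lambda>_. a"]) auto
next
  case (insert a F)
  then obtain h where h: "h \<in> N \<rightarrow>\<^sub>M count_space UNIV" "(\<lambda>x. g (h x) x) \<in> borel_measurable N"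
    "\<And>x. h x \<in> F" "\<And>x j. j \<in> F \<Longrightarrow> g (h x) x \<le> g j x" by auto
  note [measurable] = h(1,2) insert.prems[of a, simplified]
  define h' where "h' x = (if g a x \<le> g (h x) x then a else h x)" for x
  have "h' \<in> N \<rightarrow>\<^sub>M count_space UNIV" unfolding h'_def by measurable
  moreover have "(\<lambda>x. g (h' x) x) = (\<lambda>x. if g a x \<le> g (h x) x then g a x else g (h x) x)"
    by (auto simp: h'_def)
  then have "(\<lambda>x. g (h' x) x) \<in> borel_measurable N" by simp
  moreover have "h' x \<in> insert a F" for x using h(3) by (simp add: h'_def)
  moreover have "g (h' x) x \<le> g j x" if "j \<in> insert a F" for x j
    using that h(4)[of j x] by (auto simp: h'_def)
  ultimately show ?case by blast
qed

section \<open>An oracle inequality for penalized least squares\<close>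

lemma vec_add_diff_cancel_left:
  "u \<in> carrier_vec n \<Longrightarrow> v \<in> carrier_vec n \<Longrightarrow> u + v - u = (v :: real vec)"
  by (intro eq_vecI) auto

lemma vec_diff_diff_swap:
  "u \<in> carrier_vec n \<Longrightarrow> v \<in> carrier_vec n \<Longrightarrow> f \<in> carrier_vec n \<Longrightarrow> u + v - f = v - (f - u :: real vec)"
  by (intro eq_vecI) auto

text \<open>The deterministic part of the oracle inequality: a penalized criterion that is no larger at
  $N$ than at a model $M$ containing the truth bounds the loss by the penalties and the projection of the noise.\<close>

lemma penalized_lse_excess_bound:
  fixes A :: "real mat"
  assumes A: "A \<in> carrier_mat n p" and e: "e \<in> carrier_vec n"
    and b: "b \<in> carrier_vec p" "\<And>j. j < p \<Longrightarrow> j \<notin> M \<Longrightarrow> vec_index b j = 0"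
    and injM: "\<And>b. b \<in> carrier_vec p \<Longrightarrow> (\<And>j. j < p \<Longrightarrow> j \<notin> M \<Longrightarrow> vec_index b j = 0) \<Longrightarrow>
      A *\<^sub>v b = 0\<^sub>v n \<Longrightarrow> b = 0\<^sub>v p"
    and injN: "\<And>b. b \<in> carrier_vec p \<Longrightarrow> (\<And>j. j < p \<Longrightarrow> j \<notin> N \<Longrightarrow> vec_index b j = 0) \<Longrightarrow>
      A *\<^sub>v b = 0\<^sub>v n \<Longrightarrow> b = 0\<^sub>v p"
    and y: "y = A *\<^sub>v b + e"
    and opt: "sqn (y - A *\<^sub>v lse A N y) + penN \<le> sqn (y - A *\<^sub>v lse A M y) + penM"
    and on: "orthonormal n d w" "parseval n d w (A *\<^sub>v b)" "\<And>j. j < p \<Longrightarrow> j \<in> N \<Longrightarrow> parseval n d w (col A j)"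
    and a: "0 < a"
  shows "(1 - a) * sqn (A *\<^sub>v lse A N y - A *\<^sub>v b)
    \<le> penM + ((1 / a) * (\<Sum>i<d. (scalar_prod e (w i))\<^sup>2) - penN)"
proof -
  have mu: "A *\<^sub>v b \<in> carrier_vec n" and cy: "y \<in> carrier_vec n" using A b e y by auto
  have l: "lse A N y \<in> carrier_vec p" "\<And>j. j < p \<Longrightarrow> j \<notin> N \<Longrightarrow> vec_index (lse A N y) j = 0"
    using lse_normal_equations(1,2)[where M = N, OF A cy] injN by blast+
  define u where "u = A *\<^sub>v lse A N y - A *\<^sub>v b"
  have cf: "A *\<^sub>v lse A N y \<in> carrier_vec n" using A l by auto
  have u: "u \<in> carrier_vec n" using cf mu by (simp add: u_def)
  have "parseval n d w (A *\<^sub>v lse A N y)"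
    by (rule parseval_mult_mat_vec[OF A l(1) on(1)]) (use l(2) on(3) in blast)
  then have pu: "parseval n d w u" unfolding u_def by (rule parseval_minus[OF _ on(2) on(1) cf mu])
  have "sqn (y - A *\<^sub>v lse A M y) \<le> sqn (y - A *\<^sub>v b)"
    using lse_minimizes_residual[where M = M, OF A cy _ b] injM by blast
  also have "y - A *\<^sub>v b = e" unfolding y by (rule vec_add_diff_cancel_left[OF mu e])
  finally have r1: "sqn (y - A *\<^sub>v lse A N y) + penN \<le> sqn e + penM" using opt by simp
  have "y - A *\<^sub>v lse A N y = e - u"
    unfolding u_def using vec_diff_diff_swap[OF mu e cf] by (simp only: y)
  then have "sqn (y - A *\<^sub>v lse A N y) = sqn e - 2 * scalar_prod e u + sqn u"
    using sqn_minus[OF e u] by simp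
  with r1 twice_scalar_prod_le[OF pu u e a] show ?thesis
    unfolding u_def[symmetric] by (simp add: algebra_simps)
qed

lemma nn_integral_gauss_exp_projection:
  assumes \<sigma>: "0 < \<sigma>" and t: "0 \<le> t" "t < 1 / 2" and on: "orthonormal n d w"
  shows "(\<integral>\<^sup>+e. ennreal (exp (t / \<sigma>\<^sup>2 * (\<Sum>i<d. (scalar_prod e (w i))\<^sup>2))) \<partial>gauss_noise n \<sigma>)
    = ennreal ((1 / sqrt (1 - 2 * t)) ^ d)"
proof -
  have w: "w i \<in> carrier_vec n" if "i < d" for i using on that by (simp add: orthonormal_def)
  have m: "(\<lambda>e. scalar_prod e (w i)) \<in> borel_measurable (borel_vec n)" if "i < d" for i
    by (rule measurable_scalar_prod[of _ _ n]) (use w[OF that] in auto)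
  have "(\<integral>\<^sup>+e. ennreal (exp (t / \<sigma>\<^sup>2 * (\<Sum>i<d. (scalar_prod e (w i))\<^sup>2))) \<partial>gauss_noise n \<sigma>)
    = (\<integral>\<^sup>+e. ennreal (exp (t / \<sigma>\<^sup>2 * (\<Sum>i<d. (scalar_prod (Matrix.vec n e) (w i))\<^sup>2))) \<partial>noise_coords n \<sigma>)"
  proof (rule nn_integral_gauss_noise)
    note [measurable] = m
    show "(\<lambda>e. ennreal (exp (t / \<sigma>\<^sup>2 * (\<Sum>i<d. (scalar_prod e (w i))\<^sup>2)))) \<in> borel_measurable (borel_vec n)"
      by measurable
  qed
  also have "\<dots> = (\<integral>\<^sup>+e. ennreal (exp (t / \<sigma>\<^sup>2 * (\<Sum>i<d. (\<Sum>j<n. e j * vec_index (w i) j)\<^sup>2))) \<partial>noise_coords n \<sigma>)"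
    by (simp add: scalar_prod_eq_sum[OF vec_carrier w])
  also have "\<dots> = ennreal ((1 / sqrt (1 - 2 * t)) ^ d)"
    by (rule nn_integral_noise_exp_projection[OF \<sigma> t])
      (use on w in \<open>auto simp: orthonormal_def scalar_prod_eq_sum[of _ n, symmetric]\<close>)
  finally show ?thesis .
qed

text \<open>The selected model depends on the noise, so the excess term is bounded by the sum over all
  models of its exponential. Each summand has an explicit expectation, and $K$ bounds
  the sum of these expectations.\<close>

lemma risk_penalized_lse_le:
  fixes A :: "real mat"
  assumes A: "A \<in> carrier_mat n p" and \<sigma>: "0 < \<sigma>"
    and Ms: "finite Ms" "\<And>N. N \<in> Ms \<Longrightarrow> N \<subseteq> {..<p}"
    and inj: "\<And>N b. N \<in> Ms \<Longrightarrow> b \<in> carrier_vec p \<Longrightarrow> (\<And>j. j < p \<Longrightarrow> j \<notin> N \<Longrightarrow> vec_index b j = 0) \<Longrightarrow>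
      A *\<^sub>v b = 0\<^sub>v n \<Longrightarrow> b = 0\<^sub>v p"
    and Mhat: "\<And>y. y \<in> carrier_vec n \<Longrightarrow> Mhat y \<in> Ms"
    and opt: "\<And>y N. y \<in> carrier_vec n \<Longrightarrow> N \<in> Ms \<Longrightarrow>
      sqn (y - A *\<^sub>v lse A (Mhat y) y) + pen (Mhat y) \<le> sqn (y - A *\<^sub>v lse A N y) + pen N"
    and as: "0 < a" "a < 1" "0 < s" "2 * (s / a) < 1"
    and K: "(\<Sum>N\<in>Ms. exp (- (s / \<sigma>\<^sup>2 * pen N)) * (1 / sqrt (1 - 2 * (s / a))) ^ (card N + 1)) \<le> K"
    and M: "M \<in> Ms" "0 \<le> pen M"
    and b: "b \<in> carrier_vec p" "\<And>j. j < p \<Longrightarrow> j \<notin> M \<Longrightarrow> vec_index b j = 0"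
  shows "risk n \<sigma> (map_estimator A Mhat) (A *\<^sub>v b) \<le> ennreal ((pen M + \<sigma>\<^sup>2 / s * K) / (1 - a))"
proof -
  interpret prob_space "gauss_noise n \<sigma>" by (rule prob_space_gauss_noise[OF \<sigma>])
  have mu: "A *\<^sub>v b \<in> carrier_vec n" using A b by auto
  have colc: "col A j \<in> carrier_vec n" for j using A by auto
  have "\<exists>d w. d \<le> card N + 1 \<and> orthonormal n d w \<and> parseval n d w (A *\<^sub>v b) \<and> (\<forall>j\<in>N. parseval n d w (col A j))"
    if N: "N \<in> Ms" for N
  proof -
    have fN: "finite N" using Ms(2)[OF N] finite_subset by blast
    define vs where "vs = (A *\<^sub>v b) # map (col A) (sorted_list_of_set N)"
    have "set vs \<subseteq> carrier_vec n" using mu colc by (auto simp: vs_def)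
    from orthonormal_spanning[OF this] show ?thesis using fN by (auto simp: vs_def)
  qed
  then obtain d w where dw: "\<And>N. N \<in> Ms \<Longrightarrow> d N \<le> card N + 1" "\<And>N. N \<in> Ms \<Longrightarrow> orthonormal n (d N) (w N)"
    "\<And>N. N \<in> Ms \<Longrightarrow> parseval n (d N) (w N) (A *\<^sub>v b)"
    "\<And>N j. N \<in> Ms \<Longrightarrow> j \<in> N \<Longrightarrow> parseval n (d N) (w N) (col A j)" by metis
  define t where "t = s / a"
  have t: "0 \<le> t" "t < 1 / 2" using as by (auto simp: t_def)
  define V where "V = 1 / sqrt (1 - 2 * t)"
  have V1: "1 \<le> V" using t by (simp add: V_def)
  define Q where "Q N e = (\<Sum>i<d N. (scalar_prod e (w N i))\<^sup>2)" for N e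
  define h where "h N = \<sigma>\<^sup>2 / (s * (1 - a)) * exp (- (s / \<sigma>\<^sup>2 * pen N))" for N
  have h0: "0 \<le> h N" for N using as by (simp add: h_def)
  have mQ: "(\<lambda>e. ennreal (exp (t / \<sigma>\<^sup>2 * Q N e))) \<in> borel_measurable (borel_vec n)" if "N \<in> Ms" for N
  proof -
    have [measurable]: "(\<lambda>e. scalar_prod e (w N i)) \<in> borel_measurable (borel_vec n)" if "i < d N" for i
      by (rule measurable_scalar_prod[of _ _ n])
        (use that dw(2)[OF \<open>N \<in> Ms\<close>] in \<open>auto simp: orthonormal_def\<close>)
    show ?thesis unfolding Q_def by measurable
  qed
  have pt: "sqn (map_estimator A Mhat (A *\<^sub>v b + e) - A *\<^sub>v b)
      \<le> pen M / (1 - a) + (\<Sum>N\<in>Ms. h N * exp (t / \<sigma>\<^sup>2 * Q N e))" if e: "e \<in> carrier_vec n" for e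
  proof -
    define y where "y = A *\<^sub>v b + e"
    have cy: "y \<in> carrier_vec n" using mu e by (simp add: y_def)
    define N where "N = Mhat y"
    have N: "N \<in> Ms" using Mhat[OF cy] by (simp add: N_def)
    have injM: "\<And>b. b \<in> carrier_vec p \<Longrightarrow> (\<And>j. j < p \<Longrightarrow> j \<notin> M \<Longrightarrow> vec_index b j = 0) \<Longrightarrow>
      A *\<^sub>v b = 0\<^sub>v n \<Longrightarrow> b = 0\<^sub>v p" using inj[OF M(1)] by blast
    have injN: "\<And>b. b \<in> carrier_vec p \<Longrightarrow> (\<And>j. j < p \<Longrightarrow> j \<notin> N \<Longrightarrow> vec_index b j = 0) \<Longrightarrow>
      A *\<^sub>v b = 0\<^sub>v n \<Longrightarrow> b = 0\<^sub>v p" using inj[OF N] by blast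
    have "(1 - a) * sqn (A *\<^sub>v lse A N y - A *\<^sub>v b) \<le> pen M + ((1 / a) * Q N e - pen N)"
      unfolding Q_def
    proof (rule penalized_lse_excess_bound[where M = M and N = N, OF A e b(1) _ _ _ y_def _ dw(2,3)[OF N]])
      show "sqn (y - A *\<^sub>v lse A N y) + pen N \<le> sqn (y - A *\<^sub>v lse A M y) + pen M"
        unfolding N_def by (rule opt[OF cy M(1)])
    qed (use b(2) injM injN dw(4)[OF N] as in \<open>blast | simp\<close>)+
    moreover have "(1 / a) * Q N e - pen N \<le> \<sigma>\<^sup>2 / s * (exp (- (s / \<sigma>\<^sup>2 * pen N)) * exp (t / \<sigma>\<^sup>2 * Q N e))"
    proof -
      define x where "x = (1 / a) * Q N e - pen N"
      have sx: "s / \<sigma>\<^sup>2 * x = - (s / \<sigma>\<^sup>2 * pen N) + t / \<sigma>\<^sup>2 * Q N e"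
        by (simp add: x_def t_def algebra_simps)
      have "s / \<sigma>\<^sup>2 * x \<le> exp (s / \<sigma>\<^sup>2 * x)" using exp_ge_add_one_self[of "s / \<sigma>\<^sup>2 * x"] by linarith
      then have "\<sigma>\<^sup>2 / s * (s / \<sigma>\<^sup>2 * x) \<le> \<sigma>\<^sup>2 / s * exp (s / \<sigma>\<^sup>2 * x)"
        using as by (intro mult_left_mono) auto
      moreover have "\<sigma>\<^sup>2 / s * (s / \<sigma>\<^sup>2 * x) = x" using as \<sigma> by simp
      ultimately show ?thesis unfolding x_def[symmetric] sx exp_add by simp
    qed
    ultimately have "(1 - a) * sqn (A *\<^sub>v lse A N y - A *\<^sub>v b)
        \<le> pen M + \<sigma>\<^sup>2 / s * (exp (- (s / \<sigma>\<^sup>2 * pen N)) * exp (t / \<sigma>\<^sup>2 * Q N e))" by linarith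
    then have "sqn (A *\<^sub>v lse A N y - A *\<^sub>v b)
        \<le> (pen M + \<sigma>\<^sup>2 / s * (exp (- (s / \<sigma>\<^sup>2 * pen N)) * exp (t / \<sigma>\<^sup>2 * Q N e))) / (1 - a)"
      using as by (simp add: pos_le_divide_eq mult.commute)
    also have "\<dots> = pen M / (1 - a) + h N * exp (t / \<sigma>\<^sup>2 * Q N e)"
      using as by (simp add: h_def add_divide_distrib)
    also have "h N * exp (t / \<sigma>\<^sup>2 * Q N e) \<le> (\<Sum>N\<in>Ms. h N * exp (t / \<sigma>\<^sup>2 * Q N e))"
      by (rule member_le_sum[OF N]) (use h0 Ms in auto)
    finally show ?thesis by (simp add: map_estimator_def y_def N_def)
  qed
  have "risk n \<sigma> (map_estimator A Mhat) (A *\<^sub>v b)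
      \<le> (\<integral>\<^sup>+e. ennreal (pen M / (1 - a)) + (\<Sum>N\<in>Ms. ennreal (h N) * ennreal (exp (t / \<sigma>\<^sup>2 * Q N e))) \<partial>gauss_noise n \<sigma>)"
    unfolding risk_def
  proof (rule nn_integral_mono)
    fix e assume "e \<in> space (gauss_noise n \<sigma>)"
    then have e: "e \<in> carrier_vec n" by simp
    have "ennreal (sqn (map_estimator A Mhat (A *\<^sub>v b + e) - A *\<^sub>v b))
        \<le> ennreal (pen M / (1 - a) + (\<Sum>N\<in>Ms. h N * exp (t / \<sigma>\<^sup>2 * Q N e)))"
      by (rule ennreal_leI[OF pt[OF e]])
    also have "\<dots> = ennreal (pen M / (1 - a)) + (\<Sum>N\<in>Ms. ennreal (h N) * ennreal (exp (t / \<sigma>\<^sup>2 * Q N e)))"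
      using h0 as M by (subst ennreal_plus) (auto intro!: sum_nonneg simp: sum_ennreal[symmetric] ennreal_mult)
    finally show "ennreal (sqn (map_estimator A Mhat (A *\<^sub>v b + e) - A *\<^sub>v b))
      \<le> ennreal (pen M / (1 - a)) + (\<Sum>N\<in>Ms. ennreal (h N) * ennreal (exp (t / \<sigma>\<^sup>2 * Q N e)))" .
  qed
  also have "\<dots> = ennreal (pen M / (1 - a)) + (\<Sum>N\<in>Ms. ennreal (h N) * (\<integral>\<^sup>+e. ennreal (exp (t / \<sigma>\<^sup>2 * Q N e)) \<partial>gauss_noise n \<sigma>))"
    using mQ emeasure_space_1 by (simp add: nn_integral_add nn_integral_sum nn_integral_cmult)
  also have "\<dots> = ennreal (pen M / (1 - a)) + (\<Sum>N\<in>Ms. ennreal (h N) * ennreal (V ^ d N))"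
    unfolding Q_def V_def using nn_integral_gauss_exp_projection[OF \<sigma> t dw(2)] by simp
  also have "\<dots> = ennreal (pen M / (1 - a) + (\<Sum>N\<in>Ms. h N * V ^ d N))"
    using h0 as M V1 by (subst ennreal_plus) (auto intro!: sum_nonneg simp: sum_ennreal[symmetric] ennreal_mult)
  also have "\<dots> \<le> ennreal ((pen M + \<sigma>\<^sup>2 / s * K) / (1 - a))"
  proof (rule ennreal_leI)
    have "(\<Sum>N\<in>Ms. h N * V ^ d N) \<le> (\<Sum>N\<in>Ms. h N * V ^ (card N + 1))"
      using dw(1) V1 h0 by (intro sum_mono mult_left_mono power_increasing) auto
    also have "\<dots> = \<sigma>\<^sup>2 / (s * (1 - a)) * (\<Sum>N\<in>Ms. exp (- (s / \<sigma>\<^sup>2 * pen N)) * V ^ (card N + 1))"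
      unfolding h_def sum_distrib_left by (simp only: mult.assoc)
    also have "\<dots> \<le> \<sigma>\<^sup>2 / (s * (1 - a)) * K"
      using K as unfolding V_def t_def by (intro mult_left_mono) auto
    finally show "pen M / (1 - a) + (\<Sum>N\<in>Ms. h N * V ^ d N) \<le> (pen M + \<sigma>\<^sup>2 / s * K) / (1 - a)"
      by (simp add: add_divide_distrib)
  qed
  finally show ?thesis .
qed

section \<open>Sparse eigenvalues\<close>

lemma nonzero_entries_finite [simp]: "finite (nonzero_entries b)"
  by (simp add: nonzero_entries_def)

lemma sqn_mult_mat_vec_le:
  fixes A :: "real mat"
  assumes A: "A \<in> carrier_mat n p"
  shows "\<exists>C. \<forall>b\<in>carrier_vec p. sqn (A *\<^sub>v b) \<le> C * sqn b"
proof (intro exI ballI)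
  fix b :: "real vec" assume b: "b \<in> carrier_vec p"
  have "sqn (A *\<^sub>v b) = (\<Sum>i<n. (\<Sum>j<p. A $$ (i, j) * vec_index b j)\<^sup>2)"
    using A b by (subst sqn_eq_sum[of _ n]) (auto simp: scalar_prod_eq_sum[of _ p] intro!: sum.cong)
  also have "\<dots> \<le> (\<Sum>i<n. (\<Sum>j<p. (A $$ (i, j))\<^sup>2) * (\<Sum>j<p. (vec_index b j)\<^sup>2))"
    by (intro sum_mono Cauchy_Schwarz_ineq_sum)
  also have "\<dots> = (\<Sum>i<n. \<Sum>j<p. (A $$ (i, j))\<^sup>2) * sqn b"
    using b by (simp add: sqn_eq_sum sum_distrib_right)
  finally show "sqn (A *\<^sub>v b) \<le> (\<Sum>i<n. \<Sum>j<p. (A $$ (i, j))\<^sup>2) * sqn b" .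
qed

text \<open>A positive ratio forces both extreme eigenvalues to be positive, since they are an infimum and
  a supremum of nonnegative quotients. The supremum is over a bounded set because a matrix is a bounded
  operator.\<close>

lemma sparse_eigenvalue_bounds:
  fixes A :: "real mat"
  assumes A: "A \<in> carrier_mat n p" and r: "1 \<le> r" "1 \<le> p" and \<delta>: "0 < \<delta>" "\<delta> \<le> tau A r"
  obtains lo hi where "0 < lo" "0 < hi" "\<delta> * hi \<le> lo"
    "\<And>b. b \<in> carrier_vec p \<Longrightarrow> card (nonzero_entries b) \<le> r \<Longrightarrow> lo * sqn b \<le> sqn (A *\<^sub>v b)"
    "\<And>b. b \<in> carrier_vec p \<Longrightarrow> card (nonzero_entries b) \<le> r \<Longrightarrow> sqn (A *\<^sub>v b) \<le> hi * sqn b"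
proof -
  define Q where "Q = {sqn (A *\<^sub>v b) / sqn b | b. b \<in> carrier_vec (dim_col A) \<and>
     1 \<le> card (nonzero_entries b) \<and> card (nonzero_entries b) \<le> r}"
  have lo: "phi_min A r = Inf Q" and hi: "phi_max A r = Sup Q" by (simp_all add: phi_min_def phi_max_def Q_def)
  obtain C where C: "\<forall>b\<in>carrier_vec p. sqn (A *\<^sub>v b) \<le> C * sqn b" using sqn_mult_mat_vec_le[OF A] by blast
  have pos: "0 < sqn b" if "b \<in> carrier_vec p" "1 \<le> card (nonzero_entries b)" for b
  proof -
    have "nonzero_entries b \<noteq> {}" using that by auto
    then have "b \<noteq> 0\<^sub>v p" using that by (auto simp: nonzero_entries_def)
    then show ?thesis using sqn_eq_0_iff[OF that(1)] sqn_nonneg[of b] by linarith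
  qed
  have dA: "dim_col A = p" using A by simp
  have ge0: "0 \<le> x" if "x \<in> Q" for x using that by (auto simp: Q_def sqn_nonneg)
  have leC: "x \<le> C" if "x \<in> Q" for x
    using that C pos by (auto simp: Q_def dA pos_divide_le_eq)
  have bb: "bdd_below Q" "bdd_above Q" using bdd_belowI[of Q 0] bdd_aboveI[of Q C] ge0 leC by auto
  have mem: "sqn (A *\<^sub>v b) / sqn b \<in> Q"
    if "b \<in> carrier_vec p" "1 \<le> card (nonzero_entries b)" "card (nonzero_entries b) \<le> r" for b
    using that by (auto simp: Q_def dA)
  have "nonzero_entries (unit_vec p 0) = {0}" using r by (auto simp: nonzero_entries_def split: if_splits)
  then have "sqn (A *\<^sub>v unit_vec p 0) / sqn (unit_vec p 0) \<in> Q" using r by (intro mem) auto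
  then have ne: "Q \<noteq> {}" by blast
  have nn: "0 \<le> Inf Q" using ne ge0 by (intro cInf_greatest) auto
  have "Inf Q \<le> Sup Q" using ne bb by (intro cInf_le_cSup) auto
  moreover have t: "\<delta> \<le> Inf Q / Sup Q" using \<delta> by (simp add: tau_def lo hi)
  then have "Inf Q \<noteq> 0" using \<delta> by auto
  ultimately have p: "0 < Inf Q" "0 < Sup Q" using nn by auto
  have zero: "b = 0\<^sub>v p" if "b \<in> carrier_vec p" "\<not> 1 \<le> card (nonzero_entries b)" for b
  proof -
    have "nonzero_entries b = {}" using that by (simp add: not_le)
    then show ?thesis using that(1) by (intro eq_vecI) (auto simp: nonzero_entries_def)
  qed
  have A0: "A *\<^sub>v 0\<^sub>v p = 0\<^sub>v n" using A by (intro eq_vecI) auto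
  have z: "sqn (0\<^sub>v k) = 0" for k by (simp add: sqn_def)
  show thesis
  proof (rule that[OF p])
    show "\<delta> * Sup Q \<le> Inf Q" using t p by (simp add: pos_le_divide_eq)
    show "Inf Q * sqn b \<le> sqn (A *\<^sub>v b)" if "b \<in> carrier_vec p" "card (nonzero_entries b) \<le> r" for b
    proof (cases "1 \<le> card (nonzero_entries b)")
      case True
      show ?thesis using cInf_lower[OF mem[OF that(1) True that(2)] bb(1)] pos[OF that(1) True]
        by (simp add: pos_le_divide_eq)
    qed (use zero[OF that(1)] A0 in \<open>simp add: z\<close>)
    show "sqn (A *\<^sub>v b) \<le> Sup Q * sqn b" if "b \<in> carrier_vec p" "card (nonzero_entries b) \<le> r" for b
    proof (cases "1 \<le> card (nonzero_entries b)")
      case True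
      show ?thesis using cSup_upper[OF mem[OF that(1) True that(2)] bb(2)] pos[OF that(1) True]
        by (simp add: pos_divide_le_eq)
    qed (use zero[OF that(1)] A0 in \<open>simp add: z\<close>)
  qed
qed

section \<open>Counting models\<close>

lemma in_modelsD:
  assumes "S \<subseteq> {..<p}" "card S = r" "N \<in> models p r S k"
  shows "N \<subseteq> {..<p}" "card N = k" "k \<le> r"
  using assms by (auto simp: models_def split: if_splits)

lemma in_models_upto:
  assumes "S \<subseteq> {..<p}" "card S = r"
  shows "N \<in> models_upto p r S q \<longleftrightarrow> card N \<le> q \<and> N \<in> models p r S (card N)"
  using in_modelsD[OF assms] by (auto simp: models_upto_def)

lemma finite_models [simp]: "finite (models p r S k)"
  by (auto simp: models_def)

lemma finite_models_upto [simp]: "finite (models_upto p r S q)"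
  by (simp add: models_upto_def)

lemma num_models_eq: "num_models p r S k = (if k < r then p choose k else if k = r then 1 else 0)"
  using n_subsets[of "{..<p}" k] by (simp add: num_models_def models_def)

lemma sum_over_models:
  fixes f :: "nat \<Rightarrow> real"
  assumes "S \<subseteq> {..<p}" "card S = r"
  shows "(\<Sum>N\<in>models_upto p r S r. f (card N)) = (\<Sum>k\<le>r. real (num_models p r S k) * f k)"
proof -
  have "(\<Sum>N\<in>models_upto p r S r. f (card N)) = (\<Sum>k\<le>r. \<Sum>N\<in>models p r S k. f (card N))"
    unfolding models_upto_def
    by (rule sum.UNION_disjoint) (auto dest: in_modelsD(2)[OF assms])
  also have "\<dots> = (\<Sum>k\<le>r. \<Sum>N\<in>models p r S k. f k)"
    by (intro sum.cong refl) (simp add: in_modelsD(2)[OF assms])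
  finally show ?thesis by (simp add: num_models_def)
qed

section \<open>Model complexity\<close>

text \<open>From $\binom{p}{k}k! \le p^k$ and $k! \ge (k/e)^k$, the latter because $k^k/k!$ is a single term of the
  series of $e^k$.\<close>

lemma binomial_le_exp_power:
  assumes "1 \<le> k"
  shows "real (p choose k) \<le> (exp 1 * real p / real k) ^ k"
proof -
  have "(real k ^ k /\<^sub>R fact k) \<le> exp (real k)"
    using sum_le_suminf[OF summable_exp_generic[of "real k"], of "{k}"] by (simp add: exp_def)
  then have "real k ^ k \<le> exp 1 ^ k * fact k"
    by (simp add: field_simps exp_of_nat_mult[symmetric])
  moreover have "real (p choose k) * fact k \<le> real p ^ k"
    using binomial_fact_pow[of p k] by (metis of_nat_fact of_nat_le_iff of_nat_mult of_nat_power)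
  ultimately have "(real (p choose k) * fact k) * real k ^ k \<le> real p ^ k * (exp 1 ^ k * fact k)"
    by (intro mult_mono) auto
  then have "real (p choose k) * real k ^ k \<le> exp 1 ^ k * real p ^ k"
    by (simp add: mult_ac)
  then show ?thesis using assms by (simp add: power_divide power_mult_distrib pos_le_divide_eq)
qed

text \<open>For $1 \le k \le p/2$ this is $\ln\binom{p}{k}$ up to constants.\<close>

definition complexity :: "nat \<Rightarrow> nat \<Rightarrow> real" where
  "complexity p k = real k * (ln (real p / real k) + 1)"

lemma complexity_ge: "1 \<le> k \<Longrightarrow> k \<le> p \<Longrightarrow> real k \<le> complexity p k"
  by (simp add: complexity_def)

text \<open>The derivative in $k$ is $\ln(p/k) \ge 0$; the proof uses $\ln x \le x-1$ instead.\<close>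

lemma complexity_mono:
  assumes "1 \<le> k" "k \<le> q" "q \<le> p"
  shows "complexity p k \<le> complexity p q"
proof -
  have "ln (real q / real k) \<le> real q / real k - 1" using assms by (intro ln_le_minus_one) auto
  then have "real k * ln (real q / real k) \<le> real q - real k"
    using assms by (simp add: field_simps)
  moreover have "ln (real p / real k) = ln (real p / real q) + ln (real q / real k)"
    using assms by (simp add: ln_div)
  moreover have "0 \<le> (real q - real k) * ln (real p / real q)" using assms by simp
  ultimately show ?thesis by (simp add: complexity_def algebra_simps)
qed

lemma ln_binomial_le:
  assumes "1 \<le> k" "k \<le> p"
  shows "ln (real (p choose k)) \<le> complexity p k"
proof -
  have "ln (real (p choose k)) \<le> ln ((exp 1 * real p / real k) ^ k)"
    using binomial_le_exp_power[OF assms(1)] assms by (subst ln_le_cancel_iff) (auto simp: zero_less_binomial_iff)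
  also have "\<dots> = complexity p k"
    using assms by (simp add: ln_realpow ln_div ln_mult complexity_def)
  finally show ?thesis .
qed

section \<open>Priors on model sizes\<close>

definition prior_in_range :: "nat \<Rightarrow> nat \<Rightarrow> real \<Rightarrow> real \<Rightarrow> (nat \<Rightarrow> real) \<Rightarrow> bool" where
  "prior_in_range p r c0 c \<pi> \<longleftrightarrow> size_prior r \<pi> \<and>
     (\<forall>k\<in>{1..<r}. (real k / (real p * exp 1)) powr (c * real k) \<le> \<pi> k \<and>
        \<pi> k \<le> (real p / (real k * exp c0)) ^ k) \<and>
     exp (- c * real r) \<le> \<pi> r \<and> \<pi> r \<le> exp (- c0 * real r)"

text \<open>The part of the penalty that depends on the prior; it is the negative logarithm of the prior probability of one model.\<close>

definition log_weight :: "nat \<Rightarrow> nat \<Rightarrow> nat set \<Rightarrow> (nat \<Rightarrow> real) \<Rightarrow> nat \<Rightarrow> real" where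
  "log_weight p r S \<pi> k = ln (real (num_models p r S k) / \<pi> k)"

lemma num_models_pos: "r \<le> p \<Longrightarrow> k \<le> r \<Longrightarrow> 0 < num_models p r S k"
  by (auto simp: num_models_eq)

text \<open>Here the upper bounds on the prior are used: the binomial coefficient is at least $(p/k)^k$,
  and $\pi(k)$ is at most $(p/k)^k$ times $e^{-c_0k}$.\<close>

lemma log_weight_ge:
  assumes "prior_in_range p r c0 c \<pi>" "1 \<le> r" "r \<le> p" "k \<le> r"
  shows "c0 * real k \<le> log_weight p r S \<pi> k"
proof -
  have pos: "0 < \<pi> k" using assms by (auto simp: prior_in_range_def size_prior_def)
  have m: "0 < real (num_models p r S k)" using num_models_pos[of r p k S] assms by simp
  have "exp (c0 * real k) \<le> real (num_models p r S k) / \<pi> k"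
  proof -
    consider "k = 0" | "1 \<le> k" "k < r" | "k = r" "1 \<le> k" using assms by linarith
    then show ?thesis
    proof cases
      case 1
      have "\<pi> 0 \<le> (\<Sum>k\<le>r. \<pi> k)"
        using assms by (intro member_le_sum) (auto simp: prior_in_range_def size_prior_def less_imp_le)
      then have "\<pi> 0 \<le> 1" using assms by (simp add: prior_in_range_def size_prior_def)
      then show ?thesis using 1 pos assms by (simp add: num_models_eq pos_le_divide_eq)
    next
      case 2
      have "exp (c0 * real k) * \<pi> k \<le> exp c0 ^ k * (real p / (real k * exp c0)) ^ k"
        using assms 2 by (intro mult_mono) (auto simp: prior_in_range_def exp_of_nat_mult[of k c0] mult.commute[of c0] less_imp_le[OF pos])
      also have "\<dots> = (real p / real k) ^ k"
        by (simp add: power_mult_distrib[symmetric])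
      also have "\<dots> \<le> real (p choose k)"
        using binomial_ge_n_over_k_pow_k[of k p, where 'a = real] assms 2 by simp
      finally show ?thesis using 2 pos by (simp add: num_models_eq pos_le_divide_eq)
    next
      case 3
      have "exp (c0 * real k) * \<pi> k \<le> exp (c0 * real k) * exp (- c0 * real k)"
        using assms 3 by (intro mult_left_mono) (auto simp: prior_in_range_def)
      also have "\<dots> = 1" by (simp add: exp_add[symmetric])
      finally show ?thesis using 3 pos by (simp add: num_models_eq pos_le_divide_eq)
    qed
  qed
  then have "ln (exp (c0 * real k)) \<le> log_weight p r S \<pi> k"
    unfolding log_weight_def using m pos by (subst ln_le_cancel_iff) auto
  then show ?thesis by simp
qed

text \<open>The lower bounds on the prior limit the penalty of a model by its complexity. Size $0$ is left
  out, as no lower bound on $\pi(0)$ is available.\<close>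

lemma log_weight_le:
  assumes "prior_in_range p r c0 c \<pi>" "0 \<le> c" "1 \<le> k" "k \<le> r" "r \<le> p"
  shows "log_weight p r S \<pi> k \<le> (1 + c) * complexity p k"
proof -
  have pos: "0 < \<pi> k" using assms by (auto simp: prior_in_range_def size_prior_def)
  have m: "0 < real (num_models p r S k)" using num_models_pos[of r p k S] assms by simp
  have "ln (real (num_models p r S k)) \<le> complexity p k"
    using ln_binomial_le[of k p] complexity_ge[of k p] assms by (auto simp: num_models_eq)
  moreover have "- c * complexity p k \<le> ln (\<pi> k)"
  proof (cases "k < r")
    case True
    have "ln ((real k / (real p * exp 1)) powr (c * real k)) \<le> ln (\<pi> k)"
      using True assms pos by (subst ln_le_cancel_iff) (auto simp: prior_in_range_def)
    moreover have "ln ((real k / (real p * exp 1)) powr (c * real k)) = - c * complexity p k"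
      using assms by (simp add: ln_powr ln_div ln_mult complexity_def algebra_simps)
    ultimately show ?thesis by simp
  next
    case False
    then have "k = r" using assms by simp
    then have "ln (exp (- c * real k)) \<le> ln (\<pi> k)"
      using assms pos by (subst ln_le_cancel_iff) (auto simp: prior_in_range_def)
    moreover have "c * real k \<le> c * complexity p k"
      using complexity_ge[of k p] assms by (intro mult_left_mono) auto
    ultimately show ?thesis by simp
  qed
  moreover have "log_weight p r S \<pi> k = ln (real (num_models p r S k)) - ln (\<pi> k)"
    unfolding log_weight_def using m pos by (simp add: ln_div)
  ultimately show ?thesis by (simp add: algebra_simps)
qed

section \<open>The exponential weights of the models\<close>

text \<open>The relative excess $\eta$ of $1/a$ over one in the oracle inequality. It is small enough for
  $\gamma(2\eta+\eta^2) \le 1/2$.\<close>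

definition slack :: "real \<Rightarrow> real" where "slack \<gamma> = 1 / (6 * (1 + \<gamma>))"

text \<open>The contribution of one model to the sum in the oracle inequality. With $\eta = 0$ the two powers
  of $1+\gamma$ would cancel up to a single factor $\sqrt{1+\gamma}$. With $\eta > 0$ the chi-square factor grows by
  $(1-x)^{-(k+1)/2}$, where $x = \gamma(2\eta+\eta^2) \le 3\gamma\eta$, and the surplus $e^{-\eta L}$ compensates this as soon
  as $L \ge 12\gamma k$.\<close>

lemma tilted_weight_le:
  assumes \<gamma>: "0 < \<gamma>" and L: "12 * \<gamma> * real k \<le> L"
  defines "\<eta> \<equiv> slack \<gamma>"
  shows "(1 + \<eta>)\<^sup>2 * \<gamma> / (1 + \<gamma>) < 1"
    and "exp (- ((1 + \<eta>) * (L + real k / 2 * ln (1 + \<gamma>)))) * (1 / sqrt (1 - (1 + \<eta>)\<^sup>2 * \<gamma> / (1 + \<gamma>))) ^ (k + 1)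
      \<le> exp (- L) * exp ((ln (1 + \<gamma>) + 1) / 2)"
proof -
  have \<eta>: "0 < \<eta>" "\<eta> \<le> 1" "\<gamma> * \<eta> \<le> 1 / 6" using \<gamma> by (auto simp: \<eta>_def slack_def field_simps)
  define x where "x = \<gamma> * (2 * \<eta> + \<eta>\<^sup>2)"
  have "\<eta>\<^sup>2 \<le> \<eta>" using \<eta> by (simp add: power2_eq_square mult_left_le)
  then have "x \<le> \<gamma> * (3 * \<eta>)" unfolding x_def using \<gamma> by (intro mult_left_mono) auto
  then have x: "0 \<le> x" "x \<le> 3 * (\<gamma> * \<eta>)" "x \<le> 1 / 2"
    using \<gamma> \<eta> by (simp add: x_def, linarith+)
  have eq: "1 - (1 + \<eta>)\<^sup>2 * \<gamma> / (1 + \<gamma>) = (1 - x) / (1 + \<gamma>)"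
    using \<gamma> by (simp add: x_def field_simps power2_eq_square)
  have v: "0 < (1 - x) / (1 + \<gamma>)" using x \<gamma> by auto
  then show "(1 + \<eta>)\<^sup>2 * \<gamma> / (1 + \<gamma>) < 1" using eq by linarith
  have lnx: "- ln (1 - x) \<le> 2 * x"
  proof -
    have "x\<^sup>2 \<le> x / 2" using x by (simp add: power2_eq_square) (use mult_left_mono[of x "1/2" x] in simp)
    then show ?thesis using ln_one_minus_pos_lower_bound[of x] x by linarith
  qed
  define l where "l = ln (1 + \<gamma>)"
  have l: "0 \<le> l" using \<gamma> by (simp add: l_def)
  have "1 / sqrt ((1 - x) / (1 + \<gamma>)) = exp ((l - ln (1 - x)) / 2)"
  proof -
    have "sqrt ((1 - x) / (1 + \<gamma>)) = exp (ln ((1 - x) / (1 + \<gamma>)) / 2)"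
      using v x \<gamma> by (simp add: powr_half_sqrt[symmetric] powr_def)
    also have "ln ((1 - x) / (1 + \<gamma>)) = ln (1 - x) - l" using x \<gamma> by (simp add: ln_div l_def)
    finally have "1 / sqrt ((1 - x) / (1 + \<gamma>)) = exp (- ((ln (1 - x) - l) / 2))"
      by (simp only: exp_minus inverse_eq_divide)
    also have "- ((ln (1 - x) - l) / 2) = (l - ln (1 - x)) / 2" by (simp add: minus_divide_left)
    finally show ?thesis .
  qed
  then have "exp (- ((1 + \<eta>) * (L + real k / 2 * l))) * (1 / sqrt ((1 - x) / (1 + \<gamma>))) ^ (k + 1)
      = exp (- ((1 + \<eta>) * (L + real k / 2 * l)) + real (k + 1) * ((l - ln (1 - x)) / 2))"
    by (simp only: exp_of_nat_mult[symmetric] exp_add)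
  also have "\<dots> \<le> exp (- L + (l + 1) / 2)"
  proof -
    define B where "B = (real k + 1) * (l - ln (1 - x))"
    define kl where "kl = real k * l"
    define kx where "kx = real k * x"
    define kg where "kg = real k * (\<gamma> * \<eta>)"
    define eL where "eL = \<eta> * L"
    define ekl where "ekl = \<eta> * real k * l"
    have "B \<le> (real k + 1) * (l + 2 * x)"
      unfolding B_def using lnx by (intro mult_left_mono) auto
    also have "\<dots> = kl + 2 * kx + l + 2 * x"
      by (simp add: kl_def kx_def algebra_simps)
    finally have f1: "B \<le> kl + 2 * kx + l + 2 * x" .
    have f2: "12 * kg \<le> eL"
      using mult_left_mono[OF L, of \<eta>] \<eta> by (simp add: kg_def eL_def mult_ac)
    have f3: "kx \<le> 3 * kg"
      using mult_left_mono[OF x(2), of "real k"] by (simp add: kx_def kg_def)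
    have f4: "0 \<le> ekl" "0 \<le> kg" using \<eta> l \<gamma> by (auto simp: ekl_def kg_def)
    have f5: "- L - eL - kl / 2 - ekl / 2 + B / 2 \<le> - L + (l + 1) / 2"
      using f1 f2 f3 f4 x(3) by argo
    have "- ((1 + \<eta>) * (L + real k / 2 * l)) + real (k + 1) * ((l - ln (1 - x)) / 2)
        = - L - eL - kl / 2 - ekl / 2 + B / 2"
      by (simp add: B_def kl_def ekl_def eL_def field_simps)
    with f5 show ?thesis by simp
  qed
  finally show "exp (- ((1 + \<eta>) * (L + real k / 2 * ln (1 + \<gamma>)))) * (1 / sqrt (1 - (1 + \<eta>)\<^sup>2 * \<gamma> / (1 + \<gamma>))) ^ (k + 1)
      \<le> exp (- L) * exp ((ln (1 + \<gamma>) + 1) / 2)"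
    unfolding eq l_def[symmetric] by (simp only: exp_add)
qed

text \<open>In the numerator, the constant from the penalty of the comparison model, and the bound on the sum of the
  exponential weights divided by $s$; in the denominator, the factor $1-a$.\<close>

definition map_constant :: "real \<Rightarrow> real \<Rightarrow> real" where
  "map_constant \<gamma> c =
     (2 * (1 + 1 / \<gamma>) * (1 + c + ln (1 + \<gamma>) / 2)
       + exp ((ln (1 + \<gamma>) + 1) / 2) / ((1 + slack \<gamma>) * \<gamma> / (2 * (1 + \<gamma>))))
     / (1 - 1 / (1 + slack \<gamma>))"

lemma map_constant_pos: "0 < \<gamma> \<Longrightarrow> 0 \<le> c \<Longrightarrow> 0 < map_constant \<gamma> c"
  unfolding map_constant_def slack_def
  by (intro divide_pos_pos add_nonneg_pos mult_nonneg_nonneg) (auto simp: field_simps add_pos_nonneg)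

lemma c_gamma_ge: "0 < \<gamma> \<Longrightarrow> 12 * \<gamma> \<le> c_gamma \<gamma>"
  by (simp add: c_gamma_def power2_eq_square algebra_simps)

section \<open>The risk of the MAP estimator\<close>

text \<open>The comparison model is the true one, unless the truth is the zero vector. In that case it is a model of
  size one, because the penalty of the null model may be arbitrarily large.\<close>

lemma sup_risk_map_le:
  fixes A :: "real mat"
  assumes A: "A \<in> carrier_mat n p" and \<sigma>: "0 < \<sigma>" and r: "2 \<le> r" "r \<le> p"
    and S: "S \<subseteq> {..<p}" "card S = r"
    and lo: "0 < lo" "\<And>b. b \<in> carrier_vec p \<Longrightarrow> card (nonzero_entries b) \<le> r \<Longrightarrow> lo * sqn b \<le> sqn (A *\<^sub>v b)"
    and \<gamma>: "0 < \<gamma>" and c: "0 \<le> c"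
    and prior: "prior_in_range p r (c_gamma \<gamma>) c \<pi>"
    and sel: "map_selector A r S \<sigma> \<gamma> \<pi> Mhat"
    and p0: "1 \<le> p0" "p0 \<le> r"
  shows "sup_risk A r S \<sigma> (map_estimator A Mhat) p0
    \<le> ennreal (map_constant \<gamma> c * (\<sigma>\<^sup>2 * complexity p p0))"
  unfolding sup_risk_def
proof (rule SUP_least)
  have dA: "dim_row A = n" "dim_col A = p" using A by auto
  define Ms where "Ms = models_upto p r S r"
  define L where "L = log_weight p r S \<pi>"
  define pen where "pen N = 2 * \<sigma>\<^sup>2 * (1 + 1 / \<gamma>) * (L (card N) + real (card N) / 2 * ln (1 + \<gamma>))" for N :: "nat set"
  define \<eta> where "\<eta> = slack \<gamma>"
  define a where "a = 1 / (1 + \<eta>)"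
  define s where "s = (1 + \<eta>) * \<gamma> / (2 * (1 + \<gamma>))"
  define K where "K = exp ((ln (1 + \<gamma>) + 1) / 2)"
  have \<eta>: "0 < \<eta>" using \<gamma> by (simp add: \<eta>_def slack_def)
  have a: "0 < a" "a < 1" and s: "0 < s" using \<eta> \<gamma> by (auto simp: a_def s_def)
  have sa: "2 * (s / a) = (1 + \<eta>)\<^sup>2 * \<gamma> / (1 + \<gamma>)"
    using \<eta> \<gamma> by (simp add: s_def a_def power2_eq_square field_simps)
  have lw: "12 * \<gamma> * real k \<le> L k" if "k \<le> r" for k
  proof -
    have "12 * \<gamma> * real k \<le> c_gamma \<gamma> * real k" by (intro mult_right_mono c_gamma_ge \<gamma>) simp
    also have "\<dots> \<le> L k" unfolding L_def using prior r that by (intro log_weight_ge) auto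
    finally show ?thesis .
  qed
  have \<pi>: "0 < \<pi> k" if "k \<le> r" for k using that prior by (simp add: prior_in_range_def size_prior_def)
  have m: "0 < real (num_models p r S k)" if "k \<le> r" for k using num_models_pos[of r p k S] that r by simp
  have MsD: "N \<subseteq> {..<p}" "card N \<le> r" "finite N" if "N \<in> Ms" for N
    using that in_modelsD[OF S, of N "card N"] finite_subset[of N "{..<p}"]
    by (auto simp: Ms_def in_models_upto[OF S])
  have crit: "map_criterion A r S \<sigma> \<gamma> \<pi> y N = sqn (y - A *\<^sub>v lse A N y) + pen N" if "N \<in> Ms" for y N
  proof -
    define k where "k = card N"
    have k: "k \<le> r" using MsD[OF that] by (simp add: k_def)
    have "ln (real (num_models p r S k) * inverse (\<pi> k) * (1 + \<gamma>) powr (real k / 2))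
        = L k + real k / 2 * ln (1 + \<gamma>)"
    proof -
      have "0 < real (num_models p r S k) * inverse (\<pi> k)" "0 < (1 + \<gamma>) powr (real k / 2)"
        using m[OF k] \<pi>[OF k] \<gamma> by simp_all
      then have "ln (real (num_models p r S k) * inverse (\<pi> k) * (1 + \<gamma>) powr (real k / 2))
          = ln (real (num_models p r S k) * inverse (\<pi> k)) + ln ((1 + \<gamma>) powr (real k / 2))"
        by (rule ln_mult_pos)
      also have "ln ((1 + \<gamma>) powr (real k / 2)) = real k / 2 * ln (1 + \<gamma>)" by (rule ln_powr)
      finally show ?thesis by (simp only: L_def log_weight_def divide_inverse)
    qed
    then show ?thesis by (simp add: map_criterion_def pen_def dA k_def)
  qed
  have tiltN: "exp (- (s / \<sigma>\<^sup>2 * pen N)) * (1 / sqrt (1 - 2 * (s / a))) ^ (card N + 1)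
      \<le> exp (- L (card N)) * K" if "N \<in> Ms" for N
  proof -
    \<comment> \<open>$s$ is chosen so that the factor $2(1+1/\<gamma>)$ of the penalty cancels\<close>
    have "s / \<sigma>\<^sup>2 * pen N = (1 + \<eta>) * (L (card N) + real (card N) / 2 * ln (1 + \<gamma>))"
    proof -
      have "s * (2 * (1 + 1 / \<gamma>)) = 1 + \<eta>"
      proof -
        have "1 + 1 / \<gamma> = (1 + \<gamma>) / \<gamma>" using \<gamma> by (simp add: field_simps)
        then show ?thesis using \<gamma> by (simp add: s_def)
      qed
      moreover have "s / \<sigma>\<^sup>2 * pen N
          = (s * (2 * (1 + 1 / \<gamma>))) * (L (card N) + real (card N) / 2 * ln (1 + \<gamma>))"
        using \<sigma> by (simp add: pen_def)
      ultimately show ?thesis by simp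
    qed
    then show ?thesis using tilted_weight_le(2)[OF \<gamma> lw[OF MsD(2)[OF that]]]
      by (simp only: sa \<eta>_def K_def)
  qed
  have sumK: "(\<Sum>N\<in>Ms. exp (- (s / \<sigma>\<^sup>2 * pen N)) * (1 / sqrt (1 - 2 * (s / a))) ^ (card N + 1)) \<le> K"
  proof -
    have "(\<Sum>N\<in>Ms. exp (- (s / \<sigma>\<^sup>2 * pen N)) * (1 / sqrt (1 - 2 * (s / a))) ^ (card N + 1))
        \<le> (\<Sum>N\<in>Ms. exp (- L (card N)) * K)" by (intro sum_mono tiltN)
    also have "\<dots> = (\<Sum>k\<le>r. real (num_models p r S k) * (exp (- L k) * K))"
      unfolding Ms_def by (rule sum_over_models[OF S])
    also have "\<dots> = (\<Sum>k\<le>r. \<pi> k * K)"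
    proof (rule sum.cong[OF refl])
      fix k assume "k \<in> {..r}"
      then have "exp (- L k) = \<pi> k / real (num_models p r S k)"
        using m[of k] \<pi>[of k] by (simp add: L_def log_weight_def exp_minus)
      then show "real (num_models p r S k) * (exp (- L k) * K) = \<pi> k * K" using m[of k] \<open>k \<in> {..r}\<close> by simp
    qed
    also have "\<dots> = K" using prior by (simp add: sum_distrib_right[symmetric] prior_in_range_def size_prior_def)
    finally show ?thesis .
  qed
  have inj: "b = 0\<^sub>v p" if "N \<in> Ms" "b \<in> carrier_vec p" "\<And>j. j < p \<Longrightarrow> j \<notin> N \<Longrightarrow> vec_index b j = 0"
    "A *\<^sub>v b = 0\<^sub>v n" for N b
  proof -
    have "nonzero_entries b \<subseteq> N" using that by (auto simp: nonzero_entries_def)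
    then have "card (nonzero_entries b) \<le> r" using card_mono[of N "nonzero_entries b"] MsD[OF that(1)] by linarith
    then have "lo * sqn b \<le> 0" using lo(2)[OF that(2)] that(4) by (simp add: sqn_def)
    then have "sqn b = 0" using lo(1) sqn_nonneg[of b] by (simp add: mult_le_0_iff)
    then show ?thesis using sqn_eq_0_iff[OF that(2)] by simp
  qed
  fix b assume b0: "b \<in> coeffs_upto (dim_col A) r S p0"
  then have b: "b \<in> carrier_vec p" by (simp add: coeffs_upto_def dA)
  obtain M where M: "M \<in> Ms" "1 \<le> card M" "card M \<le> p0" "\<And>j. j < p \<Longrightarrow> j \<notin> M \<Longrightarrow> vec_index b j = 0"
  proof -
    obtain M0 where M0: "M0 \<in> models_upto p r S p0" "\<forall>j<p. vec_index b j \<noteq> 0 \<longleftrightarrow> j \<in> M0"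
      using b0 by (auto simp: coeffs_upto_def dA)
    show ?thesis
    proof (cases "card M0 = 0")
      case False
      then show ?thesis using M0 p0 by (intro that[of M0]) (auto simp: Ms_def in_models_upto[OF S])
    next
      case True
      have "M0 \<subseteq> {..<p}" using M0 in_modelsD[OF S] by (auto simp: in_models_upto[OF S])
      then have "M0 = {}" using True finite_subset by fastforce
      moreover have "{0} \<in> Ms" using r by (auto simp: Ms_def in_models_upto[OF S] models_def)
      ultimately show ?thesis using M0 p0 by (intro that[of "{0}"]) auto
    qed
  qed
  define k where "k = card M"
  have k: "1 \<le> k" "k \<le> p0" "k \<le> r" using M p0 by (auto simp: k_def)
  have cx: "complexity p k \<le> complexity p p0" "real k \<le> complexity p k" "1 \<le> complexity p p0"
    using complexity_mono[of k p0 p] complexity_ge[of k p] complexity_ge[of p0 p] k p0 r by auto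
  have lg: "0 \<le> ln (1 + \<gamma>)" using \<gamma> by simp
  have penM: "pen M \<le> 2 * (1 + 1 / \<gamma>) * (1 + c + ln (1 + \<gamma>) / 2) * (\<sigma>\<^sup>2 * complexity p p0)"
  proof -
    have "L k \<le> (1 + c) * complexity p k" unfolding L_def using prior c k r by (intro log_weight_le) auto
    moreover have "real k / 2 * ln (1 + \<gamma>) \<le> ln (1 + \<gamma>) / 2 * complexity p k"
      using mult_right_mono[OF cx(2) lg] by (simp add: mult.commute)
    ultimately have "L k + real k / 2 * ln (1 + \<gamma>) \<le> (1 + c + ln (1 + \<gamma>) / 2) * complexity p k"
      by (simp add: algebra_simps)
    also have "\<dots> \<le> (1 + c + ln (1 + \<gamma>) / 2) * complexity p p0"
      using c lg by (intro mult_left_mono cx) auto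
    finally have "2 * \<sigma>\<^sup>2 * (1 + 1 / \<gamma>) * (L k + real k / 2 * ln (1 + \<gamma>))
        \<le> 2 * \<sigma>\<^sup>2 * (1 + 1 / \<gamma>) * ((1 + c + ln (1 + \<gamma>) / 2) * complexity p p0)"
      using \<gamma> by (intro mult_left_mono) auto
    also have "\<dots> = 2 * (1 + 1 / \<gamma>) * (1 + c + ln (1 + \<gamma>) / 2) * (\<sigma>\<^sup>2 * complexity p p0)"
      by (simp only: mult_ac)
    finally show ?thesis by (simp only: pen_def k_def)
  qed
  have "0 \<le> 12 * \<gamma> * real k" using \<gamma> by simp
  then have "0 \<le> L k" using lw[OF k(3)] by linarith
  then have pen0: "0 \<le> pen M" using \<gamma> lg by (simp add: pen_def k_def[symmetric])
  have "risk n \<sigma> (map_estimator A Mhat) (A *\<^sub>v b) \<le> ennreal ((pen M + \<sigma>\<^sup>2 / s * K) / (1 - a))"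
  proof (rule risk_penalized_lse_le[OF A \<sigma>, where Ms = Ms and M = M])
    show "finite Ms" by (simp add: Ms_def)
    show "N \<subseteq> {..<p}" if "N \<in> Ms" for N by (rule MsD(1)[OF that])
    show M': "Mhat y \<in> Ms" if "y \<in> carrier_vec n" for y
      using sel that by (simp add: map_selector_def dA Ms_def)
    show "sqn (y - A *\<^sub>v lse A (Mhat y) y) + pen (Mhat y) \<le> sqn (y - A *\<^sub>v lse A N y) + pen N"
      if "y \<in> carrier_vec n" "N \<in> Ms" for y N
    proof -
      have "map_criterion A r S \<sigma> \<gamma> \<pi> y (Mhat y) \<le> map_criterion A r S \<sigma> \<gamma> \<pi> y N"
        using sel that by (simp add: map_selector_def dA Ms_def)
      then show ?thesis by (simp only: crit[OF M'[OF that(1)]] crit[OF that(2)])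
    qed
    show "2 * (s / a) < 1" unfolding sa \<eta>_def by (rule tilted_weight_le(1)[OF \<gamma>, of 0 0]) simp
  qed (use inj a s sumK M pen0 b in \<open>blast | simp\<close>)+
  also have "\<dots> \<le> ennreal (map_constant \<gamma> c * (\<sigma>\<^sup>2 * complexity p p0))"
  proof (rule ennreal_leI)
    have "\<sigma>\<^sup>2 / s * K \<le> K / s * (\<sigma>\<^sup>2 * complexity p p0)"
      using mult_left_mono[OF cx(3), of "K / s * \<sigma>\<^sup>2"] s by (simp add: K_def mult_ac)
    then have "pen M + \<sigma>\<^sup>2 / s * K
        \<le> (2 * (1 + 1 / \<gamma>) * (1 + c + ln (1 + \<gamma>) / 2) + K / s) * (\<sigma>\<^sup>2 * complexity p p0)"
      using penM by (simp add: distrib_right)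
    then have "(pen M + \<sigma>\<^sup>2 / s * K) / (1 - a)
        \<le> (2 * (1 + 1 / \<gamma>) * (1 + c + ln (1 + \<gamma>) / 2) + K / s) * (\<sigma>\<^sup>2 * complexity p p0) / (1 - a)"
      using a by (intro divide_right_mono) auto
    then show "(pen M + \<sigma>\<^sup>2 / s * K) / (1 - a) \<le> map_constant \<gamma> c * (\<sigma>\<^sup>2 * complexity p p0)"
      by (simp add: map_constant_def K_def s_def a_def \<eta>_def)
  qed
  finally show "risk (dim_row A) \<sigma> (map_estimator A Mhat) (A *\<^sub>v b)
    \<le> ennreal (map_constant \<gamma> c * (\<sigma>\<^sup>2 * complexity p p0))" by (simp add: dA)
qed

section \<open>Existence of a MAP selector and the upper minimax bound\<close>

lemma map_selector_exists:
  fixes A :: "real mat"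
  assumes A: "A \<in> carrier_mat n p" and r: "1 \<le> r"
  shows "\<exists>Mhat. map_selector A r S \<sigma> \<gamma> \<pi> Mhat"
proof -
  have dA: "dim_row A = n" "dim_col A = p" using A by auto
  have "{} \<in> models_upto p r S r" using r by (auto simp: models_upto_def models_def intro!: bexI[of _ 0])
  then have ne: "models_upto p r S r \<noteq> {}" by blast
  have "(\<lambda>y. map_criterion A r S \<sigma> \<gamma> \<pi> y M) \<in> borel_measurable (borel_vec n)" for M
    unfolding map_criterion_def
    by (intro borel_measurable_add borel_measurable_const measurable_sqn[of _ _ n] measurable_vec_minus
        measurable_fitted_values[OF A] measurable_ident_sets) auto
  from measurable_argmin[of "models_upto p r S r" "\<lambda>M y. map_criterion A r S \<sigma> \<gamma> \<pi> y M", OF _ ne this]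
  show ?thesis by (auto simp: map_selector_def dA)
qed

lemma map_estimator_measurable:
  fixes A :: "real mat"
  assumes A: "A \<in> carrier_mat n p" and sel: "map_selector A r S \<sigma> \<gamma> \<pi> Mhat"
  shows "map_estimator A Mhat \<in> estimators n"
proof -
  have dA: "dim_row A = n" "dim_col A = p" using A by auto
  note [measurable] = measurable_fitted_values[OF A]
  have Mh: "Mhat \<in> borel_vec n \<rightarrow>\<^sub>M count_space UNIV" using sel by (simp add: map_selector_def dA)
  have "Mhat \<in> borel_vec n \<rightarrow>\<^sub>M count_space (models_upto p r S r)"
    by (rule measurable_count_space_extend[OF subset_UNIV _ Mh]) (use sel in \<open>auto simp: map_selector_def dA\<close>)
  from measurable_compose_countable'[where f = "\<lambda>M y. A *\<^sub>v lse A M y" and N = "borel_vec n", OF _ this]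
  show ?thesis unfolding estimators_def map_estimator_def
    using measurable_fitted_values[OF A] by (auto intro!: countable_finite finite_models_upto)
qed

text \<open>The prior $e^{-ck}$ on the positive sizes, with the remaining mass at zero.\<close>

lemma geometric_prior_in_range:
  assumes \<gamma>: "0 < \<gamma>" and r: "1 \<le> r" "r \<le> p"
  shows "\<exists>\<pi>. prior_in_range p r (c_gamma \<gamma>) (c_gamma \<gamma>) \<pi>"
proof -
  define c where "c = c_gamma \<gamma>"
  have "9 / 2 \<le> c"
  proof -
    have "(3 / 4)\<^sup>2 \<le> (\<gamma> + 3 / 4)\<^sup>2" using \<gamma> by (intro power_mono) auto
    then show ?thesis by (simp add: c_def c_gamma_def power2_eq_square)
  qed
  then have c: "1 \<le> c" by simp
  define q where "q = exp (- c)"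
  have q: "0 < q" "q < 1 / 2"
  proof -
    have "2 \<le> exp (1::real)" using exp_ge_add_one_self[of 1] by simp
    also have "\<dots> < exp c" using \<open>9 / 2 \<le> c\<close> by simp
    finally show "q < 1 / 2" by (simp add: q_def exp_minus field_simps)
  qed (simp add: q_def)
  define \<pi> where "\<pi> k = (if k = 0 then 1 - (\<Sum>k=1..r. q ^ k) else q ^ k)" for k
  have "(\<Sum>k=1..r. q ^ k) < 1"
  proof -
    have "(\<Sum>k=1..r. q ^ k) = (\<Sum>k<r. q * q ^ k)"
      by (rule sum.reindex_bij_witness[of _ Suc "\<lambda>k. k - 1"]) (auto simp flip: power_Suc)
    also have "\<dots> = q * (1 - q ^ r) / (1 - q)"
      using q by (simp add: sum_distrib_left[symmetric] sum_gp_strict)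
    also have "\<dots> \<le> q / (1 - q)" using q by (intro divide_right_mono mult_left_le) auto
    also have "\<dots> < 1" using q by simp
    finally show ?thesis .
  qed
  then have pos: "0 < \<pi> k" for k using q by (simp add: \<pi>_def)
  have "{..r} = insert 0 {1..r}" by auto
  then have "(\<Sum>k\<le>r. \<pi> k) = \<pi> 0 + (\<Sum>k=1..r. \<pi> k)" by simp
  also have "(\<Sum>k=1..r. \<pi> k) = (\<Sum>k=1..r. q ^ k)" by (intro sum.cong) (auto simp: \<pi>_def)
  finally have one: "(\<Sum>k\<le>r. \<pi> k) = 1" by (simp add: \<pi>_def)
  have qk: "q ^ k = exp (- c * real k)" for k by (simp add: q_def exp_of_nat_mult[symmetric] mult.commute)
  have "(real k / (real p * exp 1)) powr (c * real k) \<le> \<pi> k \<and> \<pi> k \<le> (real p / (real k * exp c)) ^ k"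
    if k: "k \<in> {1..<r}" for k
  proof
    have "real k / (real p * exp 1) \<le> 1 / exp 1" using k r by (simp add: field_simps)
    then have "(real k / (real p * exp 1)) powr (c * real k) \<le> (1 / exp 1) powr (c * real k)"
      using c by (intro powr_mono2) auto
    also have "\<dots> = exp (- c * real k)" by (simp add: powr_def ln_div)
    finally show "(real k / (real p * exp 1)) powr (c * real k) \<le> \<pi> k" using k by (simp add: \<pi>_def qk)
    have "q \<le> real p / (real k * exp c)" using k r by (simp add: q_def exp_minus field_simps)
    then show "\<pi> k \<le> (real p / (real k * exp c)) ^ k" using k q by (simp add: \<pi>_def power_mono)
  qed
  then have "prior_in_range p r c c \<pi>"
    unfolding prior_in_range_def size_prior_def using pos one r qk by (auto simp: \<pi>_def)
  then show ?thesis unfolding c_def by blast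
qed

lemma minimax_risk_le:
  fixes A :: "real mat"
  assumes A: "A \<in> carrier_mat n p" and \<sigma>: "0 < \<sigma>" and r: "2 \<le> r" "r \<le> p"
    and S: "S \<subseteq> {..<p}" "card S = r"
    and lo: "0 < lo" "\<And>b. b \<in> carrier_vec p \<Longrightarrow> card (nonzero_entries b) \<le> r \<Longrightarrow> lo * sqn b \<le> sqn (A *\<^sub>v b)"
    and p0: "1 \<le> p0" "p0 \<le> r"
  shows "minimax_risk A r S \<sigma> p0 \<le> ennreal (map_constant 1 (c_gamma 1) * (\<sigma>\<^sup>2 * complexity p p0))"
proof -
  obtain \<pi> where \<pi>: "prior_in_range p r (c_gamma 1) (c_gamma 1) \<pi>"
    using geometric_prior_in_range[of 1 r p] r by auto
  obtain Mhat where M: "map_selector A r S \<sigma> 1 \<pi> Mhat" using map_selector_exists[OF A, of r S \<sigma> 1 \<pi>] r by auto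
  have "minimax_risk A r S \<sigma> p0 \<le> sup_risk A r S \<sigma> (map_estimator A Mhat) p0"
    unfolding minimax_risk_def using map_estimator_measurable[OF A M] A by (intro INF_lower) auto
  also have "\<dots> \<le> ennreal (map_constant 1 (c_gamma 1) * (\<sigma>\<^sup>2 * complexity p p0))"
    by (rule sup_risk_map_le[OF A \<sigma> r S lo _ _ \<pi> M p0]) (auto simp: c_gamma_def)
  finally show ?thesis .
qed

section \<open>Change of measure for Gaussian noise\<close>

lemma nn_integral_gauss_exp_linear:
  assumes \<sigma>: "0 < \<sigma>" and h: "h \<in> carrier_vec n"
  shows "(\<integral>\<^sup>+e. ennreal (exp (c * scalar_prod h e)) \<partial>gauss_noise n \<sigma>)
    = ennreal (exp (c\<^sup>2 * sqn h * \<sigma>\<^sup>2 / 2))"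
proof -
  have [measurable]: "(\<lambda>e. scalar_prod h e) \<in> borel_measurable (borel_vec n)"
    by (rule measurable_scalar_prod[of _ _ n]) (use h in auto)
  have "(\<integral>\<^sup>+e. ennreal (exp (c * scalar_prod h e)) \<partial>gauss_noise n \<sigma>)
      = (\<integral>\<^sup>+e. ennreal (exp (c * scalar_prod h (Matrix.vec n e))) \<partial>noise_coords n \<sigma>)"
    by (rule nn_integral_gauss_noise) measurable
  also have "\<dots> = (\<integral>\<^sup>+e. ennreal (exp (\<Sum>i<n. (c * vec_index h i) * e i)) \<partial>noise_coords n \<sigma>)"
    by (simp add: scalar_prod_eq_sum[OF h vec_carrier] sum_distrib_left mult_ac)
  also have "\<dots> = ennreal (exp ((\<Sum>i<n. (c * vec_index h i)\<^sup>2) * \<sigma>\<^sup>2 / 2))"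
    by (rule nn_integral_noise_exp_linear[OF \<sigma>])
  also have "(\<Sum>i<n. (c * vec_index h i)\<^sup>2) = c\<^sup>2 * sqn h"
    by (simp add: sqn_eq_sum[OF h] power_mult_distrib sum_distrib_left)
  finally show ?thesis .
qed

text \<open>The Cameron-Martin formula in finite dimension.\<close>

lemma nn_integral_gauss_shift:
  assumes \<sigma>: "0 < \<sigma>" and h: "h \<in> carrier_vec n" and g: "g \<in> borel_measurable (borel_vec n)"
  shows "(\<integral>\<^sup>+e. g (h + e) \<partial>gauss_noise n \<sigma>)
    = (\<integral>\<^sup>+e. ennreal (exp (scalar_prod h e / \<sigma>\<^sup>2 - sqn h / (2 * \<sigma>\<^sup>2))) * g e \<partial>gauss_noise n \<sigma>)"
proof -
  define P where "P = PiM {..<n} (\<lambda>_. borel :: real measure)"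
  have v: "Matrix.vec n \<in> P \<rightarrow>\<^sub>M borel_vec n"
    unfolding P_def by (rule measurable_into_borel_vec) (auto intro: measurable_component_singleton)
  have gv: "(\<lambda>e. g (Matrix.vec n e)) \<in> borel_measurable P" by (rule measurable_compose[OF v g])
  have sh: "(\<lambda>e. \<lambda>i\<in>{..<n}. e i + vec_index h i) \<in> noise_coords n \<sigma> \<rightarrow>\<^sub>M P"
    unfolding P_def by (rule measurable_restrict) (auto intro!: borel_measurable_add measurable_coord)
  have [measurable]: "(\<lambda>e. scalar_prod h e) \<in> borel_measurable (borel_vec n)"
    by (rule measurable_scalar_prod[of _ _ n]) (use h in auto)
  note [measurable] = g
  have gh: "(\<lambda>e. g (h + e)) \<in> borel_measurable (borel_vec n)"
    by (rule measurable_compose[OF _ g], rule measurable_vec_add) (use h in auto)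
  have "(\<integral>\<^sup>+e. g (h + e) \<partial>gauss_noise n \<sigma>) = (\<integral>\<^sup>+e. g (h + Matrix.vec n e) \<partial>noise_coords n \<sigma>)"
    by (rule nn_integral_gauss_noise[OF gh])
  also have "\<dots> = (\<integral>\<^sup>+e. g (Matrix.vec n (\<lambda>i\<in>{..<n}. e i + vec_index h i)) \<partial>noise_coords n \<sigma>)"
  proof (rule nn_integral_cong)
    fix e
    have "h + Matrix.vec n e = Matrix.vec n (\<lambda>i\<in>{..<n}. e i + vec_index h i)"
      using h by (intro eq_vecI) auto
    then show "g (h + Matrix.vec n e) = g (Matrix.vec n (\<lambda>i\<in>{..<n}. e i + vec_index h i))" by simp
  qed
  also have "\<dots> = (\<integral>\<^sup>+e. g (Matrix.vec n e) \<partial>distr (noise_coords n \<sigma>) P (\<lambda>e. \<lambda>i\<in>{..<n}. e i + vec_index h i))"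
    using gv by (subst nn_integral_distr[OF sh]) auto
  also have "\<dots> = (\<integral>\<^sup>+e. g (Matrix.vec n e) \<partial>density (noise_coords n \<sigma>)
      (\<lambda>e. ennreal (exp ((\<Sum>i<n. vec_index h i * e i) / \<sigma>\<^sup>2 - (\<Sum>i<n. (vec_index h i)\<^sup>2) / (2 * \<sigma>\<^sup>2)))))"
    unfolding P_def noise_coords_shift[OF \<sigma>] ..
  also have "\<dots> = (\<integral>\<^sup>+e. ennreal (exp ((\<Sum>i<n. vec_index h i * e i) / \<sigma>\<^sup>2 - (\<Sum>i<n. (vec_index h i)\<^sup>2) / (2 * \<sigma>\<^sup>2)))
      * g (Matrix.vec n e) \<partial>noise_coords n \<sigma>)"
  proof (rule nn_integral_density)
    show "(\<lambda>e. g (Matrix.vec n e)) \<in> borel_measurable (noise_coords n \<sigma>)"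
      by (rule measurable_compose[OF measurable_vec_of_coords g])
    note [measurable] = measurable_coord
    show "(\<lambda>e. ennreal (exp ((\<Sum>i<n. vec_index h i * e i) / \<sigma>\<^sup>2 - (\<Sum>i<n. (vec_index h i)\<^sup>2) / (2 * \<sigma>\<^sup>2))))
        \<in> borel_measurable (noise_coords n \<sigma>)" by measurable
  qed
  also have "\<dots> = (\<integral>\<^sup>+e. ennreal (exp (scalar_prod h (Matrix.vec n e) / \<sigma>\<^sup>2 - sqn h / (2 * \<sigma>\<^sup>2))) * g (Matrix.vec n e) \<partial>noise_coords n \<sigma>)"
    by (simp add: scalar_prod_eq_sum[OF h vec_carrier] sqn_eq_sum[OF h])
  also have "\<dots> = (\<integral>\<^sup>+e. ennreal (exp (scalar_prod h e / \<sigma>\<^sup>2 - sqn h / (2 * \<sigma>\<^sup>2))) * g e \<partial>gauss_noise n \<sigma>)"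
    by (rule nn_integral_gauss_noise[symmetric]) measurable
  finally show ?thesis .
qed

section \<open>Testing between many means\<close>

text \<open>Any test among the means $\nu + h_j$ is compared with the centre $\nu$. If $L_j$ is the likelihood
  ratio and $A_j$ the event that the test accepts $j$, then $L_j1_{A_j} \le (L_j^2/m + m1_{A_j})/2$. The second
  moment of $L_j$ at the centre is $\exp(\|h_j\|^2/\sigma^2) \le \sqrt m$, and the events $A_j$ are disjoint, so
  that the sum is at most $(\sqrt m + m)/2$.\<close>

lemma sum_success_probability_le:
  fixes T :: "real vec \<Rightarrow> nat"
  assumes \<sigma>: "0 < \<sigma>" and m: "2 \<le> m" and \<nu>: "\<nu> \<in> carrier_vec n"
    and h: "\<And>j. j < m \<Longrightarrow> h j \<in> carrier_vec n" "\<And>j. j < m \<Longrightarrow> sqn (h j) \<le> \<sigma>\<^sup>2 * ln (real m) / 2"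
    and T: "T \<in> borel_vec n \<rightarrow>\<^sub>M count_space UNIV"
  shows "(\<Sum>j<m. measure (gauss_noise n \<sigma>) {e \<in> carrier_vec n. T (\<nu> + h j + e) = j}) \<le> 7 / 8 * real m"
proof -
  interpret prob_space "gauss_noise n \<sigma>" by (rule prob_space_gauss_noise[OF \<sigma>])
  define A where "A j = {e \<in> carrier_vec n. T (\<nu> + e) = j}" for j
  have T\<nu>: "(\<lambda>e. T (\<nu> + e)) \<in> borel_vec n \<rightarrow>\<^sub>M count_space UNIV"
    by (rule measurable_compose[OF _ T], rule measurable_vec_add) (use \<nu> in auto)
  have A: "A j \<in> sets (borel_vec n)" for j
  proof -
    have "A j = (\<lambda>e. T (\<nu> + e)) -` {j} \<inter> space (borel_vec n)" by (auto simp: A_def)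
    then show ?thesis using measurable_sets[OF T\<nu>, of "{j}"] by simp
  qed
  note [measurable] = A
  have one: "measure (gauss_noise n \<sigma>) {e \<in> carrier_vec n. T (\<nu> + h j + e) = j}
      \<le> (sqrt (real m) / real m + real m * measure (gauss_noise n \<sigma>) (A j)) / 2" if j: "j < m" for j
  proof -
    let ?h = "h j"
    define L where "L e = exp (scalar_prod ?h e / \<sigma>\<^sup>2 - sqn ?h / (2 * \<sigma>\<^sup>2))" for e
    have [measurable]: "(\<lambda>e. scalar_prod ?h e) \<in> borel_measurable (borel_vec n)"
      by (rule measurable_scalar_prod[of _ _ n]) (use h j in auto)
    have L2: "(\<integral>\<^sup>+e. ennreal ((L e)\<^sup>2) \<partial>gauss_noise n \<sigma>) \<le> ennreal (sqrt (real m))"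
    proof -
      have "(L e)\<^sup>2 = exp (- sqn ?h / \<sigma>\<^sup>2) * exp (2 / \<sigma>\<^sup>2 * scalar_prod ?h e)" for e
        using \<sigma> by (simp add: L_def power2_eq_square exp_add[symmetric] field_simps)
      then have "(\<integral>\<^sup>+e. ennreal ((L e)\<^sup>2) \<partial>gauss_noise n \<sigma>)
          = (\<integral>\<^sup>+e. ennreal (exp (- sqn ?h / \<sigma>\<^sup>2)) * ennreal (exp (2 / \<sigma>\<^sup>2 * scalar_prod ?h e)) \<partial>gauss_noise n \<sigma>)"
        by (simp add: ennreal_mult)
      also have "\<dots> = ennreal (exp (- sqn ?h / \<sigma>\<^sup>2)) * ennreal (exp ((2 / \<sigma>\<^sup>2)\<^sup>2 * sqn ?h * \<sigma>\<^sup>2 / 2))"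
        by (subst nn_integral_cmult, measurable) (simp only: nn_integral_gauss_exp_linear[OF \<sigma> h(1)[OF j]])
      also have "\<dots> = ennreal (exp (sqn ?h / \<sigma>\<^sup>2))"
        using \<sigma> by (simp add: ennreal_mult[symmetric] exp_add[symmetric]) (simp add: power2_eq_square field_simps)
      also have "\<dots> \<le> ennreal (sqrt (real m))"
      proof (rule ennreal_leI)
        have "sqn ?h / \<sigma>\<^sup>2 \<le> ln (real m) / 2" using h(2)[OF j] \<sigma> by (simp add: field_simps)
        then have "exp (sqn ?h / \<sigma>\<^sup>2) \<le> exp (ln (real m) / 2)" by simp
        also have "\<dots> = sqrt (real m)" using m by (simp add: powr_half_sqrt[symmetric] powr_def)
        finally show "exp (sqn ?h / \<sigma>\<^sup>2) \<le> sqrt (real m)" .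
      qed
      finally show ?thesis .
    qed
    have am: "ennreal (L e) * indicator (A j) e
        \<le> ennreal (1 / (2 * real m)) * ennreal ((L e)\<^sup>2) + ennreal (real m / 2) * indicator (A j) e" for e
    proof (cases "e \<in> A j")
      case True
      have "0 \<le> (L e - real m)\<^sup>2 / (2 * real m)" using m by simp
      also have "\<dots> = 1 / (2 * real m) * (L e)\<^sup>2 + real m / 2 - L e"
        using m by (simp add: power2_eq_square field_simps)
      finally have "ennreal (L e) \<le> ennreal (1 / (2 * real m) * (L e)\<^sup>2 + real m / 2)"
        by (intro ennreal_leI) simp
      also have "ennreal (1 / (2 * real m) * (L e)\<^sup>2 + real m / 2)
          = ennreal (1 / (2 * real m)) * ennreal ((L e)\<^sup>2) + ennreal (real m / 2)"
        by (subst ennreal_plus, simp, simp, subst ennreal_mult, simp, simp, rule refl)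
      finally show ?thesis using True by simp
    qed simp
    have "emeasure (gauss_noise n \<sigma>) {e \<in> carrier_vec n. T (\<nu> + ?h + e) = j}
        = (\<integral>\<^sup>+e. indicator (A j) (?h + e) \<partial>gauss_noise n \<sigma>)"
    proof -
      have ih: "(\<lambda>e. ?h + e) \<in> borel_vec n \<rightarrow>\<^sub>M borel_vec n"
        by (rule measurable_vec_add) (use h j in auto)
      let ?X = "{e \<in> carrier_vec n. T (\<nu> + ?h + e) = j}"
      have X: "?X = (\<lambda>e. ?h + e) -` A j \<inter> space (borel_vec n)"
        using \<nu> h(1)[OF j] by (auto simp: A_def assoc_add_vec[of _ n])
      have "?X \<in> sets (gauss_noise n \<sigma>)"
        unfolding X using measurable_sets[OF ih A, of j] by simp
      then have "emeasure (gauss_noise n \<sigma>) ?X = (\<integral>\<^sup>+e. indicator ?X e \<partial>gauss_noise n \<sigma>)"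
        by (rule nn_integral_indicator[symmetric])
      also have "\<dots> = (\<integral>\<^sup>+e. indicator (A j) (?h + e) \<partial>gauss_noise n \<sigma>)"
        unfolding X by (rule nn_integral_cong) (simp add: indicator_def)
      finally show ?thesis .
    qed
    also have "\<dots> = (\<integral>\<^sup>+e. ennreal (L e) * indicator (A j) e \<partial>gauss_noise n \<sigma>)"
      unfolding L_def by (rule nn_integral_gauss_shift[OF \<sigma> h(1)[OF j]]) measurable
    also have "\<dots> \<le> (\<integral>\<^sup>+e. ennreal (1 / (2 * real m)) * ennreal ((L e)\<^sup>2) + ennreal (real m / 2) * indicator (A j) e \<partial>gauss_noise n \<sigma>)"
      by (intro nn_integral_mono am)
    also have "\<dots> = ennreal (1 / (2 * real m)) * (\<integral>\<^sup>+e. ennreal ((L e)\<^sup>2) \<partial>gauss_noise n \<sigma>)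
        + ennreal (real m / 2) * emeasure (gauss_noise n \<sigma>) (A j)"
      unfolding L_def using A by (simp add: nn_integral_add nn_integral_cmult)
    also have "\<dots> \<le> ennreal (1 / (2 * real m)) * ennreal (sqrt (real m))
        + ennreal (real m / 2) * emeasure (gauss_noise n \<sigma>) (A j)"
      by (intro add_right_mono mult_left_mono L2) simp
    also have "\<dots> = ennreal ((sqrt (real m) / real m + real m * measure (gauss_noise n \<sigma>) (A j)) / 2)"
      by (simp add: emeasure_eq_measure ennreal_mult[symmetric] ennreal_plus[symmetric] add_divide_distrib del: ennreal_plus)
    finally show ?thesis by (simp add: emeasure_eq_measure)
  qed
  have disj: "(\<Sum>j<m. measure (gauss_noise n \<sigma>) (A j)) \<le> 1"
  proof -
    have "(\<Sum>j<m. measure (gauss_noise n \<sigma>) (A j)) = measure (gauss_noise n \<sigma>) (\<Union>j<m. A j)"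
      using A by (intro finite_measure_finite_Union[symmetric]) (auto simp: disjoint_family_on_def A_def)
    then show ?thesis by simp
  qed
  have s: "sqrt (real m) \<le> 3 / 4 * real m"
  proof (rule real_le_lsqrt)
    have "16 / 9 * real m \<le> real m * real m" using m by (intro mult_right_mono) auto
    then show "real m \<le> (3 / 4 * real m)\<^sup>2" by (simp add: power2_eq_square)
  qed simp
  have "(\<Sum>j<m. measure (gauss_noise n \<sigma>) {e \<in> carrier_vec n. T (\<nu> + h j + e) = j})
      \<le> (\<Sum>j<m. (sqrt (real m) / real m + real m * measure (gauss_noise n \<sigma>) (A j)) / 2)"
    by (intro sum_mono one) simp
  also have "\<dots> = (sqrt (real m) + real m * (\<Sum>j<m. measure (gauss_noise n \<sigma>) (A j))) / 2"
    using m by (simp add: sum.distrib sum_distrib_left flip: sum_divide_distrib)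
  also have "\<dots> \<le> (3 / 4 * real m + real m * 1) / 2"
    using s disj by (intro divide_right_mono add_mono mult_left_mono) auto
  finally show ?thesis by simp
qed

section \<open>One nonzero coefficient per block\<close>

text \<open>Replacing coordinate $i$ by a free value $j$ and remembering the old one is an involution on
  pairs. It allows the other coordinates to be held fixed in an average over all functions.\<close>

lemma sum_PiE_update:
  fixes F :: "('i \<Rightarrow> 'j) \<Rightarrow> real"
  assumes "i \<in> I"
  shows "(\<Sum>J\<in>Pi\<^sub>E I (\<lambda>_. B). \<Sum>j\<in>B. F (J(i := j))) = real (card B) * (\<Sum>J\<in>Pi\<^sub>E I (\<lambda>_. B). F J)"
proof -
  have "(\<Sum>J\<in>Pi\<^sub>E I (\<lambda>_. B). \<Sum>j\<in>B. F (J(i := j)))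
      = (\<Sum>(J, j)\<in>Pi\<^sub>E I (\<lambda>_. B) \<times> B. F (J(i := j)))"
    by (rule sum.cartesian_product)
  also have "\<dots> = (\<Sum>(J, j)\<in>Pi\<^sub>E I (\<lambda>_. B) \<times> B. F J)"
    by (rule sum.reindex_bij_witness[where i = "\<lambda>(J, j). (J(i := j), J i)" and j = "\<lambda>(J, j). (J(i := j), J i)"])
      (use assms in \<open>auto simp: PiE_iff extensional_def\<close>)
  also have "\<dots> = (\<Sum>J\<in>Pi\<^sub>E I (\<lambda>_. B). \<Sum>j\<in>B. F J)"
    by (rule sum.cartesian_product[symmetric])
  finally show ?thesis by (simp add: sum_distrib_left)
qed

text \<open>Predictor $im + j$ is the $j$-th one of block $i$; $J$ chooses one predictor per block.\<close>

definition block_support :: "nat \<Rightarrow> nat set \<Rightarrow> (nat \<Rightarrow> nat) \<Rightarrow> nat set" where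
  "block_support m I J = (\<lambda>i. i * m + J i) ` I"

definition block_vec :: "nat \<Rightarrow> nat \<Rightarrow> real \<Rightarrow> nat set \<Rightarrow> (nat \<Rightarrow> nat) \<Rightarrow> real vec" where
  "block_vec p m a I J = Matrix.vec p (\<lambda>t. if t \<in> block_support m I J then a else 0)"

lemma block_vec_carrier [simp]: "block_vec p m a I J \<in> carrier_vec p"
  by (simp add: block_vec_def)

lemma block_index_inject:
  assumes "x < m" "(y::nat) < m" "i * m + x = i' * m + y"
  shows "i = i'" "x = y"
proof -
  have "(i * m + x) div m = (i' * m + y) div m" "(i * m + x) mod m = (i' * m + y) mod m" using assms by simp_all
  then show "i = i'" "x = y" using assms(1,2) by simp_all
qed

lemma block_index_mem:
  assumes "\<And>i. i \<in> I \<Longrightarrow> J i < m" "x < m"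
  shows "i * m + x \<in> block_support m I J \<longleftrightarrow> i \<in> I \<and> x = J i"
proof
  assume "i * m + x \<in> block_support m I J"
  then obtain i' where i': "i' \<in> I" "i * m + x = i' * m + J i'" by (auto simp: block_support_def)
  have "i = i'" "x = J i'" by (rule block_index_inject[OF assms(2) assms(1)[OF i'(1)] i'(2)])+
  then show "i \<in> I \<and> x = J i" using i' by simp
qed (simp add: block_support_def)

lemma card_block_support:
  assumes "\<And>i. i \<in> I \<Longrightarrow> J i < m"
  shows "card (block_support m I J) = card I"
  unfolding block_support_def
proof (rule card_image, rule inj_onI)
  fix i i' assume "i \<in> I" "i' \<in> I" "i * m + J i = i' * m + J i'"
  then show "i = i'" by (intro block_index_inject(1)[of "J i" m "J i'" i i'] assms)
qed

lemma block_support_bound: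
  assumes "\<And>i. i < q \<Longrightarrow> J i < m" "q * m \<le> p"
  shows "block_support m {..<q} J \<subseteq> {..<p}"
proof
  fix t assume "t \<in> block_support m {..<q} J"
  then obtain i where i: "i < q" "t = i * m + J i" by (auto simp: block_support_def)
  then have "t < Suc i * m" using assms(1) by simp
  also have "\<dots> \<le> q * m" using i by (intro mult_right_mono) auto
  finally show "t \<in> {..<p}" using assms(2) by simp
qed

lemma nonzero_entries_block_vec: "nonzero_entries (block_vec p m a I J) \<subseteq> block_support m I J"
  by (auto simp: nonzero_entries_def block_vec_def split: if_splits)

lemma nonzero_entries_minus:
  "u \<in> carrier_vec p \<Longrightarrow> v \<in> carrier_vec p \<Longrightarrow> nonzero_entries (u - v) \<subseteq> nonzero_entries u \<union> nonzero_entries v"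
  by (auto simp: nonzero_entries_def)

lemma finite_block_support [simp]: "finite I \<Longrightarrow> finite (block_support m I J)"
  by (simp add: block_support_def)

text \<open>Every block with different choices contributes at least one coordinate equal to $a$ in
  absolute value.\<close>

lemma sqn_block_vec_minus_ge:
  assumes J: "\<And>i. i < q \<Longrightarrow> J i < m" "\<And>i. i < q \<Longrightarrow> J' i < m" and qm: "q * m \<le> p"
  shows "a\<^sup>2 * real (card {i. i < q \<and> J i \<noteq> J' i}) \<le> sqn (block_vec p m a {..<q} J - block_vec p m a {..<q} J')"
proof -
  let ?D = "block_support m {..<q} J - block_support m {..<q} J'"
  have sub: "?D \<subseteq> {..<p}" using block_support_bound[of q J m p] J(1) qm by auto
  have "(\<lambda>i. i * m + J i) ` {i. i < q \<and> J i \<noteq> J' i} \<subseteq> ?D"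
    using J block_index_mem[of "{..<q}" J' m] by (auto simp: block_support_def) (metis block_index_inject)
  moreover have "inj_on (\<lambda>i. i * m + J i) {i. i < q \<and> J i \<noteq> J' i}"
    by (rule inj_onI) (use block_index_inject(1)[OF J(1) J(1)] in auto)
  ultimately have "card {i. i < q \<and> J i \<noteq> J' i} \<le> card ?D"
    by (intro card_inj_on_le) auto
  then have "a\<^sup>2 * real (card {i. i < q \<and> J i \<noteq> J' i}) \<le> a\<^sup>2 * real (card ?D)"
    by (intro mult_left_mono) auto
  also have "\<dots> = (\<Sum>t\<in>?D. a\<^sup>2)" by simp
  also have "\<dots> = (\<Sum>t\<in>?D. (vec_index (block_vec p m a {..<q} J - block_vec p m a {..<q} J') t)\<^sup>2)"
    using sub by (intro sum.cong) (auto simp: block_vec_def)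
  also have "\<dots> \<le> (\<Sum>t<p. (vec_index (block_vec p m a {..<q} J - block_vec p m a {..<q} J') t)\<^sup>2)"
    using sub by (intro sum_mono2) auto
  also have "\<dots> = sqn (block_vec p m a {..<q} J - block_vec p m a {..<q} J')"
    by (subst sqn_eq_sum[of _ p]) (auto simp: block_vec_def)
  finally show ?thesis .
qed

text \<open>The average over all choices $J$ of the expected number of correctly recovered blocks is at most $7q/8$, by
  the testing bound in each block with the other blocks held fixed. Some choice is therefore no better than this average,
  and there the expected number of wrong blocks is at least $q/8$. Passing to the nearest candidate costs a factor
  four in the loss.\<close>

lemma sup_risk_ge_blocks:
  fixes A :: "real mat"
  assumes A: "A \<in> carrier_mat n p" and \<sigma>: "0 < \<sigma>"
    and lo: "0 < lo" "\<And>b. b \<in> carrier_vec p \<Longrightarrow> card (nonzero_entries b) \<le> r \<Longrightarrow> lo * sqn b \<le> sqn (A *\<^sub>v b)"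
    and hi: "0 < hi" "\<And>b. b \<in> carrier_vec p \<Longrightarrow> card (nonzero_entries b) \<le> r \<Longrightarrow> sqn (A *\<^sub>v b) \<le> hi * sqn b"
    and q: "1 \<le> q" "2 * q \<le> r" "q \<le> p0" and m: "2 \<le> m" "q * m \<le> p"
    and f: "f \<in> estimators n"
  shows "ennreal (lo / hi * (\<sigma>\<^sup>2 * (real q * ln (real m))) / 64) \<le> sup_risk A r S \<sigma> f p0"
proof -
  interpret prob_space "gauss_noise n \<sigma>" by (rule prob_space_gauss_noise[OF \<sigma>])
  have dA: "dim_row A = n" "dim_col A = p" using A by auto
  \<comment> \<open>the largest amplitude for which the means of one block satisfy the hypothesis of the testing bound\<close>
  define a where "a = \<sigma> * sqrt (ln (real m) / (2 * hi))"
  have a2: "a\<^sup>2 = \<sigma>\<^sup>2 * ln (real m) / (2 * hi)" using hi m by (simp add: a_def power_mult_distrib)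
  have a0: "a \<noteq> 0" using hi m \<sigma> by (simp add: a_def)
  define JJ where "JJ = Pi\<^sub>E {..<q} (\<lambda>_. {..<m})"
  have fJ: "finite JJ" unfolding JJ_def by (intro finite_PiE) auto
  have JJD: "J i < m" if "J \<in> JJ" "i < q" for J i using that by (auto simp: JJ_def)
  have "(\<lambda>i\<in>{..<q}. 0) \<in> JJ" using m by (auto simp: JJ_def)
  then have neJ: "JJ \<noteq> {}" by blast
  define b where "b J = block_vec p m a {..<q} J" for J
  define \<mu> where "\<mu> J = A *\<^sub>v b J" for J
  have bc: "b J \<in> carrier_vec p" for J by (simp add: b_def)
  have \<mu>c: "\<mu> J \<in> carrier_vec n" for J using A bc[of J] by (simp add: \<mu>_def)
  have fc: "f y \<in> carrier_vec n" if "y \<in> carrier_vec n" for y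
    using measurable_space[of f "borel_vec n" "borel_vec n" y] f that by (simp add: estimators_def)
  have fm: "f \<in> borel_vec n \<rightarrow>\<^sub>M borel_vec n" using f by (simp add: estimators_def)
  \<comment> \<open>the positions guessed by the estimator are those of the candidate mean nearest to it\<close>
  have "(\<lambda>y. sqn (f y - \<mu> J)) \<in> borel_measurable (borel_vec n)" for J
    by (intro measurable_sqn[of _ _ n] measurable_vec_minus fm) (use \<mu>c in auto)
  from measurable_argmin[OF fJ neJ, of "\<lambda>J y. sqn (f y - \<mu> J)", OF this]
  obtain h where h: "h \<in> borel_vec n \<rightarrow>\<^sub>M count_space UNIV" "\<And>y. h y \<in> JJ"
    "\<And>y J. J \<in> JJ \<Longrightarrow> sqn (f y - \<mu> (h y)) \<le> sqn (f y - \<mu> J)" by blast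
  define P where "P J i = measure (gauss_noise n \<sigma>) {e \<in> carrier_vec n. h (\<mu> J + e) i = J i}" for J i
  have avg: "(\<Sum>J\<in>JJ. P J i) \<le> 7 / 8 * real (card JJ)" if i: "i < q" for i
  proof -
    have "(\<Sum>j<m. P (J(i := j)) i) \<le> 7 / 8 * real m" if J: "J \<in> JJ" for J
    proof -
      define \<beta> where "\<beta> = block_vec p m a ({..<q} - {i}) J"
      define u where "u j = block_vec p m a {i} (\<lambda>_. j)" for j
      have "b (J(i := j)) = \<beta> + u j" if j: "j < m" for j
      proof (rule eq_vecI)
        fix t assume "t < dim_vec (\<beta> + u j)"
        then have t: "t < p" by (simp add: u_def block_vec_def)
        have "block_support m {..<q} (J(i := j)) = block_support m ({..<q} - {i}) J \<union> block_support m {i} (\<lambda>_. j)"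
          using i by (auto simp: block_support_def)
        moreover have "block_support m ({..<q} - {i}) J \<inter> block_support m {i} (\<lambda>_. j) = {}"
          using JJD[OF J] j block_index_inject(1)[of j m "J _"] by (auto simp: block_support_def)
        ultimately show "vec_index (b (J(i := j))) t = vec_index (\<beta> + u j) t"
          using t unfolding b_def \<beta>_def u_def block_vec_def by auto
      qed (simp add: b_def \<beta>_def u_def block_vec_def)
      then have \<mu>u: "\<mu> (J(i := j)) = A *\<^sub>v \<beta> + A *\<^sub>v u j" if "j < m" for j
        using that A by (simp add: \<mu>_def \<beta>_def u_def mult_add_distrib_mat_vec[of _ n p])
      have "(\<Sum>j<m. measure (gauss_noise n \<sigma>) {e \<in> carrier_vec n. h (A *\<^sub>v \<beta> + A *\<^sub>v u j + e) i = j}) \<le> 7 / 8 * real m"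
      proof (rule sum_success_probability_le[where T = "\<lambda>y. h y i", OF \<sigma> m(1)])
        show "A *\<^sub>v \<beta> \<in> carrier_vec n" using A by (simp add: \<beta>_def)
        show "A *\<^sub>v u j \<in> carrier_vec n" for j using A by (simp add: u_def)
        show "sqn (A *\<^sub>v u j) \<le> \<sigma>\<^sup>2 * ln (real m) / 2" for j
        proof -
          have supp: "block_support m {i} (\<lambda>_. j) = {i * m + j}" by (simp add: block_support_def)
          have "card (nonzero_entries (u j)) \<le> card {i * m + j}"
            using nonzero_entries_block_vec[of p m a "{i}" "\<lambda>_. j"] unfolding u_def supp by (intro card_mono) auto
          then have "sqn (A *\<^sub>v u j) \<le> hi * sqn (u j)" using q by (intro hi(2)) (auto simp: u_def)
          also have "sqn (u j) \<le> a\<^sup>2"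
          proof -
            have "sqn (u j) = (\<Sum>t<p. (vec_index (u j) t)\<^sup>2)"
              by (rule sqn_eq_sum) (simp add: u_def)
            also have "\<dots> = (\<Sum>t<p. if t = i * m + j then a\<^sup>2 else 0)"
              by (rule sum.cong) (simp_all add: u_def block_vec_def supp)
            also have "\<dots> \<le> a\<^sup>2" by simp
            finally show ?thesis .
          qed
          then have "hi * sqn (u j) \<le> hi * a\<^sup>2" using hi by (intro mult_left_mono) auto
          also have "hi * a\<^sup>2 = \<sigma>\<^sup>2 * ln (real m) / 2" using hi by (simp add: a2)
          finally show ?thesis by simp
        qed
        show "(\<lambda>y. h y i) \<in> borel_vec n \<rightarrow>\<^sub>M count_space UNIV"
          by (rule measurable_compose[OF h(1)]) simp
      qed
      then show ?thesis by (simp add: P_def \<mu>u)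
    qed
    then have "(\<Sum>J\<in>JJ. \<Sum>j<m. P (J(i := j)) i) \<le> (\<Sum>J\<in>JJ. 7 / 8 * real m)" by (rule sum_mono)
    moreover have "(\<Sum>J\<in>JJ. \<Sum>j<m. P (J(i := j)) i) = real m * (\<Sum>J\<in>JJ. P J i)"
      unfolding JJ_def using sum_PiE_update[of i "{..<q}" "\<lambda>J. P J i" "{..<m}"] i by simp
    ultimately have "real m * (\<Sum>J\<in>JJ. P J i) \<le> real m * (7 / 8 * real (card JJ))" by (simp add: mult_ac)
    then show ?thesis using m by simp
  qed
  have "(\<Sum>J\<in>JJ. \<Sum>i<q. P J i) \<le> (\<Sum>J\<in>JJ. 7 / 8 * real q)"
  proof -
    have "(\<Sum>J\<in>JJ. \<Sum>i<q. P J i) = (\<Sum>i<q. \<Sum>J\<in>JJ. P J i)" by (rule sum.swap)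
    also have "\<dots> \<le> (\<Sum>i<q. 7 / 8 * real (card JJ))" by (intro sum_mono avg) simp
    finally show ?thesis by (simp add: mult_ac)
  qed
  then obtain J where J: "J \<in> JJ" "(\<Sum>i<q. P J i) \<le> 7 / 8 * real q"
    using sum_strict_mono[OF fJ neJ, of "\<lambda>_. 7 / 8 * real q" "\<lambda>J. \<Sum>i<q. P J i"] by (metis not_le)
  have "b J \<in> coeffs_upto (dim_col A) r S p0"
  proof -
    have M: "block_support m {..<q} J \<in> models p r S q"
      using card_block_support[of "{..<q}" J m] block_support_bound[of q J m p] JJD[OF J(1)] m q
      by (auto simp: models_def)
    have "\<forall>t<p. vec_index (b J) t \<noteq> 0 \<longleftrightarrow> t \<in> block_support m {..<q} J" using a0 by (simp add: b_def block_vec_def)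
    then show ?thesis using bc M q unfolding coeffs_upto_def models_upto_def dA by blast
  qed
  then have "risk n \<sigma> f (\<mu> J) \<le> sup_risk A r S \<sigma> f p0"
    unfolding sup_risk_def dA \<mu>_def by (intro SUP_upper) auto
  moreover have "ennreal (lo / hi * (\<sigma>\<^sup>2 * (real q * ln (real m))) / 64) \<le> risk n \<sigma> f (\<mu> J)"
  proof -
    define E where "E i = {e \<in> carrier_vec n. h (\<mu> J + e) i = J i}" for i
    define c where "c = lo * a\<^sup>2 / 4"
    have c0: "0 \<le> c" using lo by (simp add: c_def)
    have E: "E i \<in> sets (borel_vec n)" for i
    proof -
      have "(\<lambda>e. h (\<mu> J + e) i) \<in> borel_vec n \<rightarrow>\<^sub>M count_space UNIV"
      proof (rule measurable_compose[where f = "\<lambda>e. \<mu> J + e" and g = "\<lambda>y. h y i"])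
        show "(\<lambda>e. \<mu> J + e) \<in> borel_vec n \<rightarrow>\<^sub>M borel_vec n"
          by (rule measurable_vec_add) (use \<mu>c in auto)
        show "(\<lambda>y. h y i) \<in> borel_vec n \<rightarrow>\<^sub>M count_space UNIV"
          by (rule measurable_compose[OF h(1)]) simp
      qed
      from measurable_sets[OF this, of "{J i}"] show ?thesis
        by (simp add: E_def vimage_def Int_def conj_commute)
    qed
    have pt: "c * (\<Sum>i<q. 1 - indicator (E i) e) \<le> sqn (f (\<mu> J + e) - \<mu> J)" if e: "e \<in> carrier_vec n" for e
    proof -
      define y where "y = \<mu> J + e"
      have y: "y \<in> carrier_vec n" using \<mu>c e by (simp add: y_def)
      define H where "H = h y"
      have H: "H \<in> JJ" using h(2) by (simp add: H_def)
      have dc: "b H - b J \<in> carrier_vec p" using bc by simp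
      have "(\<Sum>i<q. 1 - indicator (E i) e :: real) = real (card {i. i < q \<and> H i \<noteq> J i})"
      proof -
        have "(\<Sum>i<q. 1 - indicator (E i) e :: real) = (\<Sum>i<q. if H i \<noteq> J i then 1 else 0)"
          using e by (intro sum.cong) (auto simp: E_def H_def y_def indicator_def)
        also have "\<dots> = (\<Sum>i\<in>{i. i < q \<and> H i \<noteq> J i}. 1)"
          by (intro sum.mono_neutral_cong_right) auto
        finally show ?thesis by simp
      qed
      then have "4 * (c * (\<Sum>i<q. 1 - indicator (E i) e)) = lo * (a\<^sup>2 * real (card {i. i < q \<and> H i \<noteq> J i}))"
        by (simp add: c_def)
      also have "\<dots> \<le> lo * sqn (b H - b J)"
        unfolding b_def using lo JJD[OF H] JJD[OF J(1)] m by (intro mult_left_mono sqn_block_vec_minus_ge) auto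
      also have "\<dots> \<le> sqn (A *\<^sub>v (b H - b J))"
      proof (rule lo(2)[OF dc])
        have "nonzero_entries (b H - b J) \<subseteq> block_support m {..<q} H \<union> block_support m {..<q} J"
          using nonzero_entries_minus[OF bc[of H] bc[of J]]
            nonzero_entries_block_vec[of p m a "{..<q}" H] nonzero_entries_block_vec[of p m a "{..<q}" J]
          unfolding b_def by blast
        then have "card (nonzero_entries (b H - b J)) \<le> card (block_support m {..<q} H \<union> block_support m {..<q} J)"
          by (intro card_mono) auto
        also have "\<dots> \<le> card (block_support m {..<q} H) + card (block_support m {..<q} J)" by (rule card_Un_le)
        also have "\<dots> = 2 * q"
          using card_block_support[of "{..<q}" H m] card_block_support[of "{..<q}" J m] JJD[OF H] JJD[OF J(1)] by simp
        finally show "card (nonzero_entries (b H - b J)) \<le> r" using q by simp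
      qed
      also have "A *\<^sub>v (b H - b J) = \<mu> H - \<mu> J"
        unfolding \<mu>_def by (rule mult_minus_distrib_mat_vec[OF A bc bc])
      also have "sqn (\<mu> H - \<mu> J) \<le> 2 * sqn (f y - \<mu> H) + 2 * sqn (f y - \<mu> J)"
      proof -
        have ee: "\<mu> H - \<mu> J = (f y - \<mu> J) - (f y - \<mu> H)"
          using fc[OF y] \<mu>c[of H] \<mu>c[of J] by (intro eq_vecI) auto
        have cc: "f y - \<mu> J \<in> carrier_vec n" "f y - \<mu> H \<in> carrier_vec n" using fc[OF y] \<mu>c by auto
        have "0 \<le> sqn ((f y - \<mu> J) + (f y - \<mu> H))" by (rule sqn_nonneg)
        then show ?thesis unfolding ee using sqn_minus[OF cc] sqn_add[OF cc] by simp
      qed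
      also have "\<dots> \<le> 4 * sqn (f y - \<mu> J)" using h(3)[OF J(1), of y] by (simp add: H_def)
      finally show ?thesis by (simp add: y_def)
    qed
    have Ei: "integrable (gauss_noise n \<sigma>) (indicat_real (E i))" for i
      using E[of i] by (intro integrable_real_indicator) (auto simp: less_top[symmetric])
    have int1: "integrable (gauss_noise n \<sigma>) (\<lambda>e. 1 - indicat_real (E i) e)" for i
      by (intro Bochner_Integration.integrable_diff integrable_const Ei)
    have ex1: "(\<integral>e. 1 - indicat_real (E i) e \<partial>gauss_noise n \<sigma>) = 1 - P J i" for i
    proof -
      have "prob (carrier_vec n) = 1" "E i \<inter> carrier_vec n = E i" "P J i = prob (E i)"
        using prob_space by (auto simp: E_def P_def)
      then show ?thesis
        using Bochner_Integration.integral_diff[OF integrable_const[of 1] Ei[of i]] by simp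
    qed
    have "lo / hi * (\<sigma>\<^sup>2 * (real q * ln (real m))) / 64 = c * (real q / 8)"
      by (simp add: c_def a2 mult_ac)
    also have "\<dots> \<le> c * (\<Sum>i<q. 1 - P J i)"
      using J(2) c0 by (intro mult_left_mono) (auto simp: sum_subtractf)
    also have "(\<Sum>i<q. 1 - P J i) = (\<integral>e. (\<Sum>i<q. 1 - indicator (E i) e) \<partial>gauss_noise n \<sigma>)"
      by (subst Bochner_Integration.integral_sum) (simp_all add: int1 ex1)
    finally have "ennreal (lo / hi * (\<sigma>\<^sup>2 * (real q * ln (real m))) / 64)
        \<le> ennreal (\<integral>e. c * (\<Sum>i<q. 1 - indicator (E i) e) \<partial>gauss_noise n \<sigma>)"
      by (intro ennreal_leI) simp
    also have "\<dots> = (\<integral>\<^sup>+e. ennreal (c * (\<Sum>i<q. 1 - indicator (E i) e)) \<partial>gauss_noise n \<sigma>)"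
      using c0 by (intro nn_integral_eq_integral[symmetric] Bochner_Integration.integrable_mult_right
          Bochner_Integration.integrable_sum int1 AE_I2 mult_nonneg_nonneg sum_nonneg)
        (auto simp: indicator_def)
    also have "\<dots> \<le> risk n \<sigma> f (\<mu> J)"
      unfolding risk_def by (intro nn_integral_mono ennreal_leI pt) simp
    finally show ?thesis .
  qed
  ultimately show ?thesis by (rule order_trans[rotated])
qed

text \<open>With about $p_0/2$ blocks, the difference of two candidates is still $r$-sparse even for
  $p_0 = r$, and the number $m$ of positions per block is at least two, so that $\ln m$ dominates a multiple of
  $\ln(p/p_0)+1$.\<close>

lemma minimax_risk_ge:
  fixes A :: "real mat"
  assumes A: "A \<in> carrier_mat n p" and \<sigma>: "0 < \<sigma>" and r: "2 \<le> r" "r \<le> p"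
    and \<delta>: "0 < \<delta>" "\<delta> * hi \<le> lo"
    and lo: "0 < lo" "\<And>b. b \<in> carrier_vec p \<Longrightarrow> card (nonzero_entries b) \<le> r \<Longrightarrow> lo * sqn b \<le> sqn (A *\<^sub>v b)"
    and hi: "0 < hi" "\<And>b. b \<in> carrier_vec p \<Longrightarrow> card (nonzero_entries b) \<le> r \<Longrightarrow> sqn (A *\<^sub>v b) \<le> hi * sqn b"
    and p0: "1 \<le> p0" "p0 \<le> r"
  shows "ennreal (\<delta> / 768 * (\<sigma>\<^sup>2 * complexity p p0)) \<le> minimax_risk A r S \<sigma> p0"
proof -
  have dA: "dim_row A = n" using A by auto
  define q where "q = max 1 (p0 div 2)"
  define m where "m = p div q"
  have q: "1 \<le> q" "2 * q \<le> r" "q \<le> p0" using p0 r by (auto simp: q_def)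
  have q3: "p0 \<le> 3 * q" unfolding q_def by linarith
  have qm: "q * m \<le> p" by (simp add: m_def)
  have qp: "2 * q \<le> p" using q r by simp
  have m2: "2 \<le> m" unfolding m_def using qp q by (simp add: less_eq_div_iff_mult_less_eq)
  have pm: "real p / real p0 \<le> real m"
  proof (cases "p0 = 1")
    case True
    then show ?thesis by (simp add: m_def q_def)
  next
    case False
    then have "2 * q \<le> p0" using p0 by (auto simp: q_def)
    have "p < q * (m + 1)" unfolding m_def using q dividend_less_times_div[of q p] by simp
    also have "q * (m + 1) \<le> q * (2 * m)" using m2 by (intro mult_left_mono) auto
    also have "\<dots> \<le> p0 * m" using mult_right_mono[OF \<open>2 * q \<le> p0\<close>, of m] by (simp add: mult_ac)
    finally have "real p \<le> real p0 * real m" by (metis less_imp_le of_nat_le_iff of_nat_mult)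
    then show ?thesis using p0 by (simp add: pos_divide_le_eq mult.commute)
  qed
  have lnm: "(ln (real p / real p0) + 1) / 4 \<le> ln (real m)"
  proof -
    have "ln (real p / real p0) \<le> ln (real m)" using pm p0 r m2 by (subst ln_le_cancel_iff) auto
    moreover have "1 / 2 \<le> ln (real m)"
    proof -
      have "ln 2 \<le> ln (real m)" using m2 by (subst ln_le_cancel_iff) auto
      then show ?thesis using ln2_ge_two_thirds by linarith
    qed
    ultimately show ?thesis by argo
  qed
  have l0: "0 \<le> ln (real p / real p0) + 1" using p0 r by simp
  have "complexity p p0 / 12 \<le> real q * ln (real m)"
  proof -
    have "complexity p p0 / 12 = (real p0 / 3) * ((ln (real p / real p0) + 1) / 4)"
      by (simp add: complexity_def)
    also have "\<dots> \<le> real q * ln (real m)"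
      using q3 lnm l0 by (intro mult_mono) auto
    finally show ?thesis .
  qed
  then have "\<delta> * (\<sigma>\<^sup>2 * (complexity p p0 / 12)) \<le> lo / hi * (\<sigma>\<^sup>2 * (real q * ln (real m)))"
    using \<delta> hi lo complexity_ge[of p0 p] p0 r by (intro mult_mono mult_left_mono) (auto simp: pos_le_divide_eq)
  then have "\<delta> * (\<sigma>\<^sup>2 * (complexity p p0 / 12)) / 64 \<le> lo / hi * (\<sigma>\<^sup>2 * (real q * ln (real m))) / 64"
    by (rule divide_right_mono) simp
  moreover have "\<delta> * (\<sigma>\<^sup>2 * (complexity p p0 / 12)) / 64 = \<delta> / 768 * (\<sigma>\<^sup>2 * complexity p p0)" by simp
  ultimately have "\<delta> / 768 * (\<sigma>\<^sup>2 * complexity p p0) \<le> lo / hi * (\<sigma>\<^sup>2 * (real q * ln (real m))) / 64"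
    by (simp only:)
  then have "ennreal (\<delta> / 768 * (\<sigma>\<^sup>2 * complexity p p0)) \<le> ennreal (lo / hi * (\<sigma>\<^sup>2 * (real q * ln (real m))) / 64)"
    by (rule ennreal_leI)
  also have "\<dots> \<le> minimax_risk A r S \<sigma> p0"
    unfolding minimax_risk_def dA
    by (rule INF_greatest) (rule sup_risk_ge_blocks[OF A \<sigma> lo hi q m2 qm])
  finally show ?thesis .
qed

section \<open>The minimax rate and its attainment\<close>

theorem corollary4:
  fixes X :: "nat \<Rightarrow> real mat" and p r :: "nat \<Rightarrow> nat" and S :: "nat \<Rightarrow> nat set" and \<sigma> :: real
  assumes sigma: "\<sigma> > 0"
    and dim: "\<And>n. X n \<in> carrier_mat n (p n)"
    and rank: "\<And>n. r n = vec_space.rank n (X n)"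
    and rank_lim: "filterlim r at_top sequentially"
    and indpt: "\<And>n J. J \<subseteq> {..<p n} \<Longrightarrow> card J = r n \<Longrightarrow> cols_lin_indpt (X n) J"
    and saturated: "\<And>n. S n \<subseteq> {..<p n} \<and> card (S n) = r n"
    and nearly_orth: "nearly_orthogonal X r"
  shows
    "(\<exists>C1 C2 :: real. \<exists>R :: nat. 0 < C1 \<and> C1 \<le> C2 \<and>
        (\<forall>n. R \<le> r n \<longrightarrow> (\<forall>p0\<in>{1..r n}.
           ennreal (C1 * (\<sigma>\<^sup>2 * real p0 * (ln (real (p n) / real p0) + 1)))
             \<le> minimax_risk (X n) (r n) (S n) \<sigma> p0 \<and>
           minimax_risk (X n) (r n) (S n) \<sigma> p0
             \<le> ennreal (C2 * (\<sigma>\<^sup>2 * real p0 * (ln (real (p n) / real p0) + 1))))))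
     \<and>
     (\<forall>(\<gamma> :: real) (c :: real) (\<pi> :: nat \<Rightarrow> nat \<Rightarrow> real) (Mhat :: nat \<Rightarrow> real vec \<Rightarrow> nat set).
        \<gamma> > 0 \<longrightarrow> c > c_gamma \<gamma> \<longrightarrow>
        (\<forall>n. size_prior (r n) (\<pi> n)) \<longrightarrow>
        (\<forall>n. \<forall>k\<in>{1..<r n}.
           (real k / (real (p n) * exp 1)) powr (c * real k) \<le> \<pi> n k \<and>
           \<pi> n k \<le> (real (p n) / (real k * exp (c_gamma \<gamma>))) ^ k) \<longrightarrow>
        (\<forall>n. exp (- c * real (r n)) \<le> \<pi> n (r n) \<and>
             \<pi> n (r n) \<le> exp (- c_gamma \<gamma> * real (r n))) \<longrightarrow>
        (\<forall>n. map_selector (X n) (r n) (S n) \<sigma> \<gamma> (\<pi> n) (Mhat n)) \<longrightarrow>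
        (\<exists>C>0. \<exists>R :: nat. \<forall>n. R \<le> r n \<longrightarrow> (\<forall>p0\<in>{1..r n}.
           sup_risk (X n) (r n) (S n) \<sigma> (map_estimator (X n) (Mhat n)) p0
             \<le> ennreal C * minimax_risk (X n) (r n) (S n) \<sigma> p0)))"
proof -
  obtain \<delta> where \<delta>: "0 < \<delta>" "\<And>n. 1 \<le> r n \<Longrightarrow> \<delta> \<le> tau (X n) (r n)"
    using nearly_orth by (auto simp: nearly_orthogonal_def)
  have S: "S n \<subseteq> {..<p n}" "card (S n) = r n" for n using saturated by auto
  have rp: "r n \<le> p n" for n using card_mono[OF _ S(1)[of n]] S(2)[of n] by simp
  have lower: "ennreal (\<delta> / 768 * (\<sigma>\<^sup>2 * complexity (p n) p0)) \<le> minimax_risk (X n) (r n) (S n) \<sigma> p0"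
    if n: "2 \<le> r n" and p0: "p0 \<in> {1..r n}" for n p0
  proof -
    have "1 \<le> r n" "1 \<le> p n" using n rp[of n] by auto
    from sparse_eigenvalue_bounds[OF dim this \<delta>(1) \<delta>(2)[OF this(1)]]
    obtain lo hi where "0 < lo" "0 < hi" "\<delta> * hi \<le> lo"
      "\<And>b. b \<in> carrier_vec (p n) \<Longrightarrow> card (nonzero_entries b) \<le> r n \<Longrightarrow> lo * sqn b \<le> sqn (X n *\<^sub>v b)"
      "\<And>b. b \<in> carrier_vec (p n) \<Longrightarrow> card (nonzero_entries b) \<le> r n \<Longrightarrow> sqn (X n *\<^sub>v b) \<le> hi * sqn b"
      by blast
    then show ?thesis using minimax_risk_ge[OF dim sigma n rp \<delta>(1)] p0 by simp
  qed
  have positive_definite: "\<exists>lo>0. \<forall>b\<in>carrier_vec (p n). card (nonzero_entries b) \<le> r n \<longrightarrow> lo * sqn b \<le> sqn (X n *\<^sub>v b)"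
    if n: "2 \<le> r n" for n
  proof -
    have "1 \<le> r n" "1 \<le> p n" using n rp[of n] by auto
    from sparse_eigenvalue_bounds[OF dim this \<delta>(1) \<delta>(2)[OF this(1)]] show ?thesis by metis
  qed
  define K where "K = map_constant 1 (c_gamma 1)"
  have upper: "minimax_risk (X n) (r n) (S n) \<sigma> p0 \<le> ennreal (max (\<delta> / 768) K * (\<sigma>\<^sup>2 * complexity (p n) p0))"
    if n: "2 \<le> r n" and p0: "p0 \<in> {1..r n}" for n p0
  proof -
    obtain lo where lo: "0 < lo" "\<And>b. b \<in> carrier_vec (p n) \<Longrightarrow> card (nonzero_entries b) \<le> r n \<Longrightarrow>
        lo * sqn b \<le> sqn (X n *\<^sub>v b)" using positive_definite[OF n] by blast
    have "minimax_risk (X n) (r n) (S n) \<sigma> p0 \<le> ennreal (K * (\<sigma>\<^sup>2 * complexity (p n) p0))"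
      unfolding K_def by (rule minimax_risk_le[OF dim sigma n rp S lo]) (use p0 in auto)
    also have "\<dots> \<le> ennreal (max (\<delta> / 768) K * (\<sigma>\<^sup>2 * complexity (p n) p0))"
      using complexity_ge[of p0 "p n"] p0 rp[of n] by (intro ennreal_leI mult_right_mono) auto
    finally show ?thesis .
  qed
  have cx: "\<sigma>\<^sup>2 * complexity (p n) p0 = \<sigma>\<^sup>2 * real p0 * (ln (real (p n) / real p0) + 1)" for n p0
    by (simp add: complexity_def)
  show ?thesis
  proof (intro conjI allI impI, goal_cases)
    case 1
    show ?case
      using \<delta>(1) lower upper unfolding cx
      by (intro exI[of _ "\<delta> / 768"] exI[of _ "max (\<delta> / 768) K"] exI[of _ 2]) auto
  next
    case (2 \<gamma> c \<pi> Mhat)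
    have "0 \<le> c_gamma \<gamma>" by (simp add: c_gamma_def)
    then have c: "0 \<le> c" using 2(2) by linarith
    have prior: "prior_in_range (p n) (r n) (c_gamma \<gamma>) c (\<pi> n)" for n
      using 2(3-5) by (simp add: prior_in_range_def)
    define B where "B = map_constant \<gamma> c"
    have B: "0 < B" unfolding B_def using 2(1) c by (rule map_constant_pos)
    have "sup_risk (X n) (r n) (S n) \<sigma> (map_estimator (X n) (Mhat n)) p0
        \<le> ennreal (B * 768 / \<delta>) * minimax_risk (X n) (r n) (S n) \<sigma> p0"
      if n: "2 \<le> r n" and p0: "p0 \<in> {1..r n}" for n p0
    proof -
      obtain lo where lo: "0 < lo" "\<And>b. b \<in> carrier_vec (p n) \<Longrightarrow> card (nonzero_entries b) \<le> r n \<Longrightarrow>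
          lo * sqn b \<le> sqn (X n *\<^sub>v b)" using positive_definite[OF n] by blast
      have "sup_risk (X n) (r n) (S n) \<sigma> (map_estimator (X n) (Mhat n)) p0
          \<le> ennreal (B * (\<sigma>\<^sup>2 * complexity (p n) p0))"
        unfolding B_def
        by (rule sup_risk_map_le[OF dim sigma n rp S lo 2(1) c prior]) (use 2(6) p0 in auto)
      also have "\<dots> = ennreal (B * 768 / \<delta>) * ennreal (\<delta> / 768 * (\<sigma>\<^sup>2 * complexity (p n) p0))"
        using \<delta>(1) B by (subst ennreal_mult'[symmetric]) auto
      also have "\<dots> \<le> ennreal (B * 768 / \<delta>) * minimax_risk (X n) (r n) (S n) \<sigma> p0"
        by (intro mult_left_mono lower n p0) simp
      finally show ?thesis .
    qed
    moreover have "0 < B * 768 / \<delta>" using B \<delta>(1) by simp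
    ultimately show ?case by blast
  qed
qed

end
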